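(* Let $1\le m\le n$ and $p\ge 1$ be integers, and let $\mathbf s_1,\dots,\mathbf s_m$ be a partial frame in involution defined on an open subset $\mathcal O\subset\mathbb R^{n+p}$. Let $\Lambda\subset\mathcal O$ be an $(n-m)$-dimensional embedded submanifold such that for every point $z\in\Lambda$ $$\operatorname{span}_{\mathbb R}\{\mathbf s_1|_z,\dots,\mathbf s_m|_z\}\oplus T_z\Lambda\cong\mathbb R^n$$ (i.e. the sum of these two subspaces of $T_z\mathbb R^{n+p}$ is direct and $n$-dimensional). Then for every point $\bar z\in\Lambda$ there exist an open neighborhood $\mathcal O_{\bar z}\subset\mathcal O$ of $\bar z$ and an $n$-dimensional submanifold $\Gamma_{\bar z}$ of $\mathbb R^{n+p}$ such that: 1) $\Lambda\cap\mathcal O_{\bar z}=\Lambda\cap\Gamma_{\bar z}$; 2) $\mathbf s_i|_z\in T_z\Gamma_{\bar z}$ for all $i=1,\dots,m$ and every point $z\in\Gamma_{\bar z}$. The manifold $\Gamma_{\bar z}$ is locally unique: if $\Gamma'_{\bar z}$ is another $n$-dimensional manifold satisfying the two conditions above, then $\Gamma_{\bar z}\cap\Gamma'_{\bar z}$ is also an $n$-dimensional manifold satisfying these conditions.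
   Context: All objects are $C^\infty$-smooth. A partial frame on an open set $\mathcal O$ is a set of smooth vector fields that are linearly independent at every point of $\mathcal O$. A partial frame $\mathbf s_1,\dots,\mathbf s_m$ is in involution if every Lie bracket $[\mathbf s_i,\mathbf s_j]$ lies in the $C^\infty(\mathcal O)$-span of $\mathbf s_1,\dots,\mathbf s_m$. (In the uniqueness part, the conditions for $\Gamma'_{\bar z}$ and for the intersection are understood with respect to some, possibly different, open neighborhood of $\bar z$.)
   Formalization: Uniqueness is localized: the intersection of Γ and Γ' is shown to be an n-dimensional manifold satisfying the conditions only after restricting to some open neighborhood of the point; unrestricted it can fail, since far from the point Γ' may contain another piece crossing Γ transversally. *)

theory Defs
  imports "HOL-Analysis.Analysis"
begin

text \<open>
  \<open>C\<^sup>k\<close> and \<open>C\<^sup>\<infinity>\<close> maps on a set \<open>S\<close>, which is open in all uses below (so that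
  \<open>frechet_derivative f (at x)\<close> only depends on \<open>f\<close> restricted to \<open>S\<close>).
\<close>

primrec higher_differentiable_on ::
    "nat \<Rightarrow> 'a::real_normed_vector set \<Rightarrow> ('a \<Rightarrow> 'b::real_normed_vector) \<Rightarrow> bool" where
  "higher_differentiable_on 0 S f \<longleftrightarrow> continuous_on S f"
| "higher_differentiable_on (Suc k) S f \<longleftrightarrow>
     (\<forall>x\<in>S. f differentiable (at x)) \<and>
     (\<forall>v. higher_differentiable_on k S (\<lambda>x. frechet_derivative f (at x) v))"

definition smooth_on ::
    "'a::real_normed_vector set \<Rightarrow> ('a \<Rightarrow> 'b::real_normed_vector) \<Rightarrow> bool" where
  "smooth_on S f \<longleftrightarrow> (\<forall>k. higher_differentiable_on k S f)"

definition diffeomorphism_between ::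
    "'a::real_normed_vector set \<Rightarrow> 'b::real_normed_vector set \<Rightarrow> ('a \<Rightarrow> 'b) \<Rightarrow> ('b \<Rightarrow> 'a) \<Rightarrow> bool" where
  "diffeomorphism_between U V f g \<longleftrightarrow>
     open U \<and> open V \<and> f ` U = V \<and> g ` V = U \<and>
     (\<forall>x\<in>U. g (f x) = x) \<and> (\<forall>y\<in>V. f (g y) = y) \<and>
     smooth_on U f \<and> smooth_on V g"

text \<open>Embedded \<open>d\<close>-dimensional submanifolds of a Euclidean space, by local slice charts.\<close>

definition embedded_submanifold :: "nat \<Rightarrow> 'a::euclidean_space set \<Rightarrow> bool" where
  "embedded_submanifold d M \<longleftrightarrow>
     (\<forall>z\<in>M. \<exists>U V f g (E::'a set). z \<in> U \<and> diffeomorphism_between U V f g \<and>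
        subspace E \<and> dim E = d \<and> f ` (M \<inter> U) = E \<inter> V)"

text \<open>
  The tangent space at \<open>z\<close> is the set of velocities at \<open>0\<close> of smooth curves in \<open>M\<close>
  passing through \<open>z\<close> at time \<open>0\<close>.
\<close>

definition tangent_space :: "'a::euclidean_space set \<Rightarrow> 'a \<Rightarrow> 'a set" where
  "tangent_space M z =
     {v. \<exists>(c :: real \<Rightarrow> 'a) e. e > 0 \<and> smooth_on {-e<..<e} c \<and> c ` {-e<..<e} \<subseteq> M \<and>
         c 0 = z \<and> (c has_vector_derivative v) (at 0)}"

text \<open>
  A vector field is represented by its principal part. In these coordinates
  \<open>[X, Y] = DY(X) - DX(Y)\<close>, i.e. \<open>[X, Y] h = X (Y h) - Y (X h)\<close> as derivations.
\<close>

definition lie_bracket :: "('a::euclidean_space \<Rightarrow> 'a) \<Rightarrow> ('a \<Rightarrow> 'a) \<Rightarrow> 'a \<Rightarrow> 'a" where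
  "lie_bracket X Y z = frechet_derivative Y (at z) (X z) - frechet_derivative X (at z) (Y z)"

text \<open>
  Partial frames \<open>s 1, \<dots>, s m\<close>; injectivity of the indexing at each point is needed because
  \<open>independent\<close> is a predicate on sets rather than on families.
\<close>

definition partial_frame :: "'a::euclidean_space set \<Rightarrow> nat \<Rightarrow> (nat \<Rightarrow> 'a \<Rightarrow> 'a) \<Rightarrow> bool" where
  "partial_frame \<O> m s \<longleftrightarrow>
     (\<forall>i\<in>{1..m}. smooth_on \<O> (s i)) \<and>
     (\<forall>z\<in>\<O>. inj_on (\<lambda>i. s i z) {1..m} \<and> independent ((\<lambda>i. s i z) ` {1..m}))"

definition in_involution :: "'a::euclidean_space set \<Rightarrow> nat \<Rightarrow> (nat \<Rightarrow> 'a \<Rightarrow> 'a) \<Rightarrow> bool" where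
  "in_involution \<O> m s \<longleftrightarrow>
     (\<forall>i\<in>{1..m}. \<forall>j\<in>{1..m}. \<exists>c :: nat \<Rightarrow> 'a \<Rightarrow> real.
        (\<forall>k\<in>{1..m}. smooth_on \<O> (c k)) \<and>
        (\<forall>z\<in>\<O>. lie_bracket (s i) (s j) z = (\<Sum>k=1..m. c k z *\<^sub>R s k z)))"

text \<open>
  \<open>\<Gamma>\<close> is an \<open>n\<close>-dimensional submanifold with \<open>\<Lambda> \<inter> U = \<Lambda> \<inter> \<Gamma>\<close> to which all \<open>s i\<close> are tangent,
  with respect to the open neighbourhood \<open>U\<close> of \<open>z\<close>. The inclusion \<open>\<Gamma> \<subseteq> \<O>\<close> is implicit in the
  tangency condition, since the fields live on \<open>\<O>\<close> only (the values of the total functions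
  \<open>s i\<close> outside \<open>\<O>\<close> are meaningless).
\<close>

definition integral_extension ::
    "'a::euclidean_space set \<Rightarrow> nat \<Rightarrow> (nat \<Rightarrow> 'a \<Rightarrow> 'a) \<Rightarrow> 'a set \<Rightarrow> nat \<Rightarrow> 'a \<Rightarrow> 'a set \<Rightarrow> 'a set \<Rightarrow> bool"
  where
  "integral_extension \<O> m s \<Lambda> n z U \<Gamma> \<longleftrightarrow>
     open U \<and> z \<in> U \<and> U \<subseteq> \<O> \<and>
     embedded_submanifold n \<Gamma> \<and> \<Gamma> \<subseteq> \<O> \<and>
     \<Lambda> \<inter> U = \<Lambda> \<inter> \<Gamma> \<and>
     (\<forall>i\<in>{1..m}. \<forall>w\<in>\<Gamma>. s i w \<in> tangent_space \<Gamma> w)"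

end

(*
  Near a point of Lambda choose a linear projection P whose range is the span of the frame at that
  point and which vanishes on the tangent space E of Lambda. The frame can be replaced by commuting
  fields z |-> A z w with P (A z w) = P w. Following A v for unit time from the point of Lambda with
  coordinate e defines a map Psi (v + e), where e ranges over the kernel of P. The solution depends
  smoothly on v and e, its derivative at 0 is the identity, and commutativity forces
  D Psi (p) w = A (Psi p) w for w in the range of P. Hence Psi is a local diffeomorphism which carries
  range P + E to the desired Gamma. Any other solution Gamma' contains the integral curves of the
  fields A v that start on Lambda, and these sweep out Gamma.
*)

theory Submission
  imports Defs
begin

section \<open>Families of differentiable maps depending continuously on a parameter\<close>

text \<open>The analytic obstacle is that a solution of \<open>\<phi>' = A(\<phi>) p\<close> must be
  smooth in \<open>p\<close> to every order. The equation is read as a Volterra integral equation on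
  the fixed interval \<open>[0,1]\<close>, and the vector \<open>p\<close> is made small instead of
  the time, until the right-hand side has Lipschitz constant 1/2 in the state. An error is then
  compared with itself at the time where it is largest: half of it is absorbed, and what remains is
  a linearisation error, or zero when two solutions are compared.

  One radial equation replaces a composition of the flows of the single fields. All directions
  \<open>w\<close> of \<open>range P\<close> are then treated alike, and a single comparison of two
  solutions of the linearised equation gives \<open>D Psi (p) w\<close> at every \<open>p\<close>
  near 0.

  Existence is proved for all small parameter neighbourhoods at once, so that the intersection in
  the uniqueness part can be recognised as the same construction over a smaller ball.\<close>

text \<open>
  \<open>f t\<close> is \<open>C\<^sup>k\<close> on \<open>S\<close> for each \<open>t \<in> I\<close>, with all partial derivatives jointly continuous in \<open>(t, x)\<close>.
  The variable \<open>t\<close> is the time of a differential equation and is never differentiated, so \<open>I\<close> may be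
  a compact interval.
\<close>

primrec fam_Ck ::
    "nat \<Rightarrow> 'c::topological_space set \<Rightarrow> 'a::real_normed_vector set \<Rightarrow>
      ('c \<Rightarrow> 'a \<Rightarrow> 'b::real_normed_vector) \<Rightarrow> bool" where
  "fam_Ck 0 I S f \<longleftrightarrow> continuous_on (I \<times> S) (\<lambda>(t, x). f t x)"
| "fam_Ck (Suc k) I S f \<longleftrightarrow>
     continuous_on (I \<times> S) (\<lambda>(t, x). f t x) \<and>
     (\<forall>t\<in>I. \<forall>x\<in>S. f t differentiable at x) \<and>
     (\<forall>v. fam_Ck k I S (\<lambda>t x. frechet_derivative (f t) (at x) v))"

lemma fam_Ck_continuous: "fam_Ck k I S f \<Longrightarrow> continuous_on (I \<times> S) (\<lambda>(t, x). f t x)"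
  by (cases k) auto

lemma fam_Ck_has_derivative:
  assumes "fam_Ck (Suc k) I S f" "t \<in> I" "x \<in> S"
  shows "(f t has_derivative frechet_derivative (f t) (at x)) (at x)"
  using assms frechet_derivative_works by auto

lemma fam_Ck_cong:
  fixes f g :: "'c::topological_space \<Rightarrow> 'a::real_normed_vector \<Rightarrow> 'b::real_normed_vector"
  assumes "open S" "\<And>t x. t \<in> I \<Longrightarrow> x \<in> S \<Longrightarrow> f t x = g t x" "fam_Ck k I S f"
  shows "fam_Ck k I S g"
  using assms(2,3)
proof (induction k arbitrary: f g)
  case 0
  have "continuous_on (I \<times> S) (\<lambda>(t, x). f t x) \<longleftrightarrow> continuous_on (I \<times> S) (\<lambda>(t, x). g t x)"
    by (rule continuous_on_cong) (use 0 in auto)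
  then show ?case using 0 by simp
next
  case (Suc k)
  have "continuous_on (I \<times> S) (\<lambda>(t, x). f t x) \<longleftrightarrow> continuous_on (I \<times> S) (\<lambda>(t, x). g t x)"
    by (rule continuous_on_cong) (use Suc in auto)
  moreover have d: "(g t has_derivative frechet_derivative (f t) (at x)) (at x)"
    if "t \<in> I" "x \<in> S" for t x
    by (rule has_derivative_transform_within_open[OF fam_Ck_has_derivative[OF Suc.prems(2) that] assms(1)])
      (use that Suc.prems in auto)
  moreover have "fam_Ck k I S (\<lambda>t x. frechet_derivative (g t) (at x) v)" for v
    by (rule Suc.IH[of "\<lambda>t x. frechet_derivative (f t) (at x) v"])
      (use Suc.prems frechet_derivative_at[OF d] in auto)
  ultimately show ?case
    using Suc.prems by (auto simp: differentiable_def)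
qed

text \<open>Allows a derivative \<open>f'\<close> to be named outright: uniqueness of derivatives
  identifies it with \<open>frechet_derivative\<close>, and \<open>S\<close> being open lets this
  equality pass to the higher orders.\<close>

lemma fam_Ck_SucI:
  fixes f :: "'c::topological_space \<Rightarrow> 'a::real_normed_vector \<Rightarrow> 'b::real_normed_vector"
  assumes S: "open S" and c: "continuous_on (I \<times> S) (\<lambda>(t, x). f t x)"
    and d: "\<And>t x. t \<in> I \<Longrightarrow> x \<in> S \<Longrightarrow> (f t has_derivative f' t x) (at x)"
    and k: "\<And>v. fam_Ck k I S (\<lambda>t x. f' t x v)"
  shows "fam_Ck (Suc k) I S f"
proof -
  have "fam_Ck k I S (\<lambda>t x. frechet_derivative (f t) (at x) v)" for v
    by (rule fam_Ck_cong[OF S _ k[of v]]) (use frechet_derivative_at[OF d] in auto)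
  then show ?thesis using c d by (auto simp: differentiable_def)
qed

lemma fam_Ck_subset:
  "fam_Ck k I S f \<Longrightarrow> J \<subseteq> I \<Longrightarrow> T \<subseteq> S \<Longrightarrow> fam_Ck k J T f"
proof (induction k arbitrary: f)
  case 0
  then show ?case by (auto elim!: continuous_on_subset)
next
  case (Suc k)
  have "continuous_on (J \<times> T) (\<lambda>(t, x). f t x)"
    using Suc.prems by (auto elim!: continuous_on_subset)
  then show ?case using Suc by (auto simp: subset_iff)
qed

lemma fam_Ck_Suc_le: "fam_Ck (Suc k) I S f \<Longrightarrow> fam_Ck k I S f"
  by (induction k arbitrary: f) auto

lemma fam_Ck_const_time:
  "higher_differentiable_on k S f \<Longrightarrow> fam_Ck k I S (\<lambda>_. f)"
proof (induction k arbitrary: f)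
  case 0
  then show ?case
    by (auto simp: case_prod_unfold intro!: continuous_on_compose2[of S f _ snd] continuous_intros)
next
  case (Suc k)
  have "continuous_on S f"
    using Suc.prems by (simp add: continuous_at_imp_continuous_on differentiable_imp_continuous_within)
  then have "continuous_on (I \<times> S) (\<lambda>(t, x). f x)"
    by (auto simp: case_prod_unfold intro!: continuous_on_compose2[of S f _ snd] continuous_intros)
  then show ?case using Suc by auto
qed

lemma fam_Ck_imp_higher_differentiable_on:
  "fam_Ck k I S f \<Longrightarrow> t \<in> I \<Longrightarrow> higher_differentiable_on k S (f t)"
proof (induction k arbitrary: f)
  case 0
  have "continuous_on S (\<lambda>x. (\<lambda>(t, x). f t x) (t, x))"
    by (rule continuous_on_compose2[of "I \<times> S"]) (use 0 in \<open>auto intro!: continuous_intros\<close>)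
  then show ?case by simp
next
  case (Suc k)
  then show ?case by auto
qed

lemma fam_Ck_const: "open S \<Longrightarrow> continuous_on I c \<Longrightarrow> fam_Ck k I S (\<lambda>t x. c t)"
proof (induction k arbitrary: c)
  case 0
  then show ?case
    by (auto simp: case_prod_unfold intro!: continuous_on_compose2[of I c _ fst] continuous_intros)
next
  case (Suc k)
  have "continuous_on (I \<times> S) (\<lambda>(t, x). c t)" using Suc
    by (auto simp: case_prod_unfold intro!: continuous_on_compose2[of I c _ fst] continuous_intros)
  then show ?case
    by (intro fam_Ck_SucI[where f' = "\<lambda>_ _ _. 0"] Suc) auto
qed

lemma fam_Ck_bounded_linear:
  assumes "open S" "bounded_linear L" "fam_Ck k I S f"
  shows "fam_Ck k I S (\<lambda>t x. L (f t x))"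
  using assms(3)
proof (induction k arbitrary: f)
  case 0
  then show ?case
    using linear_continuous_on[OF assms(2)]
    by (auto simp: case_prod_unfold intro: continuous_on_compose2)
next
  case (Suc k)
  have "continuous_on (I \<times> S) (\<lambda>(t, x). L (f t x))"
    using Suc.prems linear_continuous_on[OF assms(2)]
    by (auto simp: case_prod_unfold intro: continuous_on_compose2)
  then show ?case
    using Suc.prems Suc.IH fam_Ck_has_derivative[OF Suc.prems]
    by (intro fam_Ck_SucI[where f' = "\<lambda>t x v. L (frechet_derivative (f t) (at x) v)"] assms(1))
      (auto intro!: bounded_linear.has_derivative[OF assms(2)])
qed

lemma fam_Ck_ident: "open S \<Longrightarrow> fam_Ck k I S (\<lambda>t x. x)"
proof (induction k)
  case 0
  then show ?case by (auto simp: case_prod_unfold intro!: continuous_intros)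
next
  case (Suc k)
  have "continuous_on (I \<times> S) (\<lambda>(t, x). x)"
    by (auto simp: case_prod_unfold intro!: continuous_intros)
  then show ?case
    by (intro fam_Ck_SucI[where f' = "\<lambda>t x v. v"] Suc fam_Ck_const) (auto simp: Suc)
qed

lemma fam_Ck_linear:
  fixes L :: "'a::euclidean_space \<Rightarrow> 'b::real_normed_vector"
  assumes "open S" "linear L" shows "fam_Ck k I S (\<lambda>t. L)"
  by (rule fam_Ck_bounded_linear[OF assms(1) linear_conv_bounded_linear[THEN iffD1, OF assms(2)] fam_Ck_ident[OF assms(1)]])

lemma fam_Ck_add:
  assumes "open S" "fam_Ck k I S f" "fam_Ck k I S g"
  shows "fam_Ck k I S (\<lambda>t x. f t x + g t x)"
  using assms(2,3)
proof (induction k arbitrary: f g)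
  case 0
  then show ?case by (auto simp: case_prod_unfold intro!: continuous_on_add)
next
  case (Suc k)
  have "continuous_on (I \<times> S) (\<lambda>(t, x). f t x + g t x)"
    using Suc.prems by (auto simp: case_prod_unfold intro!: continuous_on_add)
  then show ?case
    using Suc.prems Suc.IH fam_Ck_has_derivative[OF Suc.prems(1)] fam_Ck_has_derivative[OF Suc.prems(2)]
    by (intro fam_Ck_SucI[where f' = "\<lambda>t x v. frechet_derivative (f t) (at x) v + frechet_derivative (g t) (at x) v"] assms(1))
      (auto intro!: has_derivative_add)
qed

lemma fam_Ck_sum:
  assumes "open S" "\<And>i. i \<in> A \<Longrightarrow> fam_Ck k I S (f i)"
  shows "fam_Ck k I S (\<lambda>t x. \<Sum>i\<in>A. f i t x)"
  using assms(2)
  by (induction A rule: infinite_finite_induct)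
    (auto intro!: fam_Ck_const fam_Ck_add assms(1) continuous_intros)

lemma fam_Ck_bilinear:
  assumes S: "open S" and bl: "bounded_bilinear B" and "fam_Ck k I S f" "fam_Ck k I S g"
  shows "fam_Ck k I S (\<lambda>t x. B (f t x) (g t x))"
  using assms(3,4)
proof (induction k arbitrary: f g)
  case 0
  then show ?case by (auto simp: case_prod_unfold intro: bounded_bilinear.continuous_on[OF bl])
next
  case (Suc k)
  have "continuous_on (I \<times> S) (\<lambda>(t, x). B (f t x) (g t x))"
    using Suc.prems by (auto simp: case_prod_unfold intro: bounded_bilinear.continuous_on[OF bl])
  moreover note fam_Ck_has_derivative[OF Suc.prems(1)] fam_Ck_has_derivative[OF Suc.prems(2)]
    Suc.prems[THEN fam_Ck_Suc_le]
  ultimately show ?case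
    using Suc.prems Suc.IH
    by (intro fam_Ck_SucI[where f' = "\<lambda>t x v. B (f t x) (frechet_derivative (g t) (at x) v)
         + B (frechet_derivative (f t) (at x) v) (g t x)"] S fam_Ck_add bounded_bilinear.FDERIV[OF bl]) auto
qed

lemma linear_Basis_sum:
  assumes "linear L" shows "L v = (\<Sum>b\<in>Basis. (v \<bullet> b) *\<^sub>R L b)"
  by (metis (no_types, lifting) assms euclidean_representation linear_sum linear_cmul sum.cong)

text \<open>The chain rule yields a derivative in a direction that varies with \<open>x\<close>,
  while \<open>fam_Ck\<close> speaks of fixed directions only. Expanding the direction over
  \<open>Basis\<close> turns it into a sum of products to which the induction hypothesis and the
  product rule apply.\<close>

lemma fam_Ck_compose:
  fixes f :: "'c::topological_space \<Rightarrow> 'a::real_normed_vector \<Rightarrow> 'b::euclidean_space"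
  assumes S: "open S" and Z: "open Z" and "fam_Ck k I Z F" "fam_Ck k I S f"
    and "\<And>t x. t \<in> I \<Longrightarrow> x \<in> S \<Longrightarrow> f t x \<in> Z"
  shows "fam_Ck k I S (\<lambda>t x. F t (f t x))"
  using assms(3-)
proof (induction k arbitrary: f F)
  case 0
  have "continuous_on (I \<times> S) (\<lambda>p. (\<lambda>(t, z). F t z) (fst p, (\<lambda>(t, x). f t x) p))"
    by (rule continuous_on_compose2[of "I \<times> Z"]) (use 0 in \<open>auto intro!: continuous_intros\<close>)
  then show ?case by (simp add: case_prod_unfold)
next
  case (Suc k)
  have "continuous_on (I \<times> S) (\<lambda>p. (\<lambda>(t, z). F t z) (fst p, (\<lambda>(t, x). f t x) p))"
    by (rule continuous_on_compose2[of "I \<times> Z"]) (use Suc in \<open>auto intro!: continuous_intros\<close>)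
  then have c: "continuous_on (I \<times> S) (\<lambda>(t, x). F t (f t x))" by (simp add: case_prod_unfold)
  note dF = fam_Ck_has_derivative[OF Suc.prems(1)] and df = fam_Ck_has_derivative[OF Suc.prems(2)]
  show ?case
  proof (rule fam_Ck_SucI[OF S c])
    fix t x assume tx: "t \<in> I" "x \<in> S"
    show "((\<lambda>x. F t (f t x)) has_derivative (\<lambda>v. \<Sum>b\<in>Basis. (frechet_derivative (f t) (at x) v \<bullet> b) *\<^sub>R
        frechet_derivative (F t) (at (f t x)) b)) (at x)"
      using linear_Basis_sum[OF has_derivative_linear[OF dF[OF tx(1) Suc.prems(3)[OF tx]]]]
      by (intro has_derivative_eq_rhs[OF diff_chain_at[OF df[OF tx] dF[OF tx(1) Suc.prems(3)[OF tx]], unfolded o_def]] ext)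
  next
    fix v
    have "fam_Ck k I S (\<lambda>t x. frechet_derivative (F t) (at (f t x)) b)" for b
      by (rule Suc.IH[where F = "\<lambda>t z. frechet_derivative (F t) (at z) b"])
        (use Suc.prems fam_Ck_Suc_le[OF Suc.prems(2)] in auto)
    then show "fam_Ck k I S (\<lambda>t x. \<Sum>b\<in>Basis. (frechet_derivative (f t) (at x) v \<bullet> b) *\<^sub>R
        frechet_derivative (F t) (at (f t x)) b)"
      using Suc.prems
      by (intro fam_Ck_sum S fam_Ck_bilinear[OF S bounded_bilinear_scaleR]
        fam_Ck_bounded_linear[OF S bounded_linear_inner_left]) auto
  qed
qed

lemma fam_Ck_inverse:
  fixes f :: "'c::topological_space \<Rightarrow> 'a::real_normed_vector \<Rightarrow> real"
  assumes S: "open S" and "fam_Ck k I S f" and nz: "\<And>t x. t \<in> I \<Longrightarrow> x \<in> S \<Longrightarrow> f t x \<noteq> 0"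
  shows "fam_Ck k I S (\<lambda>t x. inverse (f t x))"
  using assms(2)
proof (induction k)
  case 0
  then show ?case using nz by (auto simp: case_prod_unfold intro!: continuous_on_inverse)
next
  case (Suc k)
  have c: "continuous_on (I \<times> S) (\<lambda>(t, x). inverse (f t x))"
    using Suc.prems nz by (auto simp: case_prod_unfold intro!: continuous_on_inverse)
  have "fam_Ck k I S (\<lambda>t x. inverse (f t x))"
    using Suc fam_Ck_Suc_le by blast
  then show ?case
    using Suc.prems fam_Ck_has_derivative[OF Suc.prems] nz
    by (intro fam_Ck_SucI[where f' = "\<lambda>t x v. - (inverse (f t x) * frechet_derivative (f t) (at x) v * inverse (f t x))"]
      c S fam_Ck_bounded_linear[OF S bounded_linear_minus[OF bounded_linear_ident]]
      fam_Ck_bilinear[OF S bounded_bilinear_mult] Deriv.has_derivative_inverse) auto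
qed

lemma fam_Ck_prod:
  fixes f :: "'i \<Rightarrow> 'c::topological_space \<Rightarrow> 'a::real_normed_vector \<Rightarrow> real"
  assumes "open S" "\<And>i. i \<in> A \<Longrightarrow> fam_Ck k I S (f i)"
  shows "fam_Ck k I S (\<lambda>t x. \<Prod>i\<in>A. f i t x)"
  using assms(2)
  by (induction A rule: infinite_finite_induct)
    (auto intro!: fam_Ck_const fam_Ck_bilinear[OF assms(1) bounded_bilinear_mult] assms(1) continuous_intros)

lemma fam_Ck_Pair:
  assumes S: "open S" and "fam_Ck k I S f" "fam_Ck k I S g"
  shows "fam_Ck k I S (\<lambda>t x. (f t x, g t x))"
proof -
  have "fam_Ck k I S (\<lambda>t x. (f t x, 0) + (0, g t x))"
    using assms
    by (intro fam_Ck_add S fam_Ck_bounded_linear[OF S, where L = "\<lambda>x. (x, 0)"] fam_Ck_bounded_linear[OF S, where L = "\<lambda>x. (0, x)"]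
      bounded_linear_Pair bounded_linear_ident bounded_linear_zero)
  then show ?thesis by simp
qed

lemma fam_Ck_derivative:
  "fam_Ck (Suc k) I S f \<Longrightarrow> fam_Ck k I S (\<lambda>t x. frechet_derivative (f t) (at x) v)"
  by simp

section \<open>Integrals with variable upper limit and their derivatives in the parameter\<close>

lemma continuous_on_slice:
  assumes "continuous_on (I \<times> S) (\<lambda>(t, x). f t x)" "x \<in> S"
  shows "continuous_on I (\<lambda>t. f t x)"
proof -
  have "continuous_on I (\<lambda>t. (\<lambda>(t, x). f t x) (t, x))"
    by (rule continuous_on_compose2[OF assms(1)]) (use assms in \<open>auto intro!: continuous_intros\<close>)
  then show ?thesis by simp
qed

text \<open>Moves the variable limit into the integrand, so that joint continuity in
  \<open>t\<close> and a parameter reduces to that of an integral over the fixed interval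
  \<open>{0..1}\<close>.\<close>

lemma integral_rescale:
  fixes g :: "real \<Rightarrow> 'b::banach"
  assumes "continuous_on {0..1} g" "t \<in> {0..1}"
  shows "integral {0..t} g = t *\<^sub>R integral {0..1} (\<lambda>s. g (t * s))"
proof (cases "t = 0")
  case False
  then have t: "t > 0" using assms by auto
  have "g integrable_on {0..t}"
    by (rule integrable_continuous_real, rule continuous_on_subset[OF assms(1)]) (use assms in auto)
  then have "(g has_integral integral {0..t} g) {0..t}" by (rule integrable_integral)
  from has_integral_stretch_real[OF this False]
  have "((\<lambda>x. g (t * x)) has_integral (1 / \<bar>t\<bar>) *\<^sub>R integral {0..t} g) {0..1}"
    using t by (simp add: image_divide_atLeastAtMost)
  then have "integral {0..1} (\<lambda>x. g (t * x)) = (1 / \<bar>t\<bar>) *\<^sub>R integral {0..t} g"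
    by (rule integral_unique)
  then show ?thesis using t by simp
qed simp

text \<open>Time intervals have length at most one, so a bound of the integrand bounds the integral;
  a constant 1/2 in the integrand survives integration.\<close>

lemma norm_integral_time_le:
  fixes g :: "real \<Rightarrow> 'b::banach"
  assumes "continuous_on {0..1} g" "t \<in> {0..1}" "\<And>s. s \<in> {0..1} \<Longrightarrow> norm (g s) \<le> B"
  shows "norm (integral {0..t} g) \<le> B"
proof -
  have "0 \<le> B" using assms(3)[of 0] norm_ge_zero[of "g 0"] by (simp del: norm_ge_zero)
  have "norm (integral {0..t} g) \<le> B * (t - 0)"
    by (rule integral_bound)
      (use assms in \<open>auto intro: continuous_on_subset[OF assms(1)]\<close>)
  also have "\<dots> \<le> B" using assms(2) \<open>0 \<le> B\<close> by (simp add: mult_left_le)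
  finally show ?thesis .
qed

lemma continuous_on_time_integral:
  fixes f :: "real \<Rightarrow> 'a::topological_space \<Rightarrow> 'b::banach"
  assumes c: "continuous_on ({0..1} \<times> S) (\<lambda>(t, x). f t x)"
  shows "continuous_on ({0..1} \<times> S) (\<lambda>(t, x). integral {0..t} (\<lambda>s. f s x))"
proof -
  have "continuous_on (({0..1} \<times> S) \<times> cbox 0 1) (\<lambda>q. (\<lambda>(t, x). f t x) (fst (fst q) * snd q, snd (fst q)))"
    by (rule continuous_on_compose2[OF c]) (auto intro!: continuous_intros simp: mult_le_one)
  then have "continuous_on ({0..1} \<times> S) (\<lambda>q. integral (cbox 0 1) (\<lambda>s. f (fst q * s) (snd q)))"
    by (intro integral_continuous_on_param) (simp add: case_prod_unfold)
  then have "continuous_on ({0..1} \<times> S) (\<lambda>q. fst q *\<^sub>R integral {0..1} (\<lambda>s. f (fst q * s) (snd q)))"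
    by (intro continuous_intros) simp
  moreover have "(\<lambda>(t, x). integral {0..t} (\<lambda>s. f s x)) q = fst q *\<^sub>R integral {0..1} (\<lambda>s. f (fst q * s) (snd q))"
    if "q \<in> {0..1} \<times> S" for q
    using that integral_rescale[OF continuous_on_slice[OF c]] by (auto simp: case_prod_unfold)
  ultimately show ?thesis by (simp cong: continuous_on_cong)
qed

lemma time_integral_has_derivative:
  fixes f :: "real \<Rightarrow> 'a::euclidean_space \<Rightarrow> 'b::euclidean_space"
  assumes S: "open S" and f: "fam_Ck (Suc k) {0..1} S f" and t: "t \<in> {0..1}" and x: "x \<in> S"
  shows "((\<lambda>x. integral {0..t} (\<lambda>s. f s x)) has_derivative
    (\<lambda>v. integral {0..t} (\<lambda>s. frechet_derivative (f s) (at x) v))) (at x)"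
proof -
  obtain e where e: "e > 0" "ball x e \<subseteq> S" using S x openE by blast
  \<comment> \<open>Differentiation under the integral sign wants the derivative as a bounded
    operator, jointly continuous in operator norm. In finite dimension this follows from continuity
    in each fixed direction.\<close>
  define f' where "f' y s = Blinfun (frechet_derivative (f s) (at y))" for y s
  have f': "blinfun_apply (f' y s) = frechet_derivative (f s) (at y)" if "y \<in> S" "s \<in> {0..1}" for y s
    unfolding f'_def
    by (rule bounded_linear_Blinfun_apply)
      (use fam_Ck_has_derivative[OF f that(2,1)] has_derivative_bounded_linear in blast)
  have cd: "continuous_on ({0..1} \<times> S) (\<lambda>(s, y). frechet_derivative (f s) (at y) v)" for v
    using fam_Ck_continuous[OF fam_Ck_derivative[OF f]] .
  have "continuous_on (ball x e \<times> {0..t}) (\<lambda>q. (\<lambda>(s, y). frechet_derivative (f s) (at y) v) (snd q, fst q))" for v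
    by (rule continuous_on_compose2[OF cd]) (use t e in \<open>auto intro!: continuous_intros\<close>)
  then have "continuous_on (ball x e \<times> {0..t}) (\<lambda>q. f' (fst q) (snd q) v)" for v
    by (rule iffD1[OF continuous_on_cong, rotated -1]) (use f' e t in auto)
  then have cf': "continuous_on (ball x e \<times> cbox 0 t) (\<lambda>(y, s). f' y s)"
    unfolding case_prod_unfold by (intro continuous_on_blinfun_componentwise) auto
  have cs: "continuous_on {0..t} (\<lambda>s. f s y)" if "y \<in> S" for y
    using continuous_on_subset[OF continuous_on_slice[OF fam_Ck_continuous[OF f] that], of "{0..t}"] t by auto
  have "((\<lambda>x. integral (cbox 0 t) (\<lambda>s. f s x)) has_derivative integral (cbox 0 t) (f' x)) (at x within ball x e)"
  proof (rule leibniz_rule[OF _ _ cf'])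
    show "((\<lambda>x. f s x) has_derivative blinfun_apply (f' y s)) (at y within ball x e)"
      if "y \<in> ball x e" "s \<in> cbox 0 t" for y s
    proof -
      have "y \<in> S" "s \<in> {0..1}" using that e t by auto
      then show ?thesis
        using fam_Ck_has_derivative[OF f, of s y] f'[of y s] by (simp add: has_derivative_at_withinI)
    qed
    show "(\<lambda>s. f s y) integrable_on cbox 0 t" if "y \<in> ball x e" for y
    proof -
      have "y \<in> S" using that e by auto
      then show ?thesis by (simp add: integrable_continuous_real cs)
    qed
  qed (use e in auto)
  then have d: "((\<lambda>x. integral {0..t} (\<lambda>s. f s x)) has_derivative integral {0..t} (f' x)) (at x)"
    using e by (simp add: at_within_open[of x "ball x e"])
  have "blinfun_apply (integral {0..t} (f' x)) v = integral {0..t} (\<lambda>s. frechet_derivative (f s) (at x) v)" for v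
  proof -
    have "continuous_on {0..t} (\<lambda>s. (\<lambda>(y, s). f' y s) (x, s))"
      by (rule continuous_on_compose2[OF cf']) (use e in \<open>auto intro!: continuous_intros\<close>)
    then have "f' x integrable_on {0..t}"
      using integrable_continuous_real[of 0 t "f' x"] by simp
    then have "blinfun_apply (integral {0..t} (f' x)) v = integral {0..t} (\<lambda>s. f' x s v)"
      by (rule blinfun_apply_integral)
    also have "\<dots> = integral {0..t} (\<lambda>s. frechet_derivative (f s) (at x) v)"
      by (rule integral_cong) (use f' x t in auto)
    finally show ?thesis .
  qed
  then show ?thesis using d by (metis (no_types, lifting) ext)
qed

lemma fam_Ck_time_integral:
  fixes f :: "real \<Rightarrow> 'a::euclidean_space \<Rightarrow> 'b::euclidean_space"
  assumes S: "open S" and "fam_Ck k {0..1} S f"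
  shows "fam_Ck k {0..1} S (\<lambda>t x. integral {0..t} (\<lambda>s. f s x))"
  using assms(2)
proof (induction k arbitrary: f)
  case 0
  then show ?case using continuous_on_time_integral[of S f] by simp
next
  case (Suc k)
  show ?case
    by (rule fam_Ck_SucI[OF S continuous_on_time_integral[OF fam_Ck_continuous[OF Suc.prems]]
      time_integral_has_derivative[OF S Suc.prems]]) (use Suc in auto)
qed

section \<open>Uniform linear approximation and existence by contraction\<close>

lemma norm_linear_le_Basis:
  assumes "linear L" shows "norm (L v) \<le> norm v * (\<Sum>b\<in>Basis. norm (L b))"
proof -
  have "norm (L v) = norm (\<Sum>b\<in>Basis. (v \<bullet> b) *\<^sub>R L b)"
    using linear_Basis_sum[OF assms, of v] by simp
  also have "\<dots> \<le> (\<Sum>b\<in>Basis. norm v * norm (L b))"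
    by (rule sum_norm_le) (auto intro!: mult_right_mono Basis_le_norm)
  finally show ?thesis by (simp add: sum_distrib_left)
qed

text \<open>Differentiability alone gives a radius that depends on \<open>s\<close>. The curve
  \<open>x\<close> has compact image, so its points keep a common distance from the complement of
  \<open>S\<close> and the derivative is uniformly continuous near it; the mean value inequality
  turns this into one radius for all \<open>s\<close>.\<close>

lemma uniform_remainder:
  fixes f :: "'c::metric_space \<Rightarrow> 'p::euclidean_space \<Rightarrow> 'b::euclidean_space"
  assumes S: "open S" and f: "fam_Ck (Suc k) I S f" and I: "compact I"
    and x: "continuous_on I x" "\<And>s. s \<in> I \<Longrightarrow> x s \<in> S" and \<eta>: "\<eta> > 0"
  obtains \<delta> where "\<delta> > 0"
    "\<And>s h. s \<in> I \<Longrightarrow> norm h < \<delta> \<Longrightarrow> x s + h \<in> S \<and>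
      norm (f s (x s + h) - f s (x s) - frechet_derivative (f s) (at (x s)) h) \<le> \<eta> * norm h"
proof -
  obtain e where e: "e > 0" "(\<Union>y\<in>x ` I. cball y e) \<subseteq> S"
    using compact_subset_open_imp_cball_epsilon_subset[of "x ` I" S] S x compact_continuous_image[OF x(1) I] by blast
  have in_S: "x s + h \<in> S" if "s \<in> I" "norm h \<le> e" for s h
    using e(2) that by (force simp: dist_norm)
  define D where "D s h b = frechet_derivative (f s) (at (x s + h)) b" for s h b
  \<comment> \<open>\<open>G\<close> dominates the operator norm of the change of the derivative; it
    vanishes for zero displacement and is continuous on a compact set.\<close>
  define G where "G q = (\<Sum>b\<in>Basis. norm (D (fst q) (snd q) b - D (fst q) 0 b))" for q
  have c: "continuous_on (I \<times> S) (\<lambda>(s, y). frechet_derivative (f s) (at y) b)" for b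
    using fam_Ck_continuous[OF fam_Ck_derivative[OF f]] .
  have x': "continuous_on (I \<times> cball 0 e) (\<lambda>q. x (fst q))"
    by (rule continuous_on_compose2[OF x(1)]) (auto intro!: continuous_intros)
  have 1: "continuous_on (I \<times> cball 0 e) (\<lambda>q. (\<lambda>(s, y). frechet_derivative (f s) (at y) b) (fst q, x (fst q) + snd q))" for b
    by (rule continuous_on_compose2[OF c]) (use in_S in \<open>auto intro!: continuous_intros x'\<close>)
  have 2: "continuous_on (I \<times> cball 0 e) (\<lambda>q. (\<lambda>(s, y). frechet_derivative (f s) (at y) b) (fst q, x (fst q)))" for b
    by (rule continuous_on_compose2[OF c]) (use x in \<open>auto intro!: continuous_intros x'\<close>)
  have "continuous_on (I \<times> cball 0 e) G"
    unfolding G_def D_def using 1 2 by (intro continuous_intros) auto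
  then have "uniformly_continuous_on (I \<times> cball 0 e) G"
    by (intro compact_uniformly_continuous compact_Times I) auto
  then obtain d where d: "d > 0"
    "\<And>q q'. q \<in> I \<times> cball 0 e \<Longrightarrow> q' \<in> I \<times> cball 0 e \<Longrightarrow> dist q' q < d \<Longrightarrow> dist (G q') (G q) < \<eta>"
    using \<eta> unfolding uniformly_continuous_on_def by meson
  have G: "G (s, h) < \<eta>" if "s \<in> I" "norm h < min d e" for s h
  proof -
    have "dist (G (s, h)) (G (s, 0)) < \<eta>"
      by (rule d(2)) (use that e in \<open>auto simp: dist_Pair_Pair\<close>)
    moreover have "G (s, 0) = 0" by (simp add: G_def)
    ultimately show ?thesis by (auto simp: dist_norm)
  qed
  show ?thesis
  proof (rule that[of "min d e"], safe)
    fix s and h :: 'p assume s: "s \<in> I" and h: "norm h < min d e"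
    show "x s + h \<in> S" using in_S s h by auto
    have lin: "linear (D s k)" if "norm k \<le> e" for k
      unfolding D_def using has_derivative_linear[OF fam_Ck_has_derivative[OF f s in_S[OF s that]]] .
    have "norm (f s (x s + h) - f s (x s) - frechet_derivative (f s) (at (x s)) (x s + h - x s)) \<le> norm (x s + h - x s) * \<eta>"
    proof (rule differentiable_bound_linearization[where S = "ball (x s) (min d e)"])
      show "x s + t *\<^sub>R (x s + h - x s) \<in> ball (x s) (min d e)" if "t \<in> {0..1}" for t
        using that h mult_left_le_one_le[of "norm h" t] by (auto simp: dist_norm)
      show "(f s has_derivative frechet_derivative (f s) (at y)) (at y within ball (x s) (min d e))"
        if "y \<in> ball (x s) (min d e)" for y
        using fam_Ck_has_derivative[OF f s, of y] in_S[OF s, of "y - x s"] that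
        by (auto intro!: has_derivative_at_withinI simp: dist_norm norm_minus_commute)
      show "onorm (frechet_derivative (f s) (at y) - frechet_derivative (f s) (at (x s))) \<le> \<eta>"
        if y: "y \<in> ball (x s) (min d e)" for y
      proof (rule onorm_le)
        fix v
        define k where "k = y - x s"
        have k: "norm k < min d e" using y by (simp add: k_def dist_norm norm_minus_commute)
        have "(frechet_derivative (f s) (at y) - frechet_derivative (f s) (at (x s))) v = D s k v - D s 0 v"
          by (simp add: D_def k_def)
        also have "D s k v = (\<Sum>b\<in>Basis. (v \<bullet> b) *\<^sub>R D s k b)"
          by (rule linear_Basis_sum) (use lin k in auto)
        also have "D s 0 v = (\<Sum>b\<in>Basis. (v \<bullet> b) *\<^sub>R D s 0 b)"
          by (rule linear_Basis_sum) (use lin e in auto)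
        also have "(\<Sum>b\<in>Basis. (v \<bullet> b) *\<^sub>R D s k b) - (\<Sum>b\<in>Basis. (v \<bullet> b) *\<^sub>R D s 0 b)
          = (\<Sum>b\<in>Basis. (v \<bullet> b) *\<^sub>R (D s k b - D s 0 b))"
          by (simp add: sum_subtractf scaleR_diff_right)
        also have "norm \<dots> \<le> (\<Sum>b\<in>Basis. norm v * norm (D s k b - D s 0 b))"
          by (rule sum_norm_le) (auto intro!: mult_right_mono Basis_le_norm)
        also have "\<dots> = norm v * G (s, k)" by (simp add: G_def sum_distrib_left)
        also have "\<dots> \<le> norm v * \<eta>" using G[OF s k] by (intro mult_left_mono) auto
        finally show "norm ((frechet_derivative (f s) (at y) - frechet_derivative (f s) (at (x s))) v) \<le> \<eta> * norm v"
          by (simp add: mult.commute)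
      qed
    qed (use d e in auto)
    then show "norm (f s (x s + h) - f s (x s) - frechet_derivative (f s) (at (x s)) h) \<le> \<eta> * norm h"
      by (simp add: mult.commute)
  qed (use d e in auto)
qed

text \<open>
  The Lipschitz constant \<open>1/2\<close> is smaller than the inverse length of the time interval, so that the
  integral operator contracts the sup norm; the same constant takes the place of Gronwall's inequality below.
\<close>

lemma volterra_existence:
  fixes H :: "real \<Rightarrow> 'p::euclidean_space \<times> 'b::euclidean_space \<Rightarrow> 'b"
  assumes K: "compact K" "convex K" "K \<noteq> {}"
    and H: "continuous_on ({0..1} \<times> (K \<times> UNIV)) (\<lambda>(s, q). H s q)"
    and lip: "\<And>s p z z'. s \<in> {0..1} \<Longrightarrow> p \<in> K \<Longrightarrow> norm (H s (p, z) - H s (p, z')) \<le> norm (z - z') / 2"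
    and b: "continuous_on ({0..1} \<times> K) (\<lambda>(t, p). b t p)"
  obtains u where "continuous_on ({0..1} \<times> K) (\<lambda>(t, p). u t p)"
    "\<And>t p. t \<in> {0..1} \<Longrightarrow> p \<in> K \<Longrightarrow> u t p = b t p + integral {0..t} (\<lambda>s. H s (p, u s p))"
proof -
  define X where "X = {0..1::real} \<times> K"
  have X: "compact X" "convex X" "X \<noteq> {}" "closed X"
    using K by (auto simp: X_def intro!: compact_Times convex_Times compact_imp_closed)
  define \<Phi> where "\<Phi> f = (\<lambda>(t, p). b t p + integral {0..t} (\<lambda>s. H s (p, apply_bcontfun f (s, p))))"
    for f :: "(real \<times> 'p) \<Rightarrow>\<^sub>C 'b"
  have cH: "continuous_on ({0..1} \<times> K) (\<lambda>(s, p). H s (p, apply_bcontfun f (s, p)))" for f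
  proof -
    have "continuous_on ({0..1} \<times> K) (\<lambda>r. (\<lambda>(s, q). H s q) (fst r, snd r, apply_bcontfun f r))"
      by (rule continuous_on_compose2[OF H]) (auto intro!: continuous_intros)
    then show ?thesis by (simp add: case_prod_unfold)
  qed
  have \<Phi>: "continuous_on X (\<Phi> f)" for f
    using b continuous_on_time_integral[OF cH[of f]]
    unfolding X_def \<Phi>_def case_prod_unfold by (intro continuous_on_add) (simp_all add: case_prod_unfold)
  \<comment> \<open>The closest-point retraction onto the convex set \<open>X\<close> extends
    functions on \<open>X\<close> to the whole space, whose bounded continuous functions form the
    complete space of the fixed point argument.\<close>
  define \<rho> where "\<rho> = closest_point X"
  have \<rho>: "\<rho> x \<in> X" for x using X closest_point_in_set by (auto simp: \<rho>_def)
  have \<rho>_id: "x \<in> X \<Longrightarrow> \<rho> x = x" for x by (simp add: \<rho>_def closest_point_self)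
  have "continuous_on UNIV (\<Phi> f \<circ> \<rho>)" for f
    unfolding o_def
    by (rule continuous_on_compose2[OF \<Phi>])
      (use \<rho> X in \<open>auto simp: \<rho>_def intro!: continuous_on_closest_point\<close>)
  moreover have "bounded (range (\<Phi> f \<circ> \<rho>))" for f
    by (rule bounded_subset[OF compact_imp_bounded[OF compact_continuous_image[OF \<Phi> X(1)]]])
      (use \<rho> in auto)
  ultimately have bc: "\<Phi> f \<circ> \<rho> \<in> bcontfun" for f
    by (simp add: bcontfun_def)
  define F where "F f = Bcontfun (\<Phi> f \<circ> \<rho>)" for f
  have F: "apply_bcontfun (F f) x = \<Phi> f (\<rho> x)" for f x
    unfolding F_def using Bcontfun_inverse[OF bc] by simp
  have "dist (F f) (F g) \<le> 1/2 * dist f g" for f g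
  proof (rule dist_bound)
    fix x
    obtain t p where tp: "\<rho> x = (t, p)" "t \<in> {0..1}" "p \<in> K"
      using \<rho>[of x] by (cases "\<rho> x") (auto simp: X_def)
    let ?h = "\<lambda>f s. H s (p, apply_bcontfun f (s, p))"
    have c: "continuous_on {0..1} (?h f)" for f
      using continuous_on_slice[OF cH tp(3)] .
    then have i: "?h f integrable_on {0..t}" for f
      by (intro integrable_continuous_real, rule continuous_on_subset) (use tp in auto)
    have "dist (F f x) (F g x) = norm (integral {0..t} (?h f) - integral {0..t} (?h g))"
      by (simp add: F tp \<Phi>_def dist_norm)
    also have "integral {0..t} (?h f) - integral {0..t} (?h g) = integral {0..t} (\<lambda>s. ?h f s - ?h g s)"
      using i by (simp add: integral_diff)
    also have "norm \<dots> \<le> dist f g / 2"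
    proof (rule norm_integral_time_le[OF _ tp(2)])
      fix s :: real assume s: "s \<in> {0..1}"
      have "norm (?h f s - ?h g s) \<le> norm (f (s, p) - g (s, p)) / 2"
        by (rule lip[OF s tp(3)])
      also have "\<dots> \<le> dist f g / 2" using dist_bounded[of f "(s, p)" g] by (simp add: dist_norm)
      finally show "norm (?h f s - ?h g s) \<le> dist f g / 2" .
    qed (intro continuous_intros c)
    finally show "dist (F f x) (F g x) \<le> 1/2 * dist f g" by simp
  qed
  then obtain f where f: "F f = f"
    using banach_fix_type[of "1/2" F] by auto
  have "apply_bcontfun f (t, p) = b t p + integral {0..t} (\<lambda>s. H s (p, f (s, p)))" if "t \<in> {0..1}" "p \<in> K" for t p
    using F[of f "(t, p)"] \<rho>_id[of "(t, p)"] that by (simp add: f X_def \<Phi>_def)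
  then show ?thesis
    by (intro that[of "\<lambda>t p. apply_bcontfun f (t, p)"]) (auto intro!: continuous_intros simp: case_prod_unfold)
qed

section \<open>Smooth dependence of Volterra equations on parameters\<close>

text \<open>Points \<open>x + \<tau> v\<close> with small \<open>\<tau>\<close> turn the Lipschitz
  bound into a bound of \<open>\<tau> L v\<close>; the linearisation error costs only
  \<open>e'\<close>, chosen so that \<open>e' * norm v\<close> is at most \<open>e\<close>.\<close>

lemma has_derivative_norm_le:
  assumes d: "(f has_derivative L) (at x)" and U: "open U" "x \<in> U"
    and lip: "\<And>y. y \<in> U \<Longrightarrow> norm (f y - f x) \<le> B * norm (y - x)"
  shows "norm (L v) \<le> B * norm v"
proof (rule field_le_epsilon)
  fix e :: real assume e: "e > 0"
  define e' where "e' = e / (norm v + 1)"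
  have e': "e' > 0" "e' * norm v \<le> e"
    using e by (auto simp: e'_def field_simps add_pos_nonneg)
  obtain r where r: "r > 0" "ball x r \<subseteq> U" using U openE by blast
  obtain d where d': "d > 0" "\<And>y. norm (y - x) < d \<Longrightarrow> norm (f y - f x - L (y - x)) \<le> e' * norm (y - x)"
    using d e' unfolding has_derivative_at_alt by blast
  define n where "n = norm v + 1"
  have n: "n > 0" "norm v \<le> n" by (auto simp: n_def add_nonneg_pos)
  define \<tau> where "\<tau> = min d r / (2 * n)"
  have \<tau>: "\<tau> > 0" using d' r n by (auto simp: \<tau>_def)
  have "\<tau> * norm v \<le> \<tau> * n" using \<tau> n by simp
  also have "\<dots> = min d r / 2" using n by (simp add: \<tau>_def)
  also have "\<dots> < min d r" using d'(1) r(1) by (auto simp: min_def)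
  finally have nv: "norm (\<tau> *\<^sub>R v) < min d r" using \<tau> by simp
  have lin: "L (\<tau> *\<^sub>R v) = \<tau> *\<^sub>R L v" using has_derivative_linear[OF d] linear_cmul by blast
  have "norm (L (\<tau> *\<^sub>R v)) \<le> norm (f (x + \<tau> *\<^sub>R v) - f x) + norm (f (x + \<tau> *\<^sub>R v) - f x - L (\<tau> *\<^sub>R v))"
    by (metis norm_minus_commute norm_triangle_sub)
  also have "\<dots> \<le> B * norm (\<tau> *\<^sub>R v) + e' * norm (\<tau> *\<^sub>R v)"
    using lip[of "x + \<tau> *\<^sub>R v"] d'(2)[of "x + \<tau> *\<^sub>R v"] nv r
    by (intro add_mono) (auto simp: dist_norm subset_iff)
  finally have "\<tau> * norm (L v) \<le> \<tau> * (B * norm v + e' * norm v)"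
    using \<tau> by (simp add: lin algebra_simps)
  then show "norm (L v) \<le> B * norm v + e" using \<tau> e' by simp
qed

text \<open>Ensures that the linearised equation contracts in the state with the same constant as
  the original equation.\<close>

lemma partial_derivative_norm_le:
  assumes d: "(F has_derivative F') (at (p, z))" and Z: "open Z" "z \<in> Z"
    and lip: "\<And>z'. z' \<in> Z \<Longrightarrow> norm (F (p, z') - F (p, z)) \<le> B * norm (z' - z)"
  shows "norm (F' (0, \<zeta>)) \<le> B * norm \<zeta>"
proof -
  have "((\<lambda>z. F (p, z)) has_derivative (\<lambda>\<zeta>. F' (0, \<zeta>))) (at z)"
    by (rule has_derivative_compose[OF has_derivative_Pair[OF has_derivative_const has_derivative_ident] d])
  from has_derivative_norm_le[OF this Z lip] show ?thesis .
qed

text \<open>The candidate \<open>V\<close> is constructed first, as a solution of the formally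
  differentiated equation over a compact ball. Only then is
  \<open>u t y - u t p - V (y - p) t p\<close> shown to be of smaller order than
  \<open>y - p\<close>, starting from mere continuity of \<open>u\<close>.\<close>

lemma volterra_C1_at:
  fixes H :: "real \<Rightarrow> 'p::euclidean_space \<times> 'b::euclidean_space \<Rightarrow> 'b"
  assumes S: "open S" and Z: "open Z"
    and H: "fam_Ck (Suc k) {0..1} (S \<times> Z) H"
    and lip: "\<And>s p z z'. s \<in> {0..1} \<Longrightarrow> p \<in> S \<Longrightarrow> z \<in> Z \<Longrightarrow> z' \<in> Z \<Longrightarrow>
      norm (H s (p, z) - H s (p, z')) \<le> norm (z - z') / 2"
    and b: "fam_Ck (Suc l) {0..1} S b"
    and u: "continuous_on ({0..1} \<times> S) (\<lambda>(t, p). u t p)"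
    and uZ: "\<And>t p. t \<in> {0..1} \<Longrightarrow> p \<in> S \<Longrightarrow> u t p \<in> Z"
    and eq: "\<And>t p. t \<in> {0..1} \<Longrightarrow> p \<in> S \<Longrightarrow> u t p = b t p + integral {0..t} (\<lambda>s. H s (p, u s p))"
    and p0: "p0 \<in> S"
  obtains r V where "r > 0" "ball p0 r \<subseteq> S"
    "\<And>w. continuous_on ({0..1} \<times> ball p0 r) (\<lambda>(t, p). V w t p)"
    "\<And>t p. t \<in> {0..1} \<Longrightarrow> p \<in> ball p0 r \<Longrightarrow> (u t has_derivative (\<lambda>w. V w t p)) (at p)"
    "\<And>w t p. t \<in> {0..1} \<Longrightarrow> p \<in> ball p0 r \<Longrightarrow> V w t p = frechet_derivative (b t) (at p) w
      + integral {0..t} (\<lambda>s. frechet_derivative (H s) (at (p, u s p)) (w, V w s p))"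
proof -
  define DH where "DH s p = frechet_derivative (H s) (at (p, u s p))" for s p
  define Db where "Db t p = frechet_derivative (b t) (at p)" for t p
  have dH: "(H s has_derivative DH s p) (at (p, u s p))" if "s \<in> {0..1}" "p \<in> S" for s p
    unfolding DH_def by (rule fam_Ck_has_derivative[OF H]) (use that uZ in auto)
  have linH: "linear (DH s p)" if "s \<in> {0..1}" "p \<in> S" for s p
    using has_derivative_linear[OF dH[OF that]] .
  have linb: "linear (Db t p)" if "t \<in> {0..1}" "p \<in> S" for t p
    unfolding Db_def using has_derivative_linear[OF fam_Ck_has_derivative[OF b that]] .
  have cDH: "continuous_on ({0..1} \<times> S) (\<lambda>(s, p). DH s p v)" for v
  proof -
    have "continuous_on ({0..1} \<times> S) (\<lambda>q. (\<lambda>(s, y). frechet_derivative (H s) (at y) v) (fst q, snd q, (\<lambda>(t, p). u t p) q))"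
      by (rule continuous_on_compose2[OF fam_Ck_continuous[OF fam_Ck_derivative[OF H]]])
        (use uZ in \<open>auto intro!: continuous_intros u\<close>)
    then show ?thesis by (simp add: DH_def case_prod_unfold)
  qed
  have cDb: "continuous_on ({0..1} \<times> S) (\<lambda>(s, p). Db s p v)" for v
    unfolding Db_def using fam_Ck_continuous[OF fam_Ck_derivative[OF b]] .
  have half: "norm (DH s p (0, \<zeta>)) \<le> norm \<zeta> / 2" if sp: "s \<in> {0..1}" "p \<in> S" for s p \<zeta>
    using partial_derivative_norm_le[OF dH[OF sp] Z uZ[OF sp], of "1/2" \<zeta>] lip[OF sp _ uZ[OF sp]] by simp
  obtain r where r: "r > 0" "cball p0 r \<subseteq> S" using S p0 open_contains_cball by blast
  let ?K = "cball p0 r"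
  define sol where "sol w U \<longleftrightarrow> continuous_on ({0..1} \<times> ?K) (\<lambda>(t, p). U t p) \<and>
    (\<forall>t\<in>{0..1}. \<forall>p\<in>?K. U t p = Db t p w + integral {0..t} (\<lambda>s. DH s p (w, U s p)))" for w U
  have "\<exists>U. sol w U" for w
  proof -
    \<comment> \<open>\<open>H'\<close> agrees with \<open>DH s p (w, \<zeta>)\<close> for
      \<open>p\<close> in \<open>S\<close>, and its continuity in all variables can be read off,
      whereas \<open>DH\<close> is so far known to be continuous only for fixed vectors.\<close>
    define H' where "H' = (\<lambda>s q. \<Sum>c\<in>Basis. ((w, snd q) \<bullet> c) *\<^sub>R DH s (fst q) c)"
    have H': "H' s (p, \<zeta>) = DH s p (w, \<zeta>)" if "s \<in> {0..1}" "p \<in> S" for s p \<zeta>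
      using linear_Basis_sum[OF linH[OF that], of "(w, \<zeta>)"] by (simp add: H'_def)
    have "continuous_on ({0..1} \<times> ?K \<times> UNIV) (\<lambda>q. (\<lambda>(s, p). DH s p c) (fst q, fst (snd q)))" for c
      by (rule continuous_on_compose2[OF cDH]) (use r in \<open>auto intro!: continuous_intros\<close>)
    then have c: "continuous_on ({0..1} \<times> ?K \<times> UNIV) (\<lambda>(s, q). H' s q)"
      unfolding H'_def case_prod_unfold by (intro continuous_intros) simp_all
    have l: "norm (H' s (p, z) - H' s (p, z')) \<le> norm (z - z') / 2" if "s \<in> {0..1}" "p \<in> ?K" for s p z z'
    proof -
      have *: "s \<in> {0..1}" "p \<in> S" using that r by auto
      have "H' s (p, z) - H' s (p, z') = DH s p ((w, z) - (w, z'))"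
        using H'[OF *] linear_diff[OF linH[OF *]] by metis
      then show ?thesis using half[OF *, of "z - z'"] by simp
    qed
    obtain U where U: "continuous_on ({0..1} \<times> ?K) (\<lambda>(t, p). U t p)"
      "\<And>t p. t \<in> {0..1} \<Longrightarrow> p \<in> ?K \<Longrightarrow> U t p = Db t p w + integral {0..t} (\<lambda>s. H' s (p, U s p))"
    proof (rule volterra_existence[OF compact_cball convex_cball _ c l])
      show "continuous_on ({0..1} \<times> ?K) (\<lambda>(t, p). Db t p w)"
        by (rule continuous_on_subset[OF cDb]) (use r in auto)
    qed (use r in auto)
    have "integral {0..t} (\<lambda>s. H' s (p, U s p)) = integral {0..t} (\<lambda>s. DH s p (w, U s p))"
      if "t \<in> {0..1}" "p \<in> ?K" for t p
      by (rule integral_cong) (use H' that r in auto)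
    then show ?thesis using U by (auto simp: sol_def)
  qed
  then obtain U where "\<And>w. sol w (U w)" by metis
  then have U: "\<And>w. continuous_on ({0..1} \<times> ?K) (\<lambda>(t, p). U w t p)"
    "\<And>w t p. t \<in> {0..1} \<Longrightarrow> p \<in> ?K \<Longrightarrow> U w t p = Db t p w + integral {0..t} (\<lambda>s. DH s p (w, U w s p))"
    by (auto simp: sol_def)
  \<comment> \<open>The solutions \<open>U w\<close> were chosen separately for each
    \<open>w\<close>, so nothing makes them linear in \<open>w\<close>. Combining those of the basis
    vectors linearly repairs this, and \<open>Veq\<close> shows that the equation survives.\<close>
  define V where "V w t p = (\<Sum>c\<in>Basis. (w \<bullet> c) *\<^sub>R U c t p)" for w t p
  have cV: "continuous_on ({0..1} \<times> ?K) (\<lambda>(t, p). V w t p)" for w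
    unfolding V_def case_prod_unfold
    by (intro continuous_intros) (use U(1) in \<open>simp add: case_prod_unfold\<close>)
  have cDHV: "continuous_on ({0..1} \<times> ?K) (\<lambda>(s, p). DH s p (w, W s p))"
    if W: "continuous_on ({0..1} \<times> ?K) (\<lambda>(t, p). W t p)" for w W
  proof -
    have c1: "continuous_on ({0..1} \<times> ?K) (\<lambda>q. DH (fst q) (snd q) c)" for c
      using continuous_on_subset[OF cDH[of c], of "{0..1} \<times> ?K"] r by (auto simp: case_prod_unfold)
    have "continuous_on ({0..1} \<times> ?K) (\<lambda>q. \<Sum>c\<in>Basis. ((w, W (fst q) (snd q)) \<bullet> c) *\<^sub>R DH (fst q) (snd q) c)"
      by (intro continuous_intros c1) (use W in \<open>simp add: case_prod_unfold\<close>)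
    then show ?thesis
      by (rule continuous_on_eq) (use linear_Basis_sum[OF linH] r in auto)
  qed
  have Veq: "V w t p = Db t p w + integral {0..t} (\<lambda>s. DH s p (w, V w s p))"
    if t: "t \<in> {0..1}" and p: "p \<in> ?K" for w t p
  proof -
    have pS: "p \<in> S" using p r by auto
    have i: "(\<lambda>s. DH s p (c, U c s p)) integrable_on {0..t}" for c
      by (rule integrable_continuous_real, rule continuous_on_subset[OF continuous_on_slice[OF cDHV[OF U(1)] p]]) (use t in auto)
    have "V w t p = (\<Sum>c\<in>Basis. (w \<bullet> c) *\<^sub>R Db t p c) + (\<Sum>c\<in>Basis. (w \<bullet> c) *\<^sub>R integral {0..t} (\<lambda>s. DH s p (c, U c s p)))"
      unfolding V_def using U(2)[OF t p] by (simp add: scaleR_add_right sum.distrib)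
    also have "(\<Sum>c\<in>Basis. (w \<bullet> c) *\<^sub>R Db t p c) = Db t p w"
      by (rule linear_Basis_sum[OF linb[OF t pS], symmetric])
    also have "(\<Sum>c\<in>Basis. (w \<bullet> c) *\<^sub>R integral {0..t} (\<lambda>s. DH s p (c, U c s p)))
      = integral {0..t} (\<lambda>s. \<Sum>c\<in>Basis. (w \<bullet> c) *\<^sub>R DH s p (c, U c s p))"
      using i by (subst integral_sum) (auto intro!: integrable_cmul simp: integral_cmul)
    also have "\<dots> = integral {0..t} (\<lambda>s. DH s p (w, V w s p))"
    proof (rule integral_cong)
      fix s assume "s \<in> {0..t}"
      then have s: "s \<in> {0..1}" using t by auto
      have "(\<Sum>c\<in>Basis. (w \<bullet> c) *\<^sub>R DH s p (c, U c s p)) = DH s p (\<Sum>c\<in>Basis. (w \<bullet> c) *\<^sub>R (c, U c s p))"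
        by (simp add: linear_sum[OF linH[OF s pS]] linear_cmul[OF linH[OF s pS], symmetric] del: scaleR_Pair)
      also have "(\<Sum>c\<in>Basis. (w \<bullet> c) *\<^sub>R (c, U c s p)) = (w, V w s p)"
        by (intro prod_eqI) (simp_all add: fst_sum snd_sum V_def euclidean_representation)
      finally show "(\<Sum>c\<in>Basis. (w \<bullet> c) *\<^sub>R DH s p (c, U c s p)) = DH s p (w, V w s p)" .
    qed
    finally show ?thesis .
  qed
  have deriv: "(u t has_derivative (\<lambda>w. V w t p)) (at p)" if t: "t \<in> {0..1}" and p: "p \<in> ball p0 r" for t p
    unfolding has_derivative_at_alt
  proof (intro conjI allI impI)
    have "linear (\<lambda>w. V w t p)"
      unfolding V_def
      by (rule linearI) (simp_all add: inner_left_distrib scaleR_add_left sum.distrib scaleR_sum_right)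
    then show "bounded_linear (\<lambda>w. V w t p)" by (rule linear_conv_bounded_linear[THEN iffD1])
    have pK: "p \<in> ?K" and pS: "p \<in> S" using p r by auto
    fix e :: real assume e: "e > 0"
    have "continuous_on {0..1} (\<lambda>s. \<Sum>c\<in>Basis. norm (U c s p))"
      using continuous_on_slice[OF U(1) pK] by (intro continuous_intros)
    then have "bounded ((\<lambda>s. \<Sum>c\<in>Basis. norm (U c s p)) ` {0..1})"
      by (intro compact_imp_bounded compact_continuous_image) auto
    then obtain C where C: "C > 0" "\<And>s. s \<in> {0..1} \<Longrightarrow> (\<Sum>c\<in>Basis. norm (U c s p)) \<le> C"
      unfolding bounded_pos by (force simp: abs_le_iff)
    have VC: "norm (V w s p) \<le> C * norm w" if "s \<in> {0..1}" for s w
    proof -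
      have "norm (V w s p) \<le> (\<Sum>c\<in>Basis. norm w * norm (U c s p))"
        unfolding V_def by (rule sum_norm_le) (auto intro!: mult_right_mono Basis_le_norm)
      also have "\<dots> = norm w * (\<Sum>c\<in>Basis. norm (U c s p))" by (simp add: sum_distrib_left)
      also have "\<dots> \<le> norm w * C" using C(2)[OF that] by (intro mult_left_mono) auto
      finally show ?thesis by (simp add: mult.commute)
    qed
    \<comment> \<open>For the largest error \<open>m\<close> the estimate below reads
      \<open>m \<le> \<eta> * (2 + C) * norm w + \<eta> * m + m / 2\<close>. The bound 1/4 keeps the
      last two terms below three quarters of \<open>m\<close>, and the other bound makes the
      resulting estimate at most \<open>e * norm w\<close>.\<close>
    define \<eta> where "\<eta> = min (1/4) (e / (4 * (2 + C)))"
    have C4: "4 * (2 + C) > 0" using C by simp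
    have "\<eta> \<le> e / (4 * (2 + C))" unfolding \<eta>_def by simp
    then have "\<eta> * (4 * (2 + C)) \<le> e" using C4 by (simp only: pos_le_divide_eq)
    then have "4 * \<eta> * (2 + C) \<le> e" by (simp add: algebra_simps)
    moreover have "\<eta> > 0" using e C4 by (simp add: \<eta>_def)
    moreover have "\<eta> \<le> 1/4" unfolding \<eta>_def by (rule min.cobounded1)
    ultimately have \<eta>: "\<eta> > 0" "\<eta> \<le> 1/4" "4 * \<eta> * (2 + C) \<le> e" by auto
    obtain d1 where d1: "d1 > 0" "\<And>s h. s \<in> {0..1} \<Longrightarrow> norm h < d1 \<Longrightarrow> p + h \<in> S \<and>
      norm (b s (p + h) - b s p - frechet_derivative (b s) (at p) h) \<le> \<eta> * norm h"
      using uniform_remainder[OF S b compact_Icc, of "\<lambda>_. p" \<eta>] \<eta> pS by (auto simp: continuous_on_const)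
    have cpair: "continuous_on {0..1} (\<lambda>s. (p, u s p))"
      by (intro continuous_intros continuous_on_slice[OF u pS])
    obtain d2 where d2: "d2 > 0" "\<And>s h. s \<in> {0..1} \<Longrightarrow> norm h < d2 \<Longrightarrow> (p, u s p) + h \<in> S \<times> Z \<and>
      norm (H s ((p, u s p) + h) - H s (p, u s p) - DH s p h) \<le> \<eta> * norm h"
      unfolding DH_def
      using uniform_remainder[OF open_Times[OF S Z] H compact_Icc cpair _ \<eta>(1)] uZ pS by (metis mem_Sigma_iff)
    have "uniformly_continuous_on ({0..1} \<times> ?K) (\<lambda>(t, p). u t p)"
      by (intro compact_uniformly_continuous continuous_on_subset[OF u] compact_Times) (use r in auto)
    then obtain d3 where d3: "d3 > 0" "\<And>q q'. q \<in> {0..1} \<times> ?K \<Longrightarrow> q' \<in> {0..1} \<times> ?K \<Longrightarrow> dist q' q < d3 \<Longrightarrow>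
        dist ((\<lambda>(t, p). u t p) q') ((\<lambda>(t, p). u t p) q) < d2 / 2"
      using d2(1) unfolding uniformly_continuous_on_def by (metis half_gt_zero)
    \<comment> \<open>\<open>d1\<close> controls \<open>b\<close>, \<open>d2 / 2\<close> bounds the
      parameter part of \<open>h s\<close>, \<open>d3\<close> keeps its state part below
      \<open>d2 / 2\<close>, and the last term keeps \<open>y\<close> in the ball.\<close>
    define d where "d = min (min d1 (d2 / 2)) (min d3 (r - dist p0 p))"
    show "\<exists>d>0. \<forall>y. norm (y - p) < d \<longrightarrow> norm (u t y - u t p - V (y - p) t p) \<le> e * norm (y - p)"
    proof (intro exI[of _ d] conjI allI impI)
      show "d > 0" using d1 d2 d3 p by (simp add: d_def)
      fix y assume y: "norm (y - p) < d"
      define w where "w = y - p"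
      have yK: "y \<in> ?K" using y p norm_triangle_sub[of "p0 - y" "p0 - p"] dist_triangle[of p0 y p]
        by (auto simp: d_def dist_norm norm_minus_commute)
      have yS: "y \<in> S" using yK r by auto
      define h where "h s = (w, u s y - u s p)" for s
      have h: "norm (h s) < d2" "norm (h s) \<le> norm w + norm (u s y - u s p)" if s: "s \<in> {0..1}" for s
      proof -
        have "dist (u s y) (u s p) < d2 / 2"
          using d3(2)[of "(s, p)" "(s, y)"] s pK yK y by (auto simp: dist_Pair_Pair d_def dist_norm)
        moreover have "norm (h s) \<le> norm w + norm (u s y - u s p)"
          unfolding h_def by (rule norm_Pair_le)
        moreover have "norm w < d2 / 2" using y by (simp add: w_def d_def)
        ultimately show "norm (h s) < d2" "norm (h s) \<le> norm w + norm (u s y - u s p)" by (auto simp: dist_norm)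
      qed
      define \<delta> where "\<delta> s = u s y - u s p - V w s p" for s
      have c\<delta>: "continuous_on {0..1} \<delta>" unfolding \<delta>_def
        using continuous_on_slice[OF u yS] continuous_on_slice[OF u pS] continuous_on_slice[OF cV pK]
        by (intro continuous_intros)
      obtain t' where t': "t' \<in> {0..1}" "\<And>s. s \<in> {0..1} \<Longrightarrow> norm (\<delta> s) \<le> norm (\<delta> t')"
        using continuous_attains_sup[OF compact_Icc _ continuous_on_norm[OF c\<delta>]] by auto
      define m where "m = norm (\<delta> t')"
      define R where "R s = H s (y, u s y) - H s (p, u s p) - DH s p (w, V w s p)" for s
      have cHu: "continuous_on {0..1} (\<lambda>s. H s (q, u s q))" if "q \<in> S" for q
      proof -
        have "continuous_on {0..1} (\<lambda>s. (\<lambda>(s, y). H s y) (s, q, u s q))"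
          by (rule continuous_on_compose2[OF fam_Ck_continuous[OF H]])
            (use that uZ in \<open>auto intro!: continuous_intros continuous_on_slice[OF u that]\<close>)
        then show ?thesis by simp
      qed
      have cDHVp: "continuous_on {0..1} (\<lambda>s. DH s p (w, V w s p))"
        using continuous_on_slice[OF cDHV[OF cV] pK] .
      have cR: "continuous_on {0..1} R"
        unfolding R_def by (intro continuous_intros cHu yS pS cDHVp)
      have R: "norm (R s) \<le> \<eta> * (norm w + m + C * norm w) + m / 2" if s: "s \<in> {0..1}" for s
      proof -
        \<comment> \<open>Replacing \<open>V w s p\<close> by the true increment of \<open>u\<close>
          splits \<open>R\<close> into a linearisation remainder of \<open>H\<close> and a term in
          \<open>\<delta>\<close>, on which the constant 1/2 acts.\<close>
        have "DH s p (w, V w s p) = DH s p (h s) - DH s p (0, \<delta> s)"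
          using linear_diff[OF linH[OF s pS], of "h s" "(0, \<delta> s)"] by (simp add: h_def \<delta>_def)
        moreover have "(p, u s p) + h s = (y, u s y)" by (simp add: h_def w_def)
        ultimately have "R s = (H s ((p, u s p) + h s) - H s (p, u s p) - DH s p (h s)) + DH s p (0, \<delta> s)"
          by (simp add: R_def)
        also have "norm \<dots> \<le> \<eta> * norm (h s) + norm (\<delta> s) / 2"
          using d2(2)[OF s h(1)[OF s]] half[OF s pS, of "\<delta> s"] by (intro norm_triangle_le add_mono) auto
        also have "\<dots> \<le> \<eta> * (norm w + m + C * norm w) + m / 2"
        proof (intro add_mono mult_left_mono)
          have "norm (u s y - u s p) \<le> norm (\<delta> s) + norm (V w s p)"
            unfolding \<delta>_def by (metis norm_triangle_sub add.commute)
          then show "norm (h s) \<le> norm w + m + C * norm w"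
            using h(2)[OF s] t'(2)[OF s] VC[OF s, of w] by (simp add: m_def)
        qed (use \<eta> t'(2)[OF s] in \<open>auto simp: m_def\<close>)
        finally show ?thesis .
      qed
      have "\<delta> t' = (b t' y - b t' p - Db t' p w) + integral {0..t'} R"
      proof -
        have i: "f integrable_on {0..t'}" if "continuous_on {0..1} f" for f :: "real \<Rightarrow> 'b"
          by (rule integrable_continuous_real, rule continuous_on_subset[OF that]) (use t' in auto)
        have "integral {0..t'} R = integral {0..t'} (\<lambda>s. H s (y, u s y)) - integral {0..t'} (\<lambda>s. H s (p, u s p))
            - integral {0..t'} (\<lambda>s. DH s p (w, V w s p))"
          unfolding R_def using i[OF cHu[OF yS]] i[OF cHu[OF pS]] i[OF cDHVp]
          by (simp add: integral_diff integrable_diff)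
        then show ?thesis
          using eq[OF t'(1) yS] eq[OF t'(1) pS] Veq[OF t'(1) pK, of w] by (simp add: \<delta>_def)
      qed
      then have "m \<le> norm (b t' y - b t' p - Db t' p w) + norm (integral {0..t'} R)"
        by (simp add: m_def norm_triangle_ineq)
      also have "norm (b t' y - b t' p - Db t' p w) \<le> \<eta> * norm w"
        using d1(2)[OF t'(1), of w] y by (simp add: w_def Db_def d_def)
      also have "norm (integral {0..t'} R) \<le> \<eta> * (norm w + m + C * norm w) + m / 2"
        by (rule norm_integral_time_le[OF cR t'(1) R])
      finally have "m \<le> \<eta> * (2 + C) * norm w + \<eta> * m + m / 2"
        by (simp add: algebra_simps)
      moreover have "\<eta> * m \<le> m / 4" using mult_right_mono[OF \<eta>(2), of m] by (simp add: m_def)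
      ultimately have "m \<le> 4 * \<eta> * (2 + C) * norm w" by linarith
      also have "\<dots> \<le> e * norm w" using \<eta>(3) by (intro mult_right_mono) auto
      finally have "m \<le> e * norm w" .
      then show "norm (u t y - u t p - V (y - p) t p) \<le> e * norm (y - p)"
        using t'(2)[OF t] by (simp add: m_def \<delta>_def w_def)
    qed
  qed
  show ?thesis
  proof (rule that[of r V])
    show "continuous_on ({0..1} \<times> ball p0 r) (\<lambda>(t, p). V w t p)" for w
      by (rule continuous_on_subset[OF cV]) auto
  qed (use r deriv Veq in \<open>auto simp: DH_def Db_def\<close>)
qed

text \<open>The local solutions \<open>V\<close> depend on the chosen ball, but uniqueness of
  derivatives identifies them all with \<open>frechet_derivative (u t)\<close>. Continuity and the
  linearised equation thus hold on all of \<open>S\<close>.\<close>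

lemma volterra_C1:
  fixes H :: "real \<Rightarrow> 'p::euclidean_space \<times> 'b::euclidean_space \<Rightarrow> 'b"
  assumes S: "open S" and Z: "open Z"
    and H: "fam_Ck (Suc k) {0..1} (S \<times> Z) H"
    and lip: "\<And>s p z z'. s \<in> {0..1} \<Longrightarrow> p \<in> S \<Longrightarrow> z \<in> Z \<Longrightarrow> z' \<in> Z \<Longrightarrow>
      norm (H s (p, z) - H s (p, z')) \<le> norm (z - z') / 2"
    and b: "fam_Ck (Suc l) {0..1} S b"
    and u: "continuous_on ({0..1} \<times> S) (\<lambda>(t, p). u t p)"
    and uZ: "\<And>t p. t \<in> {0..1} \<Longrightarrow> p \<in> S \<Longrightarrow> u t p \<in> Z"
    and eq: "\<And>t p. t \<in> {0..1} \<Longrightarrow> p \<in> S \<Longrightarrow> u t p = b t p + integral {0..t} (\<lambda>s. H s (p, u s p))"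
  shows "fam_Ck (Suc 0) {0..1} S u"
    and "\<And>w t p. t \<in> {0..1} \<Longrightarrow> p \<in> S \<Longrightarrow> frechet_derivative (u t) (at p) w = frechet_derivative (b t) (at p) w
      + integral {0..t} (\<lambda>s. frechet_derivative (H s) (at (p, u s p)) (w, frechet_derivative (u s) (at p) w))"
proof -
  let ?D = "\<lambda>t p w. frechet_derivative (u t) (at p) w"
  have *: "(u t has_derivative ?D t p) (at p) \<and>
     ?D t p w = frechet_derivative (b t) (at p) w
      + integral {0..t} (\<lambda>s. frechet_derivative (H s) (at (p, u s p)) (w, ?D s p w)) \<and>
     continuous (at (t, p) within {0..1} \<times> S) (\<lambda>(t, p). ?D t p w)"
    if t: "t \<in> {0..1}" and p: "p \<in> S" for w t p
  proof -
    obtain r V where r: "r > 0" "ball p r \<subseteq> S"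
      and cV: "\<And>w. continuous_on ({0..1} \<times> ball p r) (\<lambda>(t, p). V w t p)"
      and d: "\<And>t q. t \<in> {0..1} \<Longrightarrow> q \<in> ball p r \<Longrightarrow> (u t has_derivative (\<lambda>w. V w t q)) (at q)"
      and V: "\<And>w t q. t \<in> {0..1} \<Longrightarrow> q \<in> ball p r \<Longrightarrow> V w t q = frechet_derivative (b t) (at q) w
      + integral {0..t} (\<lambda>s. frechet_derivative (H s) (at (q, u s q)) (w, V w s q))"
      by (rule volterra_C1_at[OF S Z H lip b u uZ eq p]) (assumption | rule that)+
    have D: "?D s q w = V w s q" if "s \<in> {0..1}" "q \<in> ball p r" for s q w
      using frechet_derivative_at[OF d[OF that]] by metis
    have "continuous_on ({0..1} \<times> ball p r) (\<lambda>(t, p). ?D t p w)"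
      by (rule continuous_on_eq[OF cV[of w]]) (use D in auto)
    then have "continuous (at (t, p) within {0..1} \<times> ball p r) (\<lambda>(t, p). ?D t p w)"
      using t r(1) by (simp add: continuous_on_eq_continuous_within)
    moreover have "at (t, p) within {0..1} \<times> ball p r = at (t, p) within {0..1} \<times> S"
      by (rule at_within_nhd[of _ "UNIV \<times> ball p r"]) (use r in \<open>auto intro!: open_Times\<close>)
    moreover have "integral {0..t} (\<lambda>s. frechet_derivative (H s) (at (p, u s p)) (w, V w s p))
      = integral {0..t} (\<lambda>s. frechet_derivative (H s) (at (p, u s p)) (w, ?D s p w))"
      by (rule integral_cong) (use D t r(1) in auto)
    moreover have "(\<lambda>w. V w t p) = ?D t p" using D t r(1) by auto
    ultimately show ?thesis
      using d[OF t, of p] V[OF t, of p w] D[OF t, of p w] r(1) by simp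
  qed
  have "u t differentiable at p" if "t \<in> {0..1}" "p \<in> S" for t p
    using *[OF that] by (auto intro: differentiableI)
  then show "fam_Ck (Suc 0) {0..1} S u"
    using u * by (auto simp: continuous_on_eq_continuous_within)
  show "?D t p w = frechet_derivative (b t) (at p) w
      + integral {0..t} (\<lambda>s. frechet_derivative (H s) (at (p, u s p)) (w, ?D s p w))"
    if "t \<in> {0..1}" "p \<in> S" for w t p
    using *[OF that] by blast
qed

text \<open>
  Each directional derivative of the solution solves a linear equation of the same form, whose
  coefficients are as smooth as the solution itself; hence the induction over \<open>H\<close>, \<open>b\<close>, \<open>u\<close> and \<open>Z\<close>.
\<close>

lemma volterra_Ck:
  fixes H :: "real \<Rightarrow> 'p::euclidean_space \<times> 'b::euclidean_space \<Rightarrow> 'b"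
  assumes S: "open S" and "open Z"
    and "fam_Ck k {0..1} (S \<times> Z) H"
    and "\<And>s p z z'. s \<in> {0..1} \<Longrightarrow> p \<in> S \<Longrightarrow> z \<in> Z \<Longrightarrow> z' \<in> Z \<Longrightarrow>
      norm (H s (p, z) - H s (p, z')) \<le> norm (z - z') / 2"
    and "fam_Ck k {0..1} S b"
    and "continuous_on ({0..1} \<times> S) (\<lambda>(t, p). u t p)"
    and "\<And>t p. t \<in> {0..1} \<Longrightarrow> p \<in> S \<Longrightarrow> u t p \<in> Z"
    and "\<And>t p. t \<in> {0..1} \<Longrightarrow> p \<in> S \<Longrightarrow> u t p = b t p + integral {0..t} (\<lambda>s. H s (p, u s p))"
  shows "fam_Ck k {0..1} S u"
  using assms(2-)
proof (induction k arbitrary: H b u Z)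
  case 0
  then show ?case by simp
next
  case (Suc k)
  note Z = Suc.prems(1) and H = Suc.prems(2) and lip = Suc.prems(3) and b = Suc.prems(4)
    and u = Suc.prems(5) and uZ = Suc.prems(6) and eq = Suc.prems(7)
  let ?D = "\<lambda>t p w. frechet_derivative (u t) (at p) w"
  have C1: "fam_Ck (Suc 0) {0..1} S u"
    "\<And>w t p. t \<in> {0..1} \<Longrightarrow> p \<in> S \<Longrightarrow> ?D t p w = frechet_derivative (b t) (at p) w
      + integral {0..t} (\<lambda>s. frechet_derivative (H s) (at (p, u s p)) (w, ?D s p w))"
    using volterra_C1[OF S Z H lip b u uZ eq] by auto
  have uk: "fam_Ck k {0..1} S u"
    by (rule Suc.IH[OF Z fam_Ck_Suc_le[OF H] lip fam_Ck_Suc_le[OF b] u uZ eq])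
  have SZ: "open (S \<times> Z)" "open (S \<times> (UNIV :: 'b set))" using S Z by (auto intro!: open_Times)
  have upair: "fam_Ck k {0..1} S (\<lambda>t p. (p, u t p))"
    by (rule fam_Ck_Pair[OF S fam_Ck_ident[OF S] uk])
  define DH where "DH s p = frechet_derivative (H s) (at (p, u s p))" for s p
  have dH: "(H s has_derivative DH s p) (at (p, u s p))" if "s \<in> {0..1}" "p \<in> S" for s p
    unfolding DH_def by (rule fam_Ck_has_derivative[OF H]) (use that uZ in auto)
  note linH = has_derivative_linear[OF dH]
  have DHk: "fam_Ck k {0..1} S (\<lambda>s p. DH s p v)" for v
    unfolding DH_def
    by (rule fam_Ck_compose[OF S SZ(1) fam_Ck_derivative[OF H] upair]) (use uZ in auto)
  have half: "norm (DH s p (0, \<zeta>)) \<le> norm \<zeta> / 2" if sp: "s \<in> {0..1}" "p \<in> S" for s p \<zeta>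
    using partial_derivative_norm_le[OF dH[OF sp] Z uZ[OF sp], of "1/2" \<zeta>] lip[OF sp _ uZ[OF sp]] by simp
  have "fam_Ck k {0..1} S (\<lambda>t p. ?D t p w)" for w
  proof (rule Suc.IH[OF open_UNIV])
    \<comment> \<open>By linearity the \<open>w\<close> part of \<open>DH s p (w, \<zeta>)\<close>
      moves into the new inhomogeneity \<open>?b\<close>. What remains is linear in the state, so
      the new equation makes sense on \<open>UNIV\<close> and keeps the Lipschitz constant 1/2;
      \<open>uk\<close> makes its coefficients smooth to order \<open>k\<close>.\<close>
    let ?H = "\<lambda>s q. \<Sum>c\<in>Basis. (snd q \<bullet> c) *\<^sub>R DH s (fst q) (0, c)"
    let ?b = "\<lambda>t p. frechet_derivative (b t) (at p) w + integral {0..t} (\<lambda>s. DH s p (w, 0))"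
    have H': "?H s (p, \<zeta>) = DH s p (0, \<zeta>)" if "s \<in> {0..1}" "p \<in> S" for s p \<zeta>
    proof -
      have "linear (\<lambda>\<zeta>. DH s p (0, \<zeta>))"
        using linear_compose[OF _ linH[OF that], of "\<lambda>\<zeta>. (0, \<zeta>)"] by (simp add: o_def linear_iff)
      from linear_Basis_sum[OF this, of \<zeta>] show ?thesis by simp
    qed
    show "fam_Ck k {0..1} (S \<times> UNIV) ?H"
    proof (intro fam_Ck_sum SZ fam_Ck_bilinear[OF SZ(2) bounded_bilinear_scaleR])
      show "fam_Ck k {0..1} (S \<times> UNIV) (\<lambda>t q. snd q \<bullet> c)" for c :: 'b
        by (intro fam_Ck_linear SZ) (auto simp: linear_iff inner_left_distrib)
      show "fam_Ck k {0..1} (S \<times> (UNIV :: 'b set)) (\<lambda>t q. DH t (fst q) v)" for v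
        by (rule fam_Ck_compose[where F = "\<lambda>s p. DH s p v" and f = "\<lambda>t q. fst q", OF SZ(2) S DHk]) (auto intro!: fam_Ck_linear SZ linear_fst)
    qed
    show "norm (?H s (p, z) - ?H s (p, z')) \<le> norm (z - z') / 2"
      if "s \<in> {0..1}" "p \<in> S" for s p z z'
      using half[OF that, of "z - z'"] linear_diff[OF linH[OF that], of "(0, z)" "(0, z')"]
      unfolding H'[OF that] by simp
    show "fam_Ck k {0..1} S ?b"
      by (intro fam_Ck_add S fam_Ck_derivative[OF b] fam_Ck_time_integral DHk)
    show cD: "continuous_on ({0..1} \<times> S) (\<lambda>(t, p). ?D t p w)"
      using C1(1) by simp
    show "?D t p w = ?b t p + integral {0..t} (\<lambda>s. ?H s (p, ?D s p w))"
      if t: "t \<in> {0..1}" and p: "p \<in> S" for t p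
    proof -
      have "integral {0..t} (\<lambda>s. DH s p (w, ?D s p w)) = integral {0..t} (\<lambda>s. DH s p (w, 0) + ?H s (p, ?D s p w))"
      proof (rule integral_cong)
        fix s assume "s \<in> {0..t}"
        then have s: "s \<in> {0..1}" using t by auto
        show "DH s p (w, ?D s p w) = DH s p (w, 0) + ?H s (p, ?D s p w)"
          unfolding H'[OF s p] using linear_add[OF linH[OF s p], of "(w, 0)" "(0, ?D s p w)"] by simp
      qed
      also have "\<dots> = integral {0..t} (\<lambda>s. DH s p (w, 0)) + integral {0..t} (\<lambda>s. ?H s (p, ?D s p w))"
      proof (rule integral_add)
        have c: "continuous_on {0..1} (\<lambda>s. DH s p v)" for v
          using continuous_on_slice[OF fam_Ck_continuous[OF DHk] p] .
        show "(\<lambda>s. DH s p (w, 0)) integrable_on {0..t}"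
          by (rule integrable_continuous_real, rule continuous_on_subset[OF c]) (use t in auto)
        have "continuous_on {0..1} (\<lambda>s. ?H s (p, ?D s p w))"
          using continuous_on_slice[OF cD p] c by (simp, intro continuous_intros) auto
        then show "(\<lambda>s. ?H s (p, ?D s p w)) integrable_on {0..t}"
          by (intro integrable_continuous_real, rule continuous_on_subset) (use t in auto)
      qed
      finally show ?thesis using C1(2)[OF t p, of w] by (simp add: DH_def)
    qed
  qed auto
  then show ?case using C1(1) by auto
qed

section \<open>The flow of a linear family of vector fields\<close>

lemma higher_differentiable_on_subset:
  "higher_differentiable_on k S f \<Longrightarrow> T \<subseteq> S \<Longrightarrow> higher_differentiable_on k T f"
  using fam_Ck_imp_higher_differentiable_on[OF fam_Ck_subset[OF fam_Ck_const_time, of k S f "{0::real}" "{0::real}" T]] by auto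

lemma higher_differentiable_on_imp_continuous_on:
  "higher_differentiable_on k S f \<Longrightarrow> continuous_on S f"
  by (cases k) (auto intro!: continuous_at_imp_continuous_on differentiable_imp_continuous_within)

lemma higher_differentiable_on_lipschitz:
  fixes f :: "'a::euclidean_space \<Rightarrow> 'b::real_normed_vector"
  assumes f: "higher_differentiable_on (Suc k) Z f" and K: "compact K" "convex K" "K \<subseteq> Z"
  obtains C where "C > 0" "\<And>z z'. z \<in> K \<Longrightarrow> z' \<in> K \<Longrightarrow> norm (f z - f z') \<le> C * norm (z - z')"
proof -
  let ?D = "\<lambda>z. frechet_derivative f (at z)"
  have d: "(f has_derivative ?D z) (at z)" if "z \<in> K" for z
    using f K that by (auto simp flip: frechet_derivative_works)
  have "continuous_on K (\<lambda>z. ?D z b)" for b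
    using f K by (auto intro!: continuous_on_subset[OF higher_differentiable_on_imp_continuous_on])
  then have "continuous_on K (\<lambda>z. \<Sum>b\<in>Basis. norm (?D z b))" by (intro continuous_intros)
  then have "bounded ((\<lambda>z. \<Sum>b\<in>Basis. norm (?D z b)) ` K)"
    using K(1) by (intro compact_imp_bounded compact_continuous_image)
  then obtain C where C: "C > 0" "\<And>z. z \<in> K \<Longrightarrow> (\<Sum>b\<in>Basis. norm (?D z b)) \<le> C"
    unfolding bounded_pos by (force simp: abs_le_iff)
  have "onorm (?D z) \<le> C" if z: "z \<in> K" for z
  proof (rule onorm_le)
    fix v
    have "norm (?D z v) \<le> norm v * (\<Sum>b\<in>Basis. norm (?D z b))"
      by (rule norm_linear_le_Basis[OF has_derivative_linear[OF d[OF z]]])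
    also have "\<dots> \<le> norm v * C" using C(2)[OF z] by (intro mult_left_mono) auto
    finally show "norm (?D z v) \<le> C * norm v" by (simp add: mult.commute)
  qed
  then have "norm (f z - f z') \<le> C * norm (z - z')" if "z \<in> K" "z' \<in> K" for z z'
    using differentiable_bound[OF K(2) has_derivative_at_withinI[OF d]] that by blast
  then show ?thesis using that C(1) by blast
qed

text \<open>Each fixed \<open>w\<close> has its own constants; expansion over \<open>Basis\<close>
  makes them uniform, with a factor \<open>norm w\<close> that can later be made small.\<close>

lemma linear_family_lipschitz:
  fixes A :: "'a::euclidean_space \<Rightarrow> 'c::euclidean_space \<Rightarrow> 'b::real_normed_vector"
  assumes A: "\<And>w. higher_differentiable_on (Suc k) Z (\<lambda>z. A z w)" and lin: "\<And>z. z \<in> Z \<Longrightarrow> linear (A z)"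
    and K: "compact K" "convex K" "K \<subseteq> Z"
  obtains C where "C > 0" "\<And>z z' w. z \<in> K \<Longrightarrow> z' \<in> K \<Longrightarrow> norm (A z w - A z' w) \<le> C * norm (z - z') * norm w"
    "\<And>z w. z \<in> K \<Longrightarrow> norm (A z w) \<le> C * norm w"
proof -
  have "\<exists>C>0. \<forall>z\<in>K. \<forall>z'\<in>K. norm (A z w - A z' w) \<le> C * norm (z - z')" for w
    using higher_differentiable_on_lipschitz[OF A[of w] K] by metis
  then obtain c where c: "\<And>w. c w > 0" "\<And>w z z'. z \<in> K \<Longrightarrow> z' \<in> K \<Longrightarrow> norm (A z w - A z' w) \<le> c w * norm (z - z')"
    by metis
  have "\<exists>B>0. \<forall>z\<in>K. norm (A z w) \<le> B" for w
  proof -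
    have "continuous_on K (\<lambda>z. A z w)"
      by (rule continuous_on_subset[OF higher_differentiable_on_imp_continuous_on[OF A] K(3)])
    then have "bounded ((\<lambda>z. A z w) ` K)"
      by (intro compact_imp_bounded compact_continuous_image K(1))
    then show ?thesis by (auto simp: bounded_pos)
  qed
  then obtain B where B: "\<And>w. B w > 0" "\<And>w z. z \<in> K \<Longrightarrow> norm (A z w) \<le> B w" by metis
  define C where "C = (\<Sum>b\<in>Basis. c b) + (\<Sum>b\<in>Basis. B b)"
  have pos: "(\<Sum>b\<in>Basis. c b) > 0" "(\<Sum>b\<in>Basis. B b) > 0" using c B by (auto intro!: sum_pos)
  show ?thesis
  proof (rule that[of C])
    show "C > 0" using pos by (simp add: C_def)
    fix z w assume z: "z \<in> K"
    have "norm (A z w) \<le> norm w * (\<Sum>b\<in>Basis. norm (A z b))"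
      by (rule norm_linear_le_Basis) (use lin K z in auto)
    also have "\<dots> \<le> norm w * C"
      using sum_mono[of Basis "\<lambda>b. norm (A z b)" B] B(2)[OF z] pos by (intro mult_left_mono) (auto simp: C_def)
    finally show "norm (A z w) \<le> C * norm w" by (simp add: mult.commute)
    fix z' assume z': "z' \<in> K"
    have "norm (A z w - A z' w) \<le> norm w * (\<Sum>b\<in>Basis. norm (A z b - A z' b))"
      by (rule norm_linear_le_Basis) (intro linear_compose_sub lin; use K z z' in auto)
    also have "\<dots> \<le> norm w * (C * norm (z - z'))"
    proof (rule mult_left_mono)
      have "(\<Sum>b\<in>Basis. norm (A z b - A z' b)) \<le> (\<Sum>b\<in>Basis. c b) * norm (z - z')"
        unfolding sum_distrib_right by (intro sum_mono c z z')
      also have "\<dots> \<le> C * norm (z - z')" using pos by (intro mult_right_mono) (auto simp: C_def)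
      finally show "(\<Sum>b\<in>Basis. norm (A z b - A z' b)) \<le> C * norm (z - z')" .
    qed simp
    finally show "norm (A z w - A z' w) \<le> C * norm (z - z') * norm w" by (simp add: mult.commute)
  qed
qed

text \<open>
  The radial equation \<open>\<phi>' = A(\<phi>) p\<close>: the parameter \<open>p\<close> is at once the velocity and the initial datum,
  and a small \<open>p\<close> makes the right-hand side a contraction.
\<close>

lemma parametric_flow:
  fixes A :: "'a::euclidean_space \<Rightarrow> 'a \<Rightarrow> 'a"
  assumes Z0: "open Z0" "z0 \<in> Z0" and A: "\<And>w. smooth_on Z0 (\<lambda>z. A z w)"
    and lin: "\<And>z. z \<in> Z0 \<Longrightarrow> linear (A z)"
    and V: "open V" "0 \<in> V" and b: "smooth_on V b" "b 0 = z0"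
  obtains r and \<phi> :: "real \<Rightarrow> 'a \<Rightarrow> 'a" where "r > 0" "ball 0 r \<subseteq> V" "\<And>k. fam_Ck k {0..1} (ball 0 r) \<phi>"
    "\<And>t p. t \<in> {0..1} \<Longrightarrow> p \<in> ball 0 r \<Longrightarrow> \<phi> t p \<in> Z0"
    "\<And>t p. t \<in> {0..1} \<Longrightarrow> p \<in> ball 0 r \<Longrightarrow> \<phi> t p = b p + integral {0..t} (\<lambda>s. A (\<phi> s p) p)"
    "\<And>t p \<zeta>. t \<in> {0..1} \<Longrightarrow> p \<in> ball 0 r \<Longrightarrow>
       norm (frechet_derivative (\<lambda>z. A z p) (at (\<phi> t p)) \<zeta>) \<le> norm \<zeta> / 2"
    "\<And>w t p. t \<in> {0..1} \<Longrightarrow> p \<in> ball 0 r \<Longrightarrow> frechet_derivative (\<phi> t) (at p) w = frechet_derivative b (at p) w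
       + integral {0..t} (\<lambda>s. A (\<phi> s p) w
           + frechet_derivative (\<lambda>z. A z p) (at (\<phi> s p)) (frechet_derivative (\<phi> s) (at p) w))"
proof -
  obtain R where R: "R > 0" "cball z0 R \<subseteq> Z0" using Z0 open_contains_cball by blast
  have A': "higher_differentiable_on k Z0 (\<lambda>z. A z w)" for k w using A by (auto simp: smooth_on_def)
  have b': "higher_differentiable_on k V b" for k using b by (auto simp: smooth_on_def)
  obtain C where C: "C > 0"
    "\<And>z z' w. z \<in> cball z0 R \<Longrightarrow> z' \<in> cball z0 R \<Longrightarrow> norm (A z w - A z' w) \<le> C * norm (z - z') * norm w"
    "\<And>z w. z \<in> cball z0 R \<Longrightarrow> norm (A z w) \<le> C * norm w"
    using linear_family_lipschitz[OF A' lin compact_cball convex_cball R(2)] by metis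
  have "isCont b 0" using b'[of 0] V continuous_on_eq_continuous_at by auto
  then obtain r1 where r1: "r1 > 0" "\<And>p. norm p < r1 \<Longrightarrow> norm (b p - z0) < R / 2"
    using R(1) b(2) unfolding continuous_at_eps_delta by (metis dist_0_norm dist_commute dist_norm half_gt_zero)
  obtain r2 where r2: "r2 > 0" "cball 0 r2 \<subseteq> V" using V open_contains_cball by blast
  \<comment> \<open>\<open>r1\<close> keeps the initial point within \<open>R / 2\<close> of
    \<open>z0\<close> and \<open>r2\<close> keeps \<open>p\<close> in \<open>V\<close>. The bound
    \<open>R / (4 * C)\<close> limits the displacement to \<open>R / 4\<close>, so the curve stays
    in the ball, and \<open>1 / (2 * C)\<close> gives the Lipschitz constant 1/2.\<close>
  define r where "r = min (min (r1 / 2) r2) (min (R / (4 * C)) (1 / (2 * C)))"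
  have r: "r > 0" "r < r1" "r \<le> r2" "C * r \<le> R / 4" "C * r \<le> 1 / 2"
  proof -
    show "r > 0" using r1 r2 R C by (simp add: r_def)
    show "r < r1" using r1 by (simp add: r_def)
    show "r \<le> r2" by (simp add: r_def)
    have "r \<le> R / (4 * C)" "r \<le> 1 / (2 * C)" by (auto simp: r_def)
    then show "C * r \<le> R / 4" "C * r \<le> 1 / 2" using C(1) by (auto simp: field_simps)
  qed
  let ?K = "cball 0 r :: 'a set" and ?S = "ball 0 r :: 'a set" and ?Z = "ball z0 R"
  \<comment> \<open>Composing with the closest-point map extends the field to all states without
    increasing its Lipschitz constant, as \<open>volterra_existence\<close> requires; the extension
    is invisible once the solution is known to stay in the ball.\<close>
  define cp where "cp = closest_point (cball z0 R)"
  have cp: "cp z \<in> cball z0 R" for z unfolding cp_def using R(1) by (intro closest_point_in_set) auto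
  have cp_dist: "norm (cp z - cp z') \<le> norm (z - z')" for z z'
    using closest_point_lipschitz[of "cball z0 R" z z'] R(1) by (simp add: cp_def dist_norm)
  have ccp: "continuous_on UNIV cp"
    unfolding cp_def using R(1) by (intro continuous_on_closest_point) auto
  have cA: "continuous_on (cball z0 R) (\<lambda>z. A z w)" for w
    using A'[of 0 w] R by (auto elim: continuous_on_subset)
  define G where "G = (\<lambda>(s::real) (p, z). A (cp z) p)"
  have cG: "continuous_on ({0..1} \<times> ?K \<times> UNIV) (\<lambda>(s, q). G s q)"
  proof -
    have "continuous_on ({0..1::real} \<times> ?K \<times> UNIV) (\<lambda>q. A (cp (snd (snd q))) c)" for c
      by (rule continuous_on_compose2[OF cA], rule continuous_on_compose2[OF ccp])
        (use cp in \<open>auto intro!: continuous_intros\<close>)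
    then have "continuous_on ({0..1::real} \<times> ?K \<times> UNIV) (\<lambda>q. \<Sum>c\<in>Basis. (fst (snd q) \<bullet> c) *\<^sub>R A (cp (snd (snd q))) c)"
      by (intro continuous_intros)
    then show ?thesis
      by (rule continuous_on_eq) (auto simp: G_def linear_Basis_sum[OF lin[OF subsetD[OF R(2) cp]], symmetric])
  qed
  have lG: "norm (G s (p, z) - G s (p, z')) \<le> norm (z - z') / 2" if "p \<in> ?K" for s p z z'
  proof -
    have "norm (A (cp z) p - A (cp z') p) \<le> C * norm (cp z - cp z') * norm p" using C(2)[OF cp cp] .
    also have "\<dots> \<le> C * norm (z - z') * r"
      using C(1) cp_dist that r by (intro mult_mono) auto
    also have "\<dots> = (C * r) * norm (z - z')" by simp
    also have "\<dots> \<le> 1/2 * norm (z - z')" using r by (intro mult_right_mono) auto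
    finally show ?thesis by (simp add: G_def)
  qed
  have cb: "continuous_on ({0..1::real} \<times> ?K) (\<lambda>(t, p). b p)"
  proof -
    have "continuous_on ?K b" using b'[of 0] r r2 by (auto elim!: continuous_on_subset)
    then show ?thesis
      by (auto simp: case_prod_unfold intro!: continuous_on_compose2[of ?K b _ snd] continuous_intros)
  qed
  have "?K \<noteq> {}" using r by simp
  then obtain \<phi> where \<phi>: "continuous_on ({0..1} \<times> ?K) (\<lambda>(t, p). \<phi> t p)"
    "\<And>t p. t \<in> {0..1} \<Longrightarrow> p \<in> ?K \<Longrightarrow> \<phi> t p = b p + integral {0..t} (\<lambda>s. G s (p, \<phi> s p))"
    by (rule volterra_existence[OF compact_cball convex_cball _ cG lG cb]) (assumption | rule that)+
  then have \<phi>: "continuous_on ({0..1} \<times> ?K) (\<lambda>(t, p). \<phi> t p)"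
    "\<And>t p. t \<in> {0..1} \<Longrightarrow> p \<in> ?K \<Longrightarrow> \<phi> t p = b p + integral {0..t} (\<lambda>s. A (cp (\<phi> s p)) p)"
    by (auto simp: G_def)
  have \<phi>Z: "\<phi> t p \<in> ?Z" if t: "t \<in> {0..1}" and p: "p \<in> ?K" for t p
  proof -
    have c: "continuous_on {0..1} (\<lambda>s. A (cp (\<phi> s p)) p)"
      by (rule continuous_on_compose2[OF cA], rule continuous_on_compose2[OF ccp continuous_on_slice[OF \<phi>(1) p]]) (use cp in auto)
    have "norm (integral {0..t} (\<lambda>s. A (cp (\<phi> s p)) p)) \<le> C * r"
    proof (rule norm_integral_time_le[OF c t])
      show "norm (A (cp (\<phi> s p)) p) \<le> C * r" for s
        by (rule order_trans[OF C(3)[OF cp] mult_left_mono]) (use C(1) p in auto)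
    qed
    moreover have "\<phi> t p - z0 = (b p - z0) + integral {0..t} (\<lambda>s. A (cp (\<phi> s p)) p)"
      using \<phi>(2)[OF t p] by simp
    then have "norm (\<phi> t p - z0) \<le> norm (b p - z0) + norm (integral {0..t} (\<lambda>s. A (cp (\<phi> s p)) p))"
      by (simp only: norm_triangle_ineq)
    ultimately have "norm (\<phi> t p - z0) \<le> norm (b p - z0) + C * r" by linarith
    also have "\<dots> < R" using r1(2)[of p] r p R(1) by simp
    finally show ?thesis by (simp add: dist_norm norm_minus_commute)
  qed
  have SK: "?S \<subseteq> ?K" by auto
  have \<phi>eq: "\<phi> t p = b p + integral {0..t} (\<lambda>s. A (\<phi> s p) p)" if t: "t \<in> {0..1}" and p: "p \<in> ?S" for t p
  proof -
    have "integral {0..t} (\<lambda>s. A (cp (\<phi> s p)) p) = integral {0..t} (\<lambda>s. A (\<phi> s p) p)"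
    proof (rule integral_cong)
      fix s assume "s \<in> {0..t}"
      then have "\<phi> s p \<in> ?Z" using \<phi>Z[of s p] t p by auto
      then show "A (cp (\<phi> s p)) p = A (\<phi> s p) p" by (simp add: cp_def closest_point_self)
    qed
    then show ?thesis using \<phi>(2)[OF t] p by auto
  qed
  \<comment> \<open>The closest-point map need not be smooth. As \<open>\<phi>\<close> stays in
    \<open>?Z\<close>, the equation can be restated with the original field, to which the smoothness
    results apply.\<close>
  define H :: "real \<Rightarrow> 'a \<times> 'a \<Rightarrow> 'a" where "H s q = A (snd q) (fst q)" for s q
  have SZ: "open (?S \<times> ?Z)" by (intro open_Times) auto
  have ZZ0: "?Z \<subseteq> Z0" using R by auto
  have Hk: "fam_Ck k {0..1} (?S \<times> ?Z) H" for k
  proof (rule fam_Ck_cong[OF SZ])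
    show "fam_Ck k {0..1} (?S \<times> ?Z) (\<lambda>s q. \<Sum>c\<in>Basis. (fst q \<bullet> c) *\<^sub>R A (snd q) c)"
    proof (intro fam_Ck_sum SZ fam_Ck_bilinear[OF SZ bounded_bilinear_scaleR])
      show "fam_Ck k {0..1} (?S \<times> ?Z) (\<lambda>t q. fst q \<bullet> c)" for c
        by (intro fam_Ck_linear SZ) (auto simp: linear_iff inner_left_distrib)
      show "fam_Ck k {0..1} (?S \<times> ?Z) (\<lambda>t q. A (snd q) c)" for c
        by (rule fam_Ck_compose[where F = "\<lambda>_ z. A z c" and f = "\<lambda>_ q. snd q", OF SZ Z0(1) fam_Ck_const_time[OF A']])
          (use ZZ0 in \<open>auto intro!: fam_Ck_linear SZ linear_snd\<close>)
    qed
    show "(\<Sum>c\<in>Basis. (fst q \<bullet> c) *\<^sub>R A (snd q) c) = H s q" if "q \<in> ?S \<times> ?Z" for s q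
      using linear_Basis_sum[OF lin, of "snd q" "fst q"] that ZZ0 by (auto simp: H_def)
  qed
  have lipH: "norm (H s (p, z) - H s (p, z')) \<le> norm (z - z') / 2" if "p \<in> ?S" "z \<in> ?Z" "z' \<in> ?Z" for s p z z'
  proof -
    have "norm (A z p - A z' p) \<le> C * norm (z - z') * norm p" using C(2) that by auto
    also have "\<dots> \<le> C * norm (z - z') * r"
      using C(1) that by (intro mult_left_mono) auto
    also have "\<dots> = (C * r) * norm (z - z')" by simp
    also have "\<dots> \<le> 1/2 * norm (z - z')" using r by (intro mult_right_mono) auto
    finally show ?thesis by (simp add: H_def)
  qed
  have SV: "?S \<subseteq> V" using r r2 by auto
  have bk: "fam_Ck k {0..1} ?S (\<lambda>_. b)" for k
    by (rule fam_Ck_subset[OF fam_Ck_const_time[OF b'] order.refl SV])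
  have c\<phi>: "continuous_on ({0..1} \<times> ?S) (\<lambda>(t, p). \<phi> t p)"
    by (rule continuous_on_subset[OF \<phi>(1)]) auto
  have \<phi>Z': "\<phi> t p \<in> ?Z" if "t \<in> {0..1}" "p \<in> ?S" for t p using \<phi>Z that by auto
  have \<phi>H: "\<phi> t p = b p + integral {0..t} (\<lambda>s. H s (p, \<phi> s p))" if "t \<in> {0..1}" "p \<in> ?S" for t p
    using \<phi>eq[OF that] by (simp add: H_def)
  have 1: "fam_Ck k {0..1} ?S \<phi>" for k
    by (rule volterra_Ck[OF open_ball open_ball Hk lipH bk c\<phi> \<phi>Z' \<phi>H])
  have 2: "frechet_derivative (\<phi> t) (at p) w = frechet_derivative b (at p) w
      + integral {0..t} (\<lambda>s. frechet_derivative (H s) (at (p, \<phi> s p)) (w, frechet_derivative (\<phi> s) (at p) w))"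
    if "t \<in> {0..1}" "p \<in> ?S" for t p w
    using volterra_C1(2)[OF open_ball open_ball Hk lipH bk c\<phi> \<phi>Z' \<phi>H] that by auto
  have dH: "frechet_derivative (H s) (at (p, z)) (w, \<zeta>) = A z w + frechet_derivative (\<lambda>z. A z p) (at z) \<zeta>"
    "norm (frechet_derivative (\<lambda>z. A z p) (at z) \<zeta>) \<le> norm \<zeta> / 2"
    if s: "s \<in> {0..1}" and p: "p \<in> ?S" and z: "z \<in> ?Z" for s p z w \<zeta>
  proof -
    let ?D = "frechet_derivative (H s) (at (p, z))"
    have d: "(H s has_derivative ?D) (at (p, z))"
      by (rule fam_Ck_has_derivative[OF Hk s]) (use p z in auto)
    have "((\<lambda>p. H s (p, z)) has_derivative (\<lambda>w. ?D (w, 0))) (at p)"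
      by (rule has_derivative_compose[OF has_derivative_Pair[OF has_derivative_ident has_derivative_const] d])
    then have "(A z has_derivative (\<lambda>w. ?D (w, 0))) (at p)" by (simp add: H_def)
    moreover have "(A z has_derivative A z) (at p)"
      using lin[of z] z ZZ0 by (intro linear_imp_has_derivative) auto
    ultimately have w: "?D (w, 0) = A z w" by (metis has_derivative_unique)
    have "((\<lambda>z. H s (p, z)) has_derivative (\<lambda>\<zeta>. ?D (0, \<zeta>))) (at z)"
      by (rule has_derivative_compose[OF has_derivative_Pair[OF has_derivative_const has_derivative_ident] d])
    then have "((\<lambda>z. A z p) has_derivative (\<lambda>\<zeta>. ?D (0, \<zeta>))) (at z)" by (simp add: H_def)
    then have \<zeta>: "frechet_derivative (\<lambda>z. A z p) (at z) \<zeta> = ?D (0, \<zeta>)" for \<zeta>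
      by (simp flip: frechet_derivative_at)
    have "?D ((w, 0) + (0, \<zeta>)) = ?D (w, 0) + ?D (0, \<zeta>)"
      by (rule linear_add[OF has_derivative_linear[OF d]])
    then show "?D (w, \<zeta>) = A z w + frechet_derivative (\<lambda>z. A z p) (at z) \<zeta>" by (simp add: w \<zeta>)
    show "norm (frechet_derivative (\<lambda>z. A z p) (at z) \<zeta>) \<le> norm \<zeta> / 2"
      using partial_derivative_norm_le[OF d open_ball z, of "1/2" \<zeta>] lipH[OF p _ z] by (simp add: \<zeta>)
  qed
  show ?thesis
  proof (rule that[of r \<phi>])
    show "fam_Ck k {0..1} ?S \<phi>" for k by (rule 1)
    show "\<phi> t p \<in> Z0" if "t \<in> {0..1}" "p \<in> ?S" for t p using \<phi>Z'[OF that] ZZ0 by blast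
    show "norm (frechet_derivative (\<lambda>z. A z p) (at (\<phi> t p)) \<zeta>) \<le> norm \<zeta> / 2"
      if "t \<in> {0..1}" "p \<in> ?S" for t p \<zeta> using dH(2)[OF that \<phi>Z'[OF that]] .
    show "frechet_derivative (\<phi> t) (at p) w = frechet_derivative b (at p) w
       + integral {0..t} (\<lambda>s. A (\<phi> s p) w
           + frechet_derivative (\<lambda>z. A z p) (at (\<phi> s p)) (frechet_derivative (\<phi> s) (at p) w))"
      if t: "t \<in> {0..1}" and p: "p \<in> ?S" for t p w
    proof -
      have "integral {0..t} (\<lambda>s. frechet_derivative (H s) (at (p, \<phi> s p)) (w, frechet_derivative (\<phi> s) (at p) w))
        = integral {0..t} (\<lambda>s. A (\<phi> s p) w
           + frechet_derivative (\<lambda>z. A z p) (at (\<phi> s p)) (frechet_derivative (\<phi> s) (at p) w))"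
        by (rule integral_cong, rule dH(1)) (use t p \<phi>Z' in auto)
      then show ?thesis using 2[OF t p, of w] by simp
    qed
  qed (use \<phi>eq r(1) SV in auto)
qed

section \<open>The adapted projection of an involutive frame\<close>

lemma smooth_on_fam_Ck: "smooth_on S f \<Longrightarrow> fam_Ck k I S (\<lambda>_. f)"
  by (simp add: smooth_on_def fam_Ck_const_time)

text \<open>Plain smoothness is the case of a one-point time set, so the calculus of families
  applies to it unchanged.\<close>

lemma smooth_on_fam_Ck_iff: "smooth_on S f \<longleftrightarrow> (\<forall>k. fam_Ck k {0::real} S (\<lambda>_. f))"
  using smooth_on_fam_Ck[of S f _ "{0}"] fam_Ck_imp_higher_differentiable_on[of _ "{0}" S "\<lambda>_. f" 0]
  by (auto simp: smooth_on_def)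

lemma smooth_on_has_derivative:
  "smooth_on S f \<Longrightarrow> x \<in> S \<Longrightarrow> (f has_derivative frechet_derivative f (at x)) (at x)"
  using fam_Ck_has_derivative[OF smooth_on_fam_Ck[of S f "Suc 0" "{0::real}"]] by auto

lemma smooth_on_imp_continuous_on: "smooth_on S f \<Longrightarrow> continuous_on S f"
  unfolding smooth_on_def using higher_differentiable_on.simps(1) by blast

section \<open>Smoothness of determinants and of inverse linear maps\<close>

lemma fam_Ck_vec:
  fixes f :: "'c::topological_space \<Rightarrow> 'a::real_normed_vector \<Rightarrow> real ^ 'n"
  assumes S: "open S" and "\<And>i. fam_Ck k I S (\<lambda>t x. f t x $ i)"
  shows "fam_Ck k I S f"
proof -
  have "fam_Ck k I S (\<lambda>t x. \<Sum>i\<in>UNIV. (f t x $ i) *\<^sub>R axis i (1::real))"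
    using assms by (intro fam_Ck_sum S fam_Ck_bilinear[OF S bounded_bilinear_scaleR] fam_Ck_const continuous_on_const)
  then show ?thesis
  proof (rule fam_Ck_cong[OF S, rotated])
    show "(\<Sum>i\<in>UNIV. (f t x $ i) *\<^sub>R axis i (1::real)) = f t x" for t x
      using basis_expansion[of "f t x"] by (simp add: scalar_mult_eq_scaleR)
  qed
qed

lemma fam_Ck_det:
  fixes M :: "'c::topological_space \<Rightarrow> 'a::real_normed_vector \<Rightarrow> real ^ 'n ^ 'n"
  assumes S: "open S" and "\<And>i j. fam_Ck k I S (\<lambda>t x. M t x $ i $ j)"
  shows "fam_Ck k I S (\<lambda>t x. det (M t x))"
  unfolding det_def using assms
  by (intro fam_Ck_sum S fam_Ck_bilinear[OF S bounded_bilinear_mult] fam_Ck_const continuous_on_const fam_Ck_prod)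

text \<open>Cramer's rule writes the components of \<open>R t x w\<close> as quotients of
  determinants in the entries of \<open>T t x\<close>. Hence no order of differentiability is lost
  in passing to the inverse.\<close>

lemma fam_Ck_linear_inverse:
  fixes T :: "'c::topological_space \<Rightarrow> 'a::real_normed_vector \<Rightarrow> real ^ 'n \<Rightarrow> real ^ 'n"
  assumes S: "open S" and T: "\<And>w. fam_Ck k I S (\<lambda>t x. T t x w)"
    and lin: "\<And>t x. t \<in> I \<Longrightarrow> x \<in> S \<Longrightarrow> linear (T t x)"
    and inv: "\<And>t x w. t \<in> I \<Longrightarrow> x \<in> S \<Longrightarrow> T t x (R t x w) = w"
  shows "fam_Ck k I S (\<lambda>t x. R t x w)"
proof (rule fam_Ck_cong[OF S])
  let ?M = "\<lambda>t x. matrix (T t x)"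
  have Mk: "fam_Ck k I S (\<lambda>t x. ?M t x $ i $ j)" for i j
    unfolding matrix_def using fam_Ck_bounded_linear[OF S bounded_linear_vec_nth T] by simp
  have M: "?M t x *v w = T t x w" if "t \<in> I" "x \<in> S" for t x w
    using fun_cong[OF matrix_vector_mul(2)[OF lin[OF that]]] .
  have det: "det (?M t x) \<noteq> 0" if "t \<in> I" "x \<in> S" for t x
  proof -
    have "surj (T t x)" using inv[OF that] by (metis surjI)
    moreover have "(*v) (?M t x) = T t x" using M[OF that] by auto
    ultimately have "surj ((*v) (?M t x))" by simp
    then show ?thesis
      by (metis invertible_det_nz invertible_right_inverse matrix_right_invertible_surjective)
  qed
  let ?C = "\<lambda>t x. \<chi> k. det (\<chi> i j. if j = k then w $ i else ?M t x $ i $ j) / det (?M t x)"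
  show "?C t x = R t x w" if "t \<in> I" "x \<in> S" for t x
    using iffD1[OF cramer[OF det[OF that]], OF trans[OF M[OF that] inv[OF that]]] by (rule sym)
  show "fam_Ck k I S ?C"
  proof (rule fam_Ck_vec[OF S])
    fix l
    have num: "fam_Ck k I S (\<lambda>t x. det (\<chi> i j. if j = l then w $ i else ?M t x $ i $ j))"
    proof (rule fam_Ck_det[OF S])
      show "fam_Ck k I S (\<lambda>t x. (\<chi> i j. if j = l then w $ i else ?M t x $ i $ j) $ i $ j)" for i j
        using Mk[of i j] S by (cases "j = l") (auto intro!: fam_Ck_const)
    qed
    have "fam_Ck k I S (\<lambda>t x. det (\<chi> i j. if j = l then w $ i else ?M t x $ i $ j) * inverse (det (?M t x)))"
      by (rule fam_Ck_bilinear[OF S bounded_bilinear_mult num fam_Ck_inverse[OF S fam_Ck_det[OF S Mk] det]])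
    then show "fam_Ck k I S (\<lambda>t x. ?C t x $ l)" by (simp add: divide_inverse)
  qed
qed

section \<open>Independent families, dual coordinates and a product rule\<close>

lemma independent_Un_subspace:
  fixes A B :: "'a::euclidean_space set"
  assumes A: "independent A" and B: "independent B" and AB: "span A \<inter> span B = {0}"
  shows "independent (A \<union> B)" "A \<inter> B = {}"
proof -
  have fin: "finite A" "finite B" using A B by (auto simp: independent_explicit)
  show disj: "A \<inter> B = {}"
  proof (rule ccontr)
    assume "A \<inter> B \<noteq> {}"
    then obtain v where v: "v \<in> A" "v \<in> B" by blast
    then have "v = 0" using AB span_base[of v A] span_base[of v B] by blast
    then show False using v(1) A dependent_zero by blast
  qed
  show "independent (A \<union> B)"
    unfolding independent_explicit
  proof (intro conjI allI impI)
    fix c assume 0: "(\<Sum>v\<in>A \<union> B. c v *\<^sub>R v) = 0"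
    then have s: "(\<Sum>v\<in>A. c v *\<^sub>R v) + (\<Sum>v\<in>B. c v *\<^sub>R v) = 0"
      using fin disj by (simp add: sum.union_disjoint)
    have a: "(\<Sum>v\<in>A. c v *\<^sub>R v) \<in> span A" by (intro span_sum span_scale span_base)
    have b: "(\<Sum>v\<in>B. c v *\<^sub>R v) \<in> span B" by (intro span_sum span_scale span_base)
    have "(\<Sum>v\<in>A. c v *\<^sub>R v) = - (\<Sum>v\<in>B. c v *\<^sub>R v)" using s by (simp add: eq_neg_iff_add_eq_0)
    then have "(\<Sum>v\<in>A. c v *\<^sub>R v) \<in> span A \<inter> span B" using a b span_neg by force
    then have "(\<Sum>v\<in>A. c v *\<^sub>R v) = 0" "(\<Sum>v\<in>B. c v *\<^sub>R v) = 0" using AB s by auto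
    then show "\<forall>v\<in>A \<union> B. c v = 0" using A B by (auto simp: independent_explicit)
  qed (use fin in auto)
qed

text \<open>Values may be prescribed freely on the given vectors together with a basis
  \<open>B\<close> of \<open>E\<close>: the two spans meet only in 0, so the union is
  independent.\<close>

lemma dual_functionals:
  fixes b :: "nat \<Rightarrow> 'a::euclidean_space"
  assumes inj: "inj_on b J" and ind: "independent (b ` J)" and E: "subspace E" and 0: "span (b ` J) \<inter> E = {0}"
  obtains \<beta> :: "nat \<Rightarrow> 'a \<Rightarrow> real" where "\<And>i. linear (\<beta> i)" "\<And>i e. e \<in> E \<Longrightarrow> \<beta> i e = 0"
    "\<And>i j. i \<in> J \<Longrightarrow> j \<in> J \<Longrightarrow> \<beta> i (b j) = (if i = j then 1 else 0)"
proof -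
  obtain B where B: "B \<subseteq> E" "independent B" "span B = E"
    using E by (metis maximal_independent_subset span_eq_iff subset_antisym span_mono)
  have U: "independent (b ` J \<union> B)" "b ` J \<inter> B = {}"
    using independent_Un_subspace[OF ind B(2)] 0 B(3) by auto
  have "\<exists>f. linear f \<and> (\<forall>x\<in>b ` J \<union> B. f x = (if x = b i \<and> i \<in> J then 1 else (0::real)))" for i
    by (rule linear_independent_extend[OF U(1)])
  then obtain \<beta> where \<beta>: "\<And>i. linear (\<beta> i)" "\<And>i x. x \<in> b ` J \<union> B \<Longrightarrow> \<beta> i x = (if x = b i \<and> i \<in> J then 1 else (0::real))"
    by metis
  show ?thesis
  proof (rule that[of \<beta>])
    show "\<beta> i e = 0" if "e \<in> E" for i :: nat and e :: 'a
    proof (rule linear_eq_on_span[where f = "\<beta> i" and B = B])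
      show "linear (\<lambda>_::'a. 0::real)" by (simp add: linear_iff)
      show "\<beta> i x = 0" if "x \<in> B" for x using \<beta>(2)[of x i] that U(2) by auto
    qed (use that B \<beta>(1) in auto)
    show "\<beta> i (b j) = (if i = j then 1 else 0)" if "i \<in> J" "j \<in> J" for i j
      using \<beta>(2)[of "b j" i] that inj by (auto simp: inj_on_eq_iff)
  qed (rule \<beta>(1))
qed

text \<open>Expansion over \<open>Basis\<close> reduces this to the ordinary product rule. Linearity
  of \<open>A z\<close> near \<open>z\<close> forces \<open>dA w\<close> to be linear in
  \<open>w\<close>, which reassembles the sum.\<close>

lemma linear_family_product_rule:
  fixes A :: "'a::euclidean_space \<Rightarrow> 'c::euclidean_space \<Rightarrow> 'b::real_normed_vector"
  assumes Z: "open Z" "z \<in> Z" and lin: "\<And>z. z \<in> Z \<Longrightarrow> linear (A z)"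
    and A: "\<And>w. ((\<lambda>z. A z w) has_derivative dA w) (at z)"
    and f: "(f has_derivative f') (at z)"
  shows "((\<lambda>z. A z (f z)) has_derivative (\<lambda>\<zeta>. dA (f z) \<zeta> + A z (f' \<zeta>))) (at z)"
proof -
  have "((\<lambda>z. \<Sum>b\<in>Basis. (w \<bullet> b) *\<^sub>R A z b) has_derivative (\<lambda>\<zeta>. \<Sum>b\<in>Basis. (w \<bullet> b) *\<^sub>R dA b \<zeta>)) (at z)" for w
    by (intro derivative_intros A)
  then have "((\<lambda>z. A z w) has_derivative (\<lambda>\<zeta>. \<Sum>b\<in>Basis. (w \<bullet> b) *\<^sub>R dA b \<zeta>)) (at z)" for w
    by (rule has_derivative_transform_within_open[OF _ Z]) (simp add: linear_Basis_sum[OF lin, symmetric])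
  then have dA: "dA w = (\<lambda>\<zeta>. \<Sum>b\<in>Basis. (w \<bullet> b) *\<^sub>R dA b \<zeta>)" for w
    using has_derivative_unique A by blast
  have "((\<lambda>z. \<Sum>b\<in>Basis. (f z \<bullet> b) *\<^sub>R A z b) has_derivative
      (\<lambda>\<zeta>. \<Sum>b\<in>Basis. (f z \<bullet> b) *\<^sub>R dA b \<zeta> + (f' \<zeta> \<bullet> b) *\<^sub>R A z b)) (at z)"
    by (intro derivative_intros A f)
  then have "((\<lambda>z. A z (f z)) has_derivative
      (\<lambda>\<zeta>. \<Sum>b\<in>Basis. (f z \<bullet> b) *\<^sub>R dA b \<zeta> + (f' \<zeta> \<bullet> b) *\<^sub>R A z b)) (at z)"
    by (rule has_derivative_transform_within_open[OF _ Z]) (simp add: linear_Basis_sum[OF lin, symmetric])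
  moreover have "(\<lambda>\<zeta>. \<Sum>b\<in>Basis. (f z \<bullet> b) *\<^sub>R dA b \<zeta> + (f' \<zeta> \<bullet> b) *\<^sub>R A z b) = (\<lambda>\<zeta>. dA (f z) \<zeta> + A z (f' \<zeta>))"
    by (subst dA[of "f z"]) (simp add: sum.distrib linear_Basis_sum[OF lin[OF Z(2)], symmetric])
  ultimately show ?thesis by simp
qed

text \<open>
  \<open>A z\<close> maps into the span of the frame at \<open>z\<close> and is normalised by \<open>P \<circ> A z = P\<close>. The fields
  \<open>z \<mapsto> A z u\<close> have brackets in the span of the frame and in the kernel of \<open>P\<close>, so they commute; this is
  the last conclusion.
\<close>

lemma adapted_projection:
  fixes s :: "nat \<Rightarrow> real ^ 'n \<Rightarrow> real ^ 'n"
  assumes "open \<O>" "z0 \<in> \<O>" and frame: "partial_frame \<O> m s" and inv: "in_involution \<O> m s"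
    and E: "subspace E" "span ((\<lambda>i. s i z0) ` {1..m}) \<inter> E = {0}"
  obtains P A Z where "linear P" "\<And>w. P (P w) = P w" "\<And>e. e \<in> E \<Longrightarrow> P e = 0"
    "range P = span ((\<lambda>i. s i z0) ` {1..m})"
    "open Z" "z0 \<in> Z" "Z \<subseteq> \<O>" "\<And>z. z \<in> Z \<Longrightarrow> linear (A z)" "\<And>w. smooth_on Z (\<lambda>z. A z w)" "A z0 = P"
    "\<And>z w. z \<in> Z \<Longrightarrow> A z (P w) = A z w" "\<And>z w. z \<in> Z \<Longrightarrow> P (A z w) = P w"
    "\<And>z w. z \<in> Z \<Longrightarrow> A z w \<in> span ((\<lambda>i. s i z) ` {1..m})"
    "\<And>z w. z \<in> Z \<Longrightarrow> w \<in> span ((\<lambda>i. s i z) ` {1..m}) \<Longrightarrow> A z (P w) = w"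
    "\<And>z u v. z \<in> Z \<Longrightarrow> frechet_derivative (\<lambda>z. A z u) (at z) (A z v) = frechet_derivative (\<lambda>z. A z v) (at z) (A z u)"
proof -
  let ?J = "{1..m}"
  have s: "\<And>i. i \<in> ?J \<Longrightarrow> smooth_on \<O> (s i)" and si: "inj_on (\<lambda>i. s i z0) ?J" "independent ((\<lambda>i. s i z0) ` ?J)"
    using frame assms(2) by (auto simp: partial_frame_def)
  obtain \<beta> :: "nat \<Rightarrow> real ^ 'n \<Rightarrow> real" where \<beta>: "\<And>i. linear (\<beta> i)" "\<And>i e. e \<in> E \<Longrightarrow> \<beta> i e = 0"
    "\<And>i j. i \<in> ?J \<Longrightarrow> j \<in> ?J \<Longrightarrow> \<beta> i (s j z0) = (if i = j then 1 else 0)"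
    by (rule dual_functionals[OF si E]) (assumption | rule that)+
  define P where "P w = (\<Sum>i\<in>?J. \<beta> i w *\<^sub>R s i z0)" for w
  note \<beta>lin = linear_add[OF \<beta>(1)] linear_cmul[OF \<beta>(1)] linear_diff[OF \<beta>(1)] linear_sum[OF \<beta>(1)]
  have P: "linear P"
    unfolding P_def by (rule linearI) (simp_all add: \<beta>lin scaleR_add_left sum.distrib scaleR_sum_right)
  have \<beta>P: "\<beta> i (P w) = \<beta> i w" if "i \<in> ?J" for i w
  proof -
    have "\<beta> i (P w) = (\<Sum>j\<in>?J. \<beta> j w * (if i = j then 1 else 0))"
      unfolding P_def \<beta>lin using \<beta>(3)[OF that] by (intro sum.cong) auto
    also have "\<dots> = \<beta> i w" using that by (simp add: if_distrib sum.delta cong: if_cong)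
    finally show ?thesis .
  qed
  have PP: "P (P w) = P w" for w
    unfolding P_def[of "P w"] P_def[of w, symmetric] by (subst P_def[of w]) (simp add: \<beta>P)
  have PE: "P e = 0" if "e \<in> E" for e using \<beta>(2)[OF that] by (simp add: P_def)
  have Ps: "P (s j z0) = s j z0" if "j \<in> ?J" for j
  proof -
    have "P (s j z0) = (\<Sum>i\<in>?J. (if i = j then 1 else 0) *\<^sub>R s i z0)"
      unfolding P_def using \<beta>(3)[OF _ that] by (intro sum.cong) auto
    also have "\<dots> = s j z0" using that by (simp add: if_distrib[of "\<lambda>c. c *\<^sub>R _"] sum.delta cong: if_cong)
    finally show ?thesis .
  qed
  have rP: "range P = span ((\<lambda>i. s i z0) ` ?J)"
  proof
    show "range P \<subseteq> span ((\<lambda>i. s i z0) ` ?J)"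
      unfolding P_def by (intro image_subsetI span_sum span_scale span_base imageI)
    show "span ((\<lambda>i. s i z0) ` ?J) \<subseteq> range P"
    proof (rule span_minimal)
      show "(\<lambda>i. s i z0) ` ?J \<subseteq> range P" using Ps by (metis image_subsetI rangeI)
      show "subspace (range P)" by (rule linear_subspace_image[OF P subspace_UNIV])
    qed
  qed
  \<comment> \<open>\<open>T z\<close> fixes the kernel of \<open>P\<close> and sends
    \<open>s j z0\<close> to \<open>s j z\<close>. It is the identity at \<open>z0\<close>, hence
    invertible on an open set around it, which becomes \<open>Z\<close>.\<close>
  define T where "T z w = w - P w + (\<Sum>i\<in>?J. \<beta> i w *\<^sub>R s i z)" for z w
  have Tlin: "linear (T z)" for z
    unfolding T_def
    by (rule linearI) (simp_all add: \<beta>lin linear_add[OF P] linear_cmul[OF P] scaleR_add_left sum.distrib scaleR_sum_right algebra_simps)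
  have T0: "T z0 w = w" for w by (simp add: T_def P_def)
  have Tk: "fam_Ck k I \<O> (\<lambda>_::real. \<lambda>z. T z w)" for k I w
    unfolding T_def using s
    by (intro fam_Ck_add fam_Ck_sum assms(1) fam_Ck_bilinear[OF assms(1) bounded_bilinear_scaleR] fam_Ck_const continuous_on_const smooth_on_fam_Ck)
  define d where "d z = det (matrix (T z))" for z
  have "fam_Ck 0 {0::real} \<O> (\<lambda>_. d)"
    unfolding d_def
  proof (rule fam_Ck_det[OF assms(1)])
    show "fam_Ck 0 {0::real} \<O> (\<lambda>_ z. matrix (T z) $ i $ j)" for i j
      unfolding matrix_def using fam_Ck_bounded_linear[OF assms(1) bounded_linear_vec_nth Tk] by simp
  qed
  then have "continuous_on \<O> d" using fam_Ck_imp_higher_differentiable_on by fastforce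
  define Z where "Z = {z \<in> \<O>. d z \<noteq> 0}"
  have "open Z"
  proof -
    have "open (\<O> \<inter> d -` (- {0}))"
      by (rule continuous_open_preimage[OF \<open>continuous_on \<O> d\<close> assms(1)]) auto
    moreover have "\<O> \<inter> d -` (- {0}) = Z" by (auto simp: Z_def)
    ultimately show ?thesis by simp
  qed
  have "T z0 = id" by (auto simp: T0)
  then have "z0 \<in> Z" using assms(2) by (simp add: Z_def d_def matrix_id_mat_1)
  have ZO: "Z \<subseteq> \<O>" by (auto simp: Z_def)
  define R where "R z w = matrix_inv (matrix (T z)) *v w" for z w
  have TR: "T z (R z w) = w" "R z (T z w) = w" if "z \<in> Z" for z w
  proof -
    have i: "invertible (matrix (T z))" using that by (simp add: Z_def d_def invertible_det_nz)
    have M: "matrix (T z) *v x = T z x" for x using fun_cong[OF matrix_vector_mul(2)[OF Tlin]] .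
    have inv: "matrix (T z) ** matrix_inv (matrix (T z)) = mat 1 \<and> matrix_inv (matrix (T z)) ** matrix (T z) = mat 1"
      using i unfolding invertible_def matrix_inv_def by (rule someI_ex)
    have "T z (R z w) = (matrix (T z) ** matrix_inv (matrix (T z))) *v w"
      "R z (T z w) = (matrix_inv (matrix (T z)) ** matrix (T z)) *v w"
      by (simp_all add: R_def M flip: matrix_vector_mul_assoc)
    then show "T z (R z w) = w" "R z (T z w) = w" using inv by simp_all
  qed
  have Rlin: "linear (R z)" for z unfolding R_def by (rule matrix_vector_mul_linear)
  have Rk: "fam_Ck k I Z (\<lambda>_::real. \<lambda>z. R z w)" for k I w
    by (rule fam_Ck_linear_inverse[where T = "\<lambda>_. T", OF \<open>open Z\<close> fam_Ck_subset[OF Tk order.refl ZO]]) (auto simp: Tlin TR)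
  \<comment> \<open>With \<open>y = R z (P w)\<close>, the equation \<open>T z y = P w\<close>
    splits \<open>P w\<close> into \<open>y - P y\<close>, which lies in the kernel of
    \<open>P\<close>, and \<open>A z w\<close>. So \<open>A z w\<close> is the vector of the span at
    \<open>z\<close> with the same projection as \<open>w\<close>.\<close>
  define A where "A z w = (\<Sum>i\<in>?J. \<beta> i (R z (P w)) *\<^sub>R s i z)" for z w
  have Alin: "linear (A z)" for z
    unfolding A_def
    by (rule linearI) (simp_all add: \<beta>lin linear_add[OF P] linear_cmul[OF P] linear_add[OF Rlin] linear_cmul[OF Rlin]
      scaleR_add_left sum.distrib scaleR_sum_right)
  have As: "smooth_on Z (\<lambda>z. A z w)" for w
    unfolding A_def smooth_on_fam_Ck_iff
    using fam_Ck_bounded_linear[OF \<open>open Z\<close> linear_conv_bounded_linear[THEN iffD1, OF \<beta>(1)] Rk]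
      fam_Ck_subset[OF smooth_on_fam_Ck[OF s, where I = "{0::real}"] order.refl ZO]
    by (intro allI fam_Ck_sum \<open>open Z\<close> fam_Ck_bilinear[OF \<open>open Z\<close> bounded_bilinear_scaleR]) auto
  have "R z0 w = w" for w using TR(2)[OF \<open>z0 \<in> Z\<close>, of w] by (simp add: T0)
  then have A0: "A z0 = P" by (intro ext) (simp add: A_def \<beta>P, simp add: P_def)
  have AP: "A z (P w) = A z w" for z w by (simp add: A_def PP)
  have PA: "P (A z w) = P w" if "z \<in> Z" for z w
  proof -
    let ?y = "R z (P w)"
    have "A z w = P w - (?y - P ?y)" using TR(1)[OF that, of "P w"] by (simp add: A_def T_def algebra_simps)
    then show ?thesis by (simp add: linear_diff[OF P] PP)
  qed
  have Aspan: "A z w \<in> span ((\<lambda>i. s i z) ` ?J)" for z w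
    unfolding A_def by (intro span_sum span_scale span_base) auto
  have APs: "A z (P (s j z)) = s j z" if z: "z \<in> Z" and j: "j \<in> ?J" for z j
  proof -
    let ?d = "s j z"
    have "T z (s j z0) = (\<Sum>i\<in>?J. (if i = j then 1 else 0) *\<^sub>R s i z)"
      unfolding T_def Ps[OF j] diff_self add_0 by (intro sum.cong refl) (simp only: \<beta>(3)[OF _ j])
    also have "\<dots> = ?d" using j by (simp add: if_distrib[of "\<lambda>c. c *\<^sub>R _"] sum.delta cong: if_cong)
    finally have R1: "R z ?d = s j z0" using TR(2)[OF z] by metis
    have "T z (?d - P ?d) = ?d - P ?d"
      by (simp add: T_def linear_diff[OF P] PP \<beta>lin \<beta>P)
    then have R2: "R z (?d - P ?d) = ?d - P ?d" using TR(2)[OF z] by metis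
    have "R z (P ?d) = R z ?d - R z (?d - P ?d)" by (simp flip: linear_diff[OF Rlin])
    then have "R z (P ?d) = s j z0 - (?d - P ?d)" by (simp add: R1 R2)
    then have "\<beta> i (R z (P ?d)) = (if i = j then 1 else 0)" if "i \<in> ?J" for i
      using \<beta>(3)[OF that j] by (simp add: \<beta>lin \<beta>P[OF that])
    then have "A z (P ?d) = (\<Sum>i\<in>?J. (if i = j then 1 else 0) *\<^sub>R s i z)"
      unfolding A_def by (simp add: PP)
    also have "\<dots> = ?d" using j by (simp add: if_distrib[of "\<lambda>c. c *\<^sub>R _"] sum.delta cong: if_cong)
    finally show ?thesis .
  qed
  have APw: "A z (P w) = w" if z: "z \<in> Z" and "w \<in> span ((\<lambda>i. s i z) ` ?J)" for z w
  proof -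
    have "(A z \<circ> P) w = id w"
      by (rule linear_eq_on_span[OF linear_compose[OF P Alin] linear_id _ that(2)]) (use APs z in auto)
    then show ?thesis by simp
  qed
  define dA where "dA z w = frechet_derivative (\<lambda>z. A z w) (at z)" for z w
  have dA: "((\<lambda>z. A z w) has_derivative dA z w) (at z)" if "z \<in> Z" for z w
    unfolding dA_def using smooth_on_has_derivative[OF As that] .
  define ds where "ds i z = frechet_derivative (s i) (at z)" for i z
  have ds: "(s i has_derivative ds i z) (at z)" if "z \<in> Z" "i \<in> ?J" for z i
    unfolding ds_def using smooth_on_has_derivative[OF s[OF that(2)]] that ZO by blast
  \<comment> \<open>Differentiating \<open>A z (P (s j z)) = s j z\<close> along \<open>s i\<close> and antisymmetrising leaves only the bracket,
    which \<open>A z \<circ> P\<close> fixes.\<close>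
  have comm: "dA z u (A z v) = dA z v (A z u)" if z: "z \<in> Z" for z u v
  proof -
    have 1: "dA z (P (s j z)) \<zeta> + A z (P (ds j z \<zeta>)) = ds j z \<zeta>" if j: "j \<in> ?J" for j \<zeta>
    proof -
      have "((\<lambda>z. P (s j z)) has_derivative (\<lambda>\<zeta>. P (ds j z \<zeta>))) (at z)"
        by (rule bounded_linear.has_derivative[OF linear_conv_bounded_linear[THEN iffD1, OF P] ds[OF z j]])
      from linear_family_product_rule[OF \<open>open Z\<close> z Alin dA[OF z] this]
      have "((\<lambda>z. A z (P (s j z))) has_derivative (\<lambda>\<zeta>. dA z (P (s j z)) \<zeta> + A z (P (ds j z \<zeta>)))) (at z)" .
      then have "(s j has_derivative (\<lambda>\<zeta>. dA z (P (s j z)) \<zeta> + A z (P (ds j z \<zeta>)))) (at z)"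
        by (rule has_derivative_transform_within_open[OF _ \<open>open Z\<close> z]) (rule APs[OF _ j])
      then show ?thesis using has_derivative_unique[OF ds[OF z j]] by metis
    qed
    have cancel: "x = y" if "x + a = p" "y + b = q" "a - b = p - q" for x y a b p q :: "real ^ 'n"
      using that(3) unfolding that(1,2)[symmetric] add_diff_add by simp
    have 2: "dA z (P (s j z)) (s i z) = dA z (P (s i z)) (s j z)" if i: "i \<in> ?J" and j: "j \<in> ?J" for i j
    proof -
      obtain c where "lie_bracket (s i) (s j) z = (\<Sum>k=1..m. c k z *\<^sub>R s k z)"
        using inv i j z ZO unfolding in_involution_def by blast
      then have "lie_bracket (s i) (s j) z \<in> span ((\<lambda>i. s i z) ` ?J)"
        by (simp only:) (intro span_sum span_scale span_base imageI)
      then have "A z (P (ds j z (s i z) - ds i z (s j z))) = ds j z (s i z) - ds i z (s j z)"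
        using APw[OF z] by (simp add: lie_bracket_def ds_def)
      then have "A z (P (ds j z (s i z))) - A z (P (ds i z (s j z))) = ds j z (s i z) - ds i z (s j z)"
        by (simp add: linear_diff[OF P] linear_diff[OF Alin])
      then show ?thesis by (rule cancel[OF 1[OF j] 1[OF i]])
    qed
    \<comment> \<open>The vectors \<open>P (s i z)\<close> are frozen at \<open>z\<close> and only
      the base point \<open>z'\<close> of \<open>A\<close> moves, so this is linearity of
      \<open>dA z\<close> in its vector argument.\<close>
    have dAsum: "dA z (\<Sum>i\<in>?J. a i *\<^sub>R P (s i z)) \<zeta> = (\<Sum>i\<in>?J. a i *\<^sub>R dA z (P (s i z)) \<zeta>)" for a \<zeta>
    proof -
      have "((\<lambda>z'. \<Sum>i\<in>?J. a i *\<^sub>R A z' (P (s i z))) has_derivative (\<lambda>\<zeta>. \<Sum>i\<in>?J. a i *\<^sub>R dA z (P (s i z)) \<zeta>)) (at z)"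
        by (intro derivative_intros dA z)
      moreover have "(\<lambda>z'. \<Sum>i\<in>?J. a i *\<^sub>R A z' (P (s i z))) = (\<lambda>z'. A z' (\<Sum>i\<in>?J. a i *\<^sub>R P (s i z)))"
        by (simp add: linear_sum[OF Alin] linear_cmul[OF Alin])
      ultimately have "((\<lambda>z'. A z' (\<Sum>i\<in>?J. a i *\<^sub>R P (s i z))) has_derivative
          (\<lambda>\<zeta>. \<Sum>i\<in>?J. a i *\<^sub>R dA z (P (s i z)) \<zeta>)) (at z)" by simp
      then show ?thesis by (rule fun_cong[OF has_derivative_unique[OF dA[OF z]]])
    qed
    \<comment> \<open>Since \<open>P u = P (A z u)\<close>, the vector \<open>P u\<close> is a
      combination of the \<open>P (s i z)\<close>. The symmetry just shown for pairs of frame fields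
      thereby extends to all \<open>u\<close> and \<open>v\<close>.\<close>
    have rep: "dA z u \<zeta> = (\<Sum>i\<in>?J. \<beta> i (R z (P u)) *\<^sub>R dA z (P (s i z)) \<zeta>)" for u \<zeta>
    proof -
      have "dA z u = dA z (P u)" unfolding dA_def by (simp add: AP)
      also have "P u = (\<Sum>i\<in>?J. \<beta> i (R z (P u)) *\<^sub>R P (s i z))"
        using PA[OF z, of u] by (simp add: A_def linear_sum[OF P] linear_cmul[OF P])
      finally show ?thesis by (simp only: dAsum)
    qed
    have dAl: "linear (dA z w)" for w using has_derivative_linear[OF dA[OF z]] .
    have e: "dA z u (A z v) = (\<Sum>i\<in>?J. \<Sum>j\<in>?J. (\<beta> i (R z (P u)) * \<beta> j (R z (P v))) *\<^sub>R dA z (P (s i z)) (s j z))" for u v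
      unfolding rep[of u] A_def linear_sum[OF dAl] linear_cmul[OF dAl] scaleR_sum_right scaleR_scaleR
      by (subst sum.swap) (intro sum.cong refl arg_cong2[where f = scaleR] mult.commute)
    show ?thesis unfolding e
      by (subst sum.swap) (intro sum.cong refl arg_cong2[where f = scaleR] mult.commute 2)
  qed
  show ?thesis
    by (rule that[OF P PP PE rP \<open>open Z\<close> \<open>z0 \<in> Z\<close> ZO Alin As A0 AP PA Aspan APw comm[unfolded dA_def]])
qed

section \<open>Flow boxes\<close>

lemma smooth_on_subset: "smooth_on S f \<Longrightarrow> T \<subseteq> S \<Longrightarrow> smooth_on T f"
  unfolding smooth_on_def using higher_differentiable_on_subset by blast

lemma smooth_on_compose:
  fixes f :: "'a::real_normed_vector \<Rightarrow> 'b::euclidean_space"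
  assumes "open S" "open Z" "smooth_on Z F" "smooth_on S f" "f ` S \<subseteq> Z"
  shows "smooth_on S (\<lambda>x. F (f x))"
  unfolding smooth_on_fam_Ck_iff
proof
  fix k show "fam_Ck k {0::real} S (\<lambda>_ x. F (f x))"
    by (rule fam_Ck_compose[where F = "\<lambda>_. F" and f = "\<lambda>_. f", OF assms(1,2) smooth_on_fam_Ck[OF assms(3)] smooth_on_fam_Ck[OF assms(4)]])
      (use assms(5) in auto)
qed

lemma smooth_on_affine:
  fixes L :: "'a::euclidean_space \<Rightarrow> 'b::real_normed_vector"
  assumes "open S" "linear L" shows "smooth_on S (\<lambda>x. L x + c)"
  unfolding smooth_on_fam_Ck_iff
  by (intro allI fam_Ck_add assms(1) fam_Ck_linear assms(2) fam_Ck_const continuous_on_const)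

lemma smooth_on_derivative: "smooth_on S f \<Longrightarrow> smooth_on S (\<lambda>x. frechet_derivative f (at x) v)"
  unfolding smooth_on_def by (metis higher_differentiable_on.simps(2))

text \<open>The inverse function theorem gives a differentiable inverse \<open>h\<close>, whose
  derivative at \<open>y\<close> inverts that of \<open>\<Psi>\<close> at \<open>h y\<close>. If
  \<open>h\<close> has order \<open>k\<close>, so has this inverse by Cramer's rule, and
  \<open>h\<close> gains one order; iteration yields smoothness.\<close>

lemma smooth_inverse_function:
  fixes \<Psi> :: "real ^ 'n \<Rightarrow> real ^ 'n"
  assumes N: "open N" "x0 \<in> N" and \<Psi>: "smooth_on N \<Psi>" and id: "\<And>w. frechet_derivative \<Psi> (at x0) w = w"
  obtains N' M h where "x0 \<in> N'" "N' \<subseteq> N" "diffeomorphism_between N' M \<Psi> h"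
proof -
  note d = smooth_on_has_derivative[OF \<Psi>]
  define f' where "f' x = Blinfun (frechet_derivative \<Psi> (at x))" for x
  have f': "blinfun_apply (f' x) = frechet_derivative \<Psi> (at x)" if "x \<in> N" for x
    unfolding f'_def using d[OF that] by (intro bounded_linear_Blinfun_apply has_derivative_bounded_linear)
  have d': "(\<Psi> has_derivative blinfun_apply (f' x)) (at x)" if "x \<in> N" for x
    using d[OF that] f'[OF that] by simp
  have "continuous_on N (\<lambda>x. f' x v)" for v
    using continuous_on_eq[OF smooth_on_imp_continuous_on[OF smooth_on_derivative[OF \<Psi>]]] f' by simp
  then have cf': "continuous_on N f'" by (intro continuous_on_blinfun_componentwise)
  have "id_blinfun o\<^sub>L f' x0 = id_blinfun"
    by (rule blinfun_eqI) (simp add: f' N id)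
  then obtain U' M h h' where U': "open U'" "U' \<subseteq> N" "x0 \<in> U'" and M: "open M" "\<Psi> x0 \<in> M"
    and hom: "homeomorphism U' M \<Psi> h"
    and h: "\<And>y. y \<in> M \<Longrightarrow> (h has_derivative (h' y)) (at y)"
    and h': "\<And>y. y \<in> M \<Longrightarrow> h' y = inv (blinfun_apply (f' (h y)))"
    and bij: "\<And>y. y \<in> M \<Longrightarrow> bij (blinfun_apply (f' (h y)))"
    using inverse_function_theorem[OF N(1) d' cf' N(2)] by metis
  have hM: "h y \<in> U'" if "y \<in> M" for y using hom that by (auto simp: homeomorphism_def)
  have hk: "fam_Ck k {0::real} M (\<lambda>_. h)" for k
  proof (induction k)
    case 0
    have "continuous_on M h" using hom by (simp add: homeomorphism_def)
    then show ?case by (intro fam_Ck_const_time) simp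
  next
    case (Suc k)
    show ?case
    proof (rule fam_Ck_SucI[OF M(1) fam_Ck_continuous[OF Suc] h])
      show "fam_Ck k {0::real} M (\<lambda>_ y. h' y v)" for v
      proof (rule fam_Ck_linear_inverse[where T = "\<lambda>_ y. frechet_derivative \<Psi> (at (h y))", OF M(1)])
        show "fam_Ck k {0::real} M (\<lambda>_ y. frechet_derivative \<Psi> (at (h y)) w)" for w
          by (rule fam_Ck_compose[where F = "\<lambda>_ x. frechet_derivative \<Psi> (at x) w" and f = "\<lambda>_. h",
                OF M(1) N(1) smooth_on_fam_Ck[OF smooth_on_derivative[OF \<Psi>]] Suc])
            (use hM U' in auto)
        show "linear (frechet_derivative \<Psi> (at (h y)))" if "y \<in> M" for y
          by (rule has_derivative_linear[OF d]) (use hM[OF that] U' in auto)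
        show "frechet_derivative \<Psi> (at (h y)) (h' y w) = w" if "y \<in> M" for y w
        proof -
          have "h y \<in> N" using hM[OF that] U' by auto
          then show ?thesis
            using bij[OF that] by (simp add: h'[OF that] f'[symmetric] bij_is_surj surj_f_inv_f)
        qed
      qed
    qed
  qed
  show ?thesis
  proof (rule that[OF U'(3,2)])
    show "diffeomorphism_between U' M \<Psi> h"
      using hom U' M smooth_on_subset[OF \<Psi> U'(2)] hk
      by (auto simp: diffeomorphism_between_def homeomorphism_def smooth_on_fam_Ck_iff)
  qed
qed

text \<open>
  By commutativity \<open>t \<mapsto> t A(\<phi> t) w\<close> solves the same linear equation as the derivative of \<open>\<phi> t\<close> in a
  direction \<open>w = P w\<close>, so that these derivatives stay in the distribution spanned by the frame.
\<close>

lemma flow_box: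
  fixes A :: "'a::euclidean_space \<Rightarrow> 'a \<Rightarrow> 'a"
  assumes P: "linear P"
    and Z: "open Z" "z0 \<in> Z" and lin: "\<And>z. z \<in> Z \<Longrightarrow> linear (A z)" and A: "\<And>w. smooth_on Z (\<lambda>z. A z w)"
    and A0: "A z0 = P" and AP: "\<And>z w. z \<in> Z \<Longrightarrow> A z (P w) = A z w"
    and comm: "\<And>z u v. z \<in> Z \<Longrightarrow>
      frechet_derivative (\<lambda>z. A z u) (at z) (A z v) = frechet_derivative (\<lambda>z. A z v) (at z) (A z u)"
    and V: "open V" "0 \<in> V" and g: "smooth_on V g" "g 0 = z0" "\<And>w. frechet_derivative g (at 0) w = w"
  obtains r \<Psi> where "r > 0" "\<And>p. p \<in> ball 0 r \<Longrightarrow> p - P p \<in> V" "smooth_on (ball 0 r) \<Psi>"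
    "\<And>p. p \<in> ball 0 r \<Longrightarrow> \<Psi> p \<in> Z"
    "\<And>p w. p \<in> ball 0 r \<Longrightarrow> P w = w \<Longrightarrow> frechet_derivative \<Psi> (at p) w = A (\<Psi> p) w"
    "\<And>p. p \<in> ball 0 r \<Longrightarrow> P p = 0 \<Longrightarrow> \<Psi> p = g p"
    "\<And>w. frechet_derivative \<Psi> (at 0) w = w"
proof -
  define V' where "V' = (\<lambda>p. p - P p) -` V"
  have IP: "linear (\<lambda>p. p - P p)" by (intro linear_compose_sub linear_ident P)
  note P0 = linear_0[OF P]
  have V': "open V'" "0 \<in> V'"
    unfolding V'_def using V continuous_on_open_vimage[of UNIV "\<lambda>p. p - P p"] linear_continuous_on[OF linear_conv_bounded_linear[THEN iffD1, OF IP]]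
    by (auto simp: P0)
  \<comment> \<open>The starting point depends only on \<open>p - P p\<close> and the velocity only
    on \<open>P p\<close>, since \<open>A z p = A z (P p)\<close>. Directions \<open>w\<close> with
    \<open>P w = w\<close> therefore leave the initial datum unchanged.\<close>
  define b where "b p = g (p - P p)" for p
  have b: "smooth_on V' b" "b 0 = z0"
    unfolding b_def using smooth_on_compose[OF V'(1) V(1) g(1), of "\<lambda>p. p - P p + 0"] smooth_on_affine[OF V'(1) IP, of 0]
    by (auto simp: V'_def P0 g)
  have db: "frechet_derivative b (at p) w = frechet_derivative g (at (p - P p)) (w - P w)" if "p \<in> V'" for p w
  proof -
    have "(b has_derivative (\<lambda>w. frechet_derivative g (at (p - P p)) (w - P w))) (at p)"
      unfolding b_def
      by (rule has_derivative_compose[OF linear_imp_has_derivative[OF IP] smooth_on_has_derivative[OF g(1)]])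
        (use that in \<open>auto simp: V'_def\<close>)
    then show ?thesis by (simp flip: frechet_derivative_at)
  qed
  obtain r and \<phi> :: "real \<Rightarrow> 'a \<Rightarrow> 'a" where r: "r > 0" "ball 0 r \<subseteq> V'"
    and \<phi>: "\<And>k. fam_Ck k {0..1} (ball 0 r) \<phi>"
    "\<And>t p. t \<in> {0..1} \<Longrightarrow> p \<in> ball 0 r \<Longrightarrow> \<phi> t p \<in> Z"
    "\<And>t p. t \<in> {0..1} \<Longrightarrow> p \<in> ball 0 r \<Longrightarrow> \<phi> t p = b p + integral {0..t} (\<lambda>s. A (\<phi> s p) p)"
    and half: "\<And>t p \<zeta>. t \<in> {0..1} \<Longrightarrow> p \<in> ball 0 r \<Longrightarrow>
       norm (frechet_derivative (\<lambda>z. A z p) (at (\<phi> t p)) \<zeta>) \<le> norm \<zeta> / 2"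
    and d\<phi>: "\<And>w t p. t \<in> {0..1} \<Longrightarrow> p \<in> ball 0 r \<Longrightarrow> frechet_derivative (\<phi> t) (at p) w = frechet_derivative b (at p) w
       + integral {0..t} (\<lambda>s. A (\<phi> s p) w
           + frechet_derivative (\<lambda>z. A z p) (at (\<phi> s p)) (frechet_derivative (\<phi> s) (at p) w))"
    by (rule parametric_flow[OF Z A lin V' b]) (assumption | rule that)+
  have c\<phi>: "continuous_on {0..1} (\<lambda>s. \<phi> s p)" if "p \<in> ball 0 r" for p
    using continuous_on_slice[OF fam_Ck_continuous[OF \<phi>(1)] that] .
  have c\<phi>Z: "continuous_on {0..1} (\<lambda>s. F (\<phi> s p))" if "p \<in> ball 0 r" "continuous_on Z F" for p and F :: "'a \<Rightarrow> 'a"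
    by (rule continuous_on_compose2[OF that(2) c\<phi>[OF that(1)]]) (use \<phi>(2) that in auto)
  \<comment> \<open>For \<open>P p = 0\<close> the velocity vanishes, so the curve rests at its
    starting point.\<close>
  have static: "\<phi> t p = g p" if t: "t \<in> {0..1}" and p: "p \<in> ball 0 r" "P p = 0" for t p
  proof -
    have "integral {0..t} (\<lambda>s. A (\<phi> s p) p) = integral {0..t} (\<lambda>s. 0)"
    proof (rule integral_cong)
      fix s assume "s \<in> {0..t}"
      then have "\<phi> s p \<in> Z" using \<phi>(2) t p by auto
      then show "A (\<phi> s p) p = 0" using AP[of "\<phi> s p" p] linear_0[OF lin] p(2) by simp
    qed
    then show ?thesis using \<phi>(3)[OF t p(1)] p(2) by (simp add: b_def)
  qed
  have deriv: "frechet_derivative (\<phi> 1) (at p) w = A (\<phi> 1 p) w" if p: "p \<in> ball 0 r" and w: "P w = w" for p w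
  proof -
    define \<zeta> where "\<zeta> s = frechet_derivative (\<phi> s) (at p) w" for s
    define \<eta> where "\<eta> s = s *\<^sub>R A (\<phi> s p) w" for s
    define D where "D s v = frechet_derivative (\<lambda>z. A z p) (at (\<phi> s p)) v" for s v
    have \<phi>Z: "\<phi> s p \<in> Z" if "s \<in> {0..1}" for s using \<phi>(2)[OF that p] .
    have dA: "((\<lambda>z. A z v) has_derivative frechet_derivative (\<lambda>z. A z v) (at z)) (at z)" if "z \<in> Z" for z v
      using smooth_on_has_derivative[OF A that] .
    have Dlin: "linear (D s)" if "s \<in> {0..1}" for s
      unfolding D_def using has_derivative_linear[OF dA[OF \<phi>Z[OF that]]] .
    have cD: "continuous_on {0..1} (\<lambda>s. D s v)" for v
      unfolding D_def by (rule c\<phi>Z[OF p smooth_on_imp_continuous_on[OF smooth_on_derivative[OF A]]])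
    have c\<zeta>: "continuous_on {0..1} \<zeta>"
      unfolding \<zeta>_def using continuous_on_slice[OF fam_Ck_continuous[OF fam_Ck_derivative[OF \<phi>(1)]] p] .
    have cA: "continuous_on {0..1} (\<lambda>s. A (\<phi> s p) v)" for v
      by (rule c\<phi>Z[OF p smooth_on_imp_continuous_on[OF A]])
    have c\<eta>: "continuous_on {0..1} \<eta>" unfolding \<eta>_def by (intro continuous_intros cA)
    have cDf: "continuous_on {0..1} (\<lambda>s. D s (f s))" if "continuous_on {0..1} f" for f
    proof -
      have "continuous_on {0..1} (\<lambda>s. \<Sum>c\<in>Basis. (f s \<bullet> c) *\<^sub>R D s c)"
        by (intro continuous_intros that cD)
      then show ?thesis by (rule continuous_on_eq) (rule linear_Basis_sum[OF Dlin, symmetric])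
    qed
    have int: "f integrable_on {0..t}" if "continuous_on {0..1} f" "t \<in> {0..1}" for t and f :: "real \<Rightarrow> 'a"
      by (rule integrable_continuous_real, rule continuous_on_subset[OF that(1)]) (use that in auto)
    have p': "p \<in> V'" "p - P p \<in> V" using p r by (auto simp: V'_def)
    have "frechet_derivative b (at p) w = 0"
      using linear_0[OF has_derivative_linear[OF smooth_on_has_derivative[OF g(1) p'(2)]]] by (simp add: db[OF p'(1)] w)
    then have \<zeta>eq: "\<zeta> t = integral {0..t} (\<lambda>s. A (\<phi> s p) w + D s (\<zeta> s))" if "t \<in> {0..1}" for t
      using d\<phi>[OF that p, of w] by (simp add: \<zeta>_def D_def)
    have \<phi>d: "((\<lambda>s. \<phi> s p) has_vector_derivative A (\<phi> s p) p) (at s within {0..1})" if s: "s \<in> {0..1}" for s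
    proof -
      have "((\<lambda>t. b p + integral {0..t} (\<lambda>s. A (\<phi> s p) p)) has_vector_derivative (0 + A (\<phi> s p) p)) (at s within {0..1})"
        by (intro has_vector_derivative_add has_vector_derivative_const integral_has_vector_derivative cA s)
      then show ?thesis
        using has_vector_derivative_transform[OF s, of "\<lambda>s. \<phi> s p"] \<phi>(3)[OF _ p] by simp
    qed
    have \<eta>d: "(\<eta> has_vector_derivative (A (\<phi> s p) w + D s (\<eta> s))) (at s within {0..1})" if s: "s \<in> {0..1}" for s
    proof -
      let ?D = "frechet_derivative (\<lambda>z. A z w) (at (\<phi> s p))"
      have "((\<lambda>z. A z w) \<circ> (\<lambda>s. \<phi> s p) has_vector_derivative ?D (A (\<phi> s p) p)) (at s within {0..1})"
        by (rule vector_derivative_diff_chain_within[OF \<phi>d[OF s] has_derivative_at_withinI[OF dA[OF \<phi>Z[OF s]]]])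
      also have "?D (A (\<phi> s p) p) = D s (A (\<phi> s p) w)"
        unfolding D_def by (rule comm[OF \<phi>Z[OF s]])
      finally have "((\<lambda>s. A (\<phi> s p) w) has_vector_derivative D s (A (\<phi> s p) w)) (at s within {0..1})"
        by (simp add: o_def)
      then have "((\<lambda>s. s *\<^sub>R A (\<phi> s p) w) has_vector_derivative (s *\<^sub>R D s (A (\<phi> s p) w) + 1 *\<^sub>R A (\<phi> s p) w)) (at s within {0..1})"
        by (intro has_vector_derivative_scaleR) (auto intro!: derivative_eq_intros)
      then show ?thesis by (simp add: \<eta>_def[abs_def] linear_cmul[OF Dlin[OF s]] add.commute)
    qed
    have \<eta>eq: "\<eta> t = integral {0..t} (\<lambda>s. A (\<phi> s p) w + D s (\<eta> s))" if t: "t \<in> {0..1}" for t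
    proof -
      have "((\<lambda>s. A (\<phi> s p) w + D s (\<eta> s)) has_integral \<eta> t - \<eta> 0) {0..t}"
        by (rule fundamental_theorem_of_calculus) (use t in \<open>auto intro!: has_vector_derivative_within_subset[OF \<eta>d]\<close>)
      then show ?thesis by (simp add: \<eta>_def integral_unique)
    qed
    define \<delta> where "\<delta> s = \<zeta> s - \<eta> s" for s
    have c\<delta>: "continuous_on {0..1} \<delta>" unfolding \<delta>_def by (intro continuous_intros c\<zeta> c\<eta>)
    \<comment> \<open>\<open>\<zeta>\<close> and \<open>\<eta>\<close> solve the same linear
      equation, so their difference is at most half of its own maximum and hence zero.\<close>
    obtain t where t: "t \<in> {0..1}" "\<And>s. s \<in> {0..1} \<Longrightarrow> norm (\<delta> s) \<le> norm (\<delta> t)"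
      using continuous_attains_sup[OF compact_Icc _ continuous_on_norm[OF c\<delta>]] by auto
    have "\<delta> t = integral {0..t} (\<lambda>s. (A (\<phi> s p) w + D s (\<zeta> s)) - (A (\<phi> s p) w + D s (\<eta> s)))"
      unfolding \<delta>_def \<zeta>eq[OF t(1)] \<eta>eq[OF t(1)]
      by (intro integral_diff[symmetric] int t(1) continuous_on_add cA cDf c\<zeta> c\<eta>)
    also have "norm \<dots> \<le> norm (\<delta> t) / 2"
    proof (rule norm_integral_time_le[OF _ t(1)])
      show "continuous_on {0..1} (\<lambda>s. (A (\<phi> s p) w + D s (\<zeta> s)) - (A (\<phi> s p) w + D s (\<eta> s)))"
        by (intro continuous_on_diff continuous_on_add cA cDf c\<zeta> c\<eta>)
      fix s :: real assume s: "s \<in> {0..1}"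
      have "(A (\<phi> s p) w + D s (\<zeta> s)) - (A (\<phi> s p) w + D s (\<eta> s)) = D s (\<delta> s)"
        by (simp add: \<delta>_def linear_diff[OF Dlin[OF s]])
      also have "norm \<dots> \<le> norm (\<delta> s) / 2" unfolding D_def by (rule half[OF s p])
      also have "\<dots> \<le> norm (\<delta> t) / 2" using t(2)[OF s] by simp
      finally show "norm ((A (\<phi> s p) w + D s (\<zeta> s)) - (A (\<phi> s p) w + D s (\<eta> s))) \<le> norm (\<delta> t) / 2" .
    qed
    finally have "norm (\<delta> t) = 0" by simp
    then have "\<delta> 1 = 0" using t(2)[of 1] by simp
    then show ?thesis by (simp add: \<delta>_def \<zeta>_def \<eta>_def)
  qed
  \<comment> \<open>At \<open>p = 0\<close> the curve rests at \<open>z0\<close>, where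
    \<open>A z0 = P\<close>. The initial datum contributes \<open>w - P w\<close> and the integral
    contributes \<open>P w\<close>.\<close>
  have at0: "frechet_derivative (\<phi> 1) (at 0) w = w" for w
  proof -
    have 0: "0 \<in> ball 0 r" "0 \<in> V'" using r V' by auto
    have \<phi>0: "\<phi> s 0 = z0" if "s \<in> {0..1}" for s using static[OF that 0(1)] P0 g(2) by simp
    have "((\<lambda>z. A z 0) has_derivative (\<lambda>_. 0)) (at z0)"
      by (rule has_derivative_transform_within_open[OF has_derivative_const[of 0] Z]) (simp add: linear_0[OF lin])
    then have dA0: "frechet_derivative (\<lambda>z. A z 0) (at z0) v = 0" for v
      by (simp flip: frechet_derivative_at)
    have "integral {0..1} (\<lambda>s. A (\<phi> s 0) w
           + frechet_derivative (\<lambda>z. A z 0) (at (\<phi> s 0)) (frechet_derivative (\<phi> s) (at 0) w)) = integral {0..1} (\<lambda>s::real. P w)"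
      by (rule integral_cong) (simp add: \<phi>0 dA0 A0)
    then show ?thesis
      using d\<phi>[of 1 0 w] 0 db[OF 0(2), of w] by (simp add: P0 g(3))
  qed
  show ?thesis
  proof (rule that[of r "\<phi> 1"])
    show "smooth_on (ball 0 r) (\<phi> 1)"
      unfolding smooth_on_def using fam_Ck_imp_higher_differentiable_on[OF \<phi>(1), of 1] by simp
  qed (use r \<phi>(2) deriv static at0 in \<open>auto simp: V'_def\<close>)
qed

section \<open>Submanifolds and integral extensions\<close>

lemma diffeomorphism_betweenI:
  assumes "open U" "open V" "\<And>x. x \<in> U \<Longrightarrow> f x \<in> V \<and> g (f x) = x" "\<And>y. y \<in> V \<Longrightarrow> g y \<in> U \<and> f (g y) = y"
    "smooth_on U f" "smooth_on V g"
  shows "diffeomorphism_between U V f g"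
proof -
  have "V \<subseteq> f ` U" "U \<subseteq> g ` V" using assms(3,4) by (metis image_eqI subsetI)+
  then show ?thesis using assms by (auto simp: diffeomorphism_between_def)
qed

lemma diffeomorphism_betweenD:
  assumes "diffeomorphism_between U V f g"
  shows "open U" "open V" "smooth_on U f" "smooth_on V g"
    "\<And>x. x \<in> U \<Longrightarrow> f x \<in> V" "\<And>x. x \<in> U \<Longrightarrow> g (f x) = x"
    "\<And>y. y \<in> V \<Longrightarrow> g y \<in> U" "\<And>y. y \<in> V \<Longrightarrow> f (g y) = y"
  using assms by (auto simp: diffeomorphism_between_def)

lemma diffeomorphism_between_restrict:
  assumes d: "diffeomorphism_between U V f g" and N: "open N" "N \<subseteq> U"
  shows "diffeomorphism_between N (f ` N) f g"
proof -
  note D = diffeomorphism_betweenD[OF d]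
  have "f ` N = V \<inter> g -` N"
    using D N(2) by (auto simp: subset_iff image_iff) metis
  moreover have "open (V \<inter> g -` N)"
    by (rule continuous_open_preimage[OF smooth_on_imp_continuous_on[OF D(4)] D(2) N(1)])
  moreover have "f ` N \<subseteq> V" using D(5) N(2) by auto
  ultimately show ?thesis
    using N D by (intro diffeomorphism_betweenI smooth_on_subset[OF D(3)] smooth_on_subset[OF D(4)]) (auto simp: subset_iff)
qed

lemma diffeomorphism_between_sym:
  "diffeomorphism_between U V f g \<Longrightarrow> diffeomorphism_between V U g f"
  by (simp add: diffeomorphism_between_def)

lemma diffeomorphism_between_derivatives:
  assumes d: "diffeomorphism_between U V f g" and x: "x \<in> U"
  shows "frechet_derivative g (at (f x)) (frechet_derivative f (at x) w) = w"
proof -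
  note D = diffeomorphism_betweenD[OF d]
  have "((\<lambda>x. g (f x)) has_derivative (\<lambda>w. frechet_derivative g (at (f x)) (frechet_derivative f (at x) w))) (at x)"
    by (rule has_derivative_compose[OF smooth_on_has_derivative[OF D(3) x] smooth_on_has_derivative[OF D(4) D(5)[OF x]]])
  then have "((\<lambda>x. x) has_derivative (\<lambda>w. frechet_derivative g (at (f x)) (frechet_derivative f (at x) w))) (at x)"
    by (rule has_derivative_transform_within_open[OF _ D(1) x]) (simp add: D)
  then show ?thesis using has_derivative_unique[OF has_derivative_ident] by metis
qed

text \<open>Any slice chart \<open>f0\<close> is normalised by subtracting \<open>y0 = f0 z\<close>
  and applying \<open>L\<close>, the derivative of its inverse at \<open>y0\<close>. The new inverse
  has derivative \<open>L \<circ> K\<close>, the identity, so the linear slice \<open>E\<close>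
  itself consists of velocities at \<open>z\<close>.\<close>

lemma submanifold_chart:
  assumes M: "embedded_submanifold d M" and z: "z \<in> M"
  obtains U V f g E where "z \<in> U" "diffeomorphism_between U V f g" "f z = 0" "subspace E" "dim E = d"
    "f ` (M \<inter> U) = E \<inter> V" "\<And>w. frechet_derivative g (at 0) w = w"
proof -
  obtain U V0 f0 g0 and E0 :: "'a set" where zU: "z \<in> U" and d: "diffeomorphism_between U V0 f0 g0"
    and E0: "subspace E0" "dim E0 = d" and slice: "f0 ` (M \<inter> U) = E0 \<inter> V0"
    using M z unfolding embedded_submanifold_def by blast
  note D = diffeomorphism_betweenD[OF d]
  define y0 where "y0 = f0 z"
  have y0: "y0 \<in> E0" "y0 \<in> V0" "g0 y0 = z" using slice z zU D by (auto simp: y0_def)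
  define L where "L = frechet_derivative g0 (at y0)"
  define K where "K = frechet_derivative f0 (at z)"
  have LK: "L (K w) = w" for w
    unfolding L_def K_def y0_def by (rule diffeomorphism_between_derivatives[OF d zU])
  have KL: "K (L w) = w" for w
    using diffeomorphism_between_derivatives[OF diffeomorphism_between_sym[OF d] y0(2)] by (simp add: L_def K_def y0)
  have L: "linear L" unfolding L_def using has_derivative_linear[OF smooth_on_has_derivative[OF D(4) y0(2)]] .
  have K: "linear K" unfolding K_def using has_derivative_linear[OF smooth_on_has_derivative[OF D(3) zU]] .
  define f where "f x = L (f0 x) + - L y0" for x
  define g where "g y = g0 (K y + y0)" for y
  define V where "V = (\<lambda>y. K y + y0) -` V0"
  have f: "f x = L (f0 x - y0)" for x by (simp add: f_def linear_diff[OF L])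
  have cK: "continuous_on UNIV (\<lambda>y. K y + y0)"
    by (intro continuous_intros linear_continuous_on linear_conv_bounded_linear[THEN iffD1, OF K])
  have V: "open V" unfolding V_def using D(2) cK by (simp add: continuous_on_open_vimage)
  have Kf: "K (f x) + y0 = f0 x" for x by (simp add: f KL)
  have diff: "diffeomorphism_between U V f g"
  proof (rule diffeomorphism_betweenI[OF D(1) V])
    show "f x \<in> V \<and> g (f x) = x" if "x \<in> U" for x using that D by (simp add: V_def g_def Kf)
    show "g y \<in> U \<and> f (g y) = y" if "y \<in> V" for y using that D by (simp add: V_def g_def f LK)
    show "smooth_on U f"
      unfolding f_def by (rule smooth_on_compose[OF D(1) open_UNIV smooth_on_affine[OF open_UNIV L] D(3)]) auto
    show "smooth_on V g"
      unfolding g_def by (rule smooth_on_compose[OF V D(2) D(4) smooth_on_affine[OF V K]]) (auto simp: V_def)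
  qed
  show ?thesis
  proof (rule that[of U V f g "L ` E0", OF zU diff])
    show "f z = 0" by (simp add: f y0_def linear_0[OF L])
    show "subspace (L ` E0)" by (rule linear_subspace_image[OF L E0(1)])
    have "inj L" using KL by (metis injI)
    then show "dim (L ` E0) = d" using dim_image_eq[OF L] E0(2) by (metis inj_on_subset subset_UNIV)
    show "f ` (M \<inter> U) = L ` E0 \<inter> V"
    proof (intro equalityI subsetI)
      fix y assume "y \<in> f ` (M \<inter> U)"
      then obtain x where x: "x \<in> M" "x \<in> U" "y = f x" by auto
      then have "f0 x \<in> E0" using slice by auto
      then have "f0 x - y0 \<in> E0" using y0(1) E0(1) by (simp add: subspace_diff)
      then show "y \<in> L ` E0 \<inter> V" using x diffeomorphism_betweenD(5)[OF diff] by (auto simp: f)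
    next
      fix y assume y: "y \<in> L ` E0 \<inter> V"
      then obtain e where e: "e \<in> E0" "y = L e" by auto
      then have "e + y0 \<in> E0 \<inter> V0" using y y0(1) E0(1) by (auto simp: V_def KL subspace_add)
      then obtain x where "x \<in> M \<inter> U" "e + y0 = f0 x" unfolding slice[symmetric] by auto
      moreover from this have "f x = y" by (simp add: f e flip: \<open>e + y0 = f0 x\<close>)
      ultimately show "y \<in> f ` (M \<inter> U)" by blast
    qed
    show "frechet_derivative g (at 0) w = w" for w
    proof -
      have 1: "((\<lambda>y. K y + y0) has_derivative K) (at 0)"
        using has_derivative_add[OF linear_imp_has_derivative[OF K] has_derivative_const[of y0]] by simp
      have 2: "(g0 has_derivative L) (at (K 0 + y0))"
        using smooth_on_has_derivative[OF D(4) y0(2)] by (simp add: L_def linear_0[OF K])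
      have "(g has_derivative (\<lambda>w. L (K w))) (at 0)"
        unfolding g_def by (rule has_derivative_compose[OF 1 2])
      then show ?thesis by (simp add: LK flip: frechet_derivative_at)
    qed
  qed
qed

section \<open>Tangent vectors, and curves of tangent fields staying in a submanifold\<close>

lemma derivative_in_tangent_space:
  fixes \<Psi> :: "'a::euclidean_space \<Rightarrow> 'a"
  assumes N: "open N" "p \<in> N" and \<Psi>: "smooth_on N \<Psi>"
    and M: "\<And>t. p + t *\<^sub>R h \<in> N \<Longrightarrow> \<Psi> (p + t *\<^sub>R h) \<in> M"
  shows "frechet_derivative \<Psi> (at p) h \<in> tangent_space M (\<Psi> p)"
proof -
  obtain e where e: "e > 0" "ball p e \<subseteq> N" using N openE by blast
  define \<epsilon> where "\<epsilon> = e / (norm h + 1)"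
  have h1: "norm h + 1 > 0" by (simp add: add_nonneg_pos)
  then have \<epsilon>: "\<epsilon> > 0" using e by (simp add: \<epsilon>_def)
  have mem: "t *\<^sub>R h + p \<in> N" if "t \<in> {-\<epsilon><..<\<epsilon>}" for t
  proof -
    have "\<bar>t\<bar> * norm h \<le> \<epsilon> * norm h" using that by (intro mult_right_mono) auto
    also have "\<dots> < \<epsilon> * (norm h + 1)" using \<epsilon> by simp
    also have "\<dots> = e" using h1 by (simp add: \<epsilon>_def)
    finally have "t *\<^sub>R h + p \<in> ball p e" by (simp add: dist_norm)
    then show ?thesis using e(2) by blast
  qed
  \<comment> \<open>The witness is the image of a straight line through \<open>p\<close>;
    \<open>\<epsilon>\<close> keeps the line in \<open>N\<close>, with \<open>norm h + 1\<close>
    covering the case \<open>h = 0\<close>.\<close>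
  define c where "c t = \<Psi> (t *\<^sub>R h + p)" for t
  have "smooth_on {-\<epsilon><..<\<epsilon>} c"
    unfolding c_def
    by (rule smooth_on_compose[OF _ N(1) \<Psi> smooth_on_affine])
      (use mem in \<open>auto simp: linear_iff algebra_simps\<close>)
  moreover have "c ` {-\<epsilon><..<\<epsilon>} \<subseteq> M"
    using M mem by (auto simp: c_def add.commute)
  moreover have "(c has_vector_derivative frechet_derivative \<Psi> (at p) h) (at 0)"
  proof -
    have "((\<lambda>t. t *\<^sub>R h + p) has_derivative (\<lambda>t. t *\<^sub>R h)) (at 0)"
      by (auto intro!: derivative_eq_intros)
    then have "(c has_derivative (\<lambda>t. frechet_derivative \<Psi> (at p) (t *\<^sub>R h))) (at 0)"
      unfolding c_def
      by (rule has_derivative_compose) (use smooth_on_has_derivative[OF \<Psi> N(2)] in simp)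
    then show ?thesis
      by (simp add: has_vector_derivative_def linear_cmul[OF has_derivative_linear[OF smooth_on_has_derivative[OF \<Psi> N(2)]]])
  qed
  ultimately show ?thesis using \<epsilon> unfolding tangent_space_def by (auto simp: c_def intro!: exI[of _ c] exI[of _ \<epsilon>])
qed

text \<open>\<open>Q \<circ> f\<close> vanishes along every curve in \<open>M\<close> near time 0,
  so its derivative along the velocity vanishes by the chain rule. This extracts linear equations
  from tangency.\<close>

lemma tangent_vector_in_slice:
  fixes f :: "'a::euclidean_space \<Rightarrow> 'b::euclidean_space" and Q :: "'b \<Rightarrow> 'c::real_normed_vector"
  assumes d: "diffeomorphism_between U V f g" and x: "x \<in> U" and v: "v \<in> tangent_space M x"
    and Q: "linear Q" "\<And>y. y \<in> M \<inter> U \<Longrightarrow> Q (f y) = 0"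
  shows "Q (frechet_derivative f (at x) v) = 0"
proof -
  note D = diffeomorphism_betweenD[OF d]
  obtain c e where c: "e > 0" "smooth_on {-e<..<e} c" "c ` {-e<..<e} \<subseteq> M" "c 0 = x" "(c has_vector_derivative v) (at (0::real))"
    using v unfolding tangent_space_def by blast
  define T where "T = {-e<..<e} \<inter> c -` U"
  have T: "open T" "0 \<in> T"
    unfolding T_def using c x D(1)
    by (auto intro!: continuous_open_preimage smooth_on_imp_continuous_on[OF c(2)])
  have "(c has_derivative (\<lambda>t. t *\<^sub>R v)) (at 0)" using c(5) by (simp add: has_vector_derivative_def)
  then have "((\<lambda>t. f (c t)) has_derivative (\<lambda>t. frechet_derivative f (at x) (t *\<^sub>R v))) (at 0)"
    by (rule has_derivative_compose) (use smooth_on_has_derivative[OF D(3) x] c(4) in simp)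
  then have "((\<lambda>t. Q (f (c t))) has_derivative (\<lambda>t. Q (frechet_derivative f (at x) (t *\<^sub>R v)))) (at 0)"
    by (rule bounded_linear.has_derivative[OF linear_conv_bounded_linear[THEN iffD1, OF Q(1)]])
  moreover have "((\<lambda>t. Q (f (c t))) has_derivative (\<lambda>t. 0)) (at 0)"
    by (rule has_derivative_transform_within_open[OF has_derivative_const[of 0] T]) (use c(3) Q(2) in \<open>force simp: T_def\<close>)
  ultimately have "(\<lambda>t. Q (frechet_derivative f (at x) (t *\<^sub>R v))) = (\<lambda>t. 0)"
    by (rule has_derivative_unique)
  then have "Q (frechet_derivative f (at x) (1 *\<^sub>R v)) = 0" by metis
  then show ?thesis by simp
qed

text \<open>The part of the field transverse to the slice vanishes on the slice, so Lipschitz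
  continuity bounds it by the distance from the slice. A curve starting at distance zero with small
  \<open>v\<close> then keeps distance zero. Tangency is asked only up to \<open>span\<close>: a
  linear map that kills all velocities kills their span, which spares showing that
  \<open>tangent_space\<close> is a subspace.\<close>

lemma integral_curve_stays:
  fixes A :: "'a::euclidean_space \<Rightarrow> 'a \<Rightarrow> 'a"
  assumes M: "embedded_submanifold d M" "z0 \<in> M"
    and Z: "open Z" "z0 \<in> Z" and lin: "\<And>z. z \<in> Z \<Longrightarrow> linear (A z)" and A: "\<And>w. smooth_on Z (\<lambda>z. A z w)"
    and tan: "\<And>x w. x \<in> M \<Longrightarrow> x \<in> Z \<Longrightarrow> A x w \<in> span (tangent_space M x)"
  obtains W \<delta> where "open W" "z0 \<in> W" "\<delta> > 0"
    "\<forall>c v. norm v \<le> \<delta> \<longrightarrow> c 0 \<in> M \<longrightarrow> c ` {0..1} \<subseteq> W \<longrightarrow>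
       (\<forall>t\<in>{0..1}. (c has_vector_derivative A (c t) v) (at t within {0..1})) \<longrightarrow> c (1::real) \<in> M"
proof -
  obtain U V f g and E :: "'a set" where zU: "z0 \<in> U" and d: "diffeomorphism_between U V f g"
    and E: "subspace E" and "dim E = d" and slice: "f ` (M \<inter> U) = E \<inter> V"
    using M(1)[unfolded embedded_submanifold_def, rule_format, OF M(2)] by blast
  note D = diffeomorphism_betweenD[OF d]
  obtain R where R: "range R \<subseteq> E" "linear R" "\<And>e. e \<in> E \<Longrightarrow> R e = e"
    using linear_exists_left_inverse_on[OF linear_ident E] by auto
  \<comment> \<open>\<open>Q \<circ> f\<close> measures the distance from the slice; its derivative along the curve vanishes on \<open>M\<close>,
    hence is bounded by a small multiple of \<open>Q \<circ> f\<close> itself.\<close>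
  define Q where "Q y = y - R y" for y
  have Q: "linear Q" unfolding Q_def by (intro linear_compose_sub linear_ident R)
  have QE: "Q e = 0" if "e \<in> E" for e using R(3)[OF that] by (simp add: Q_def)
  have yQ: "y - Q y \<in> E" for y using R(1) by (auto simp: Q_def)
  define Df where "Df x = frechet_derivative f (at x)" for x
  have Dflin: "linear (Df x)" if "x \<in> U" for x
    unfolding Df_def using has_derivative_linear[OF smooth_on_has_derivative[OF D(3) that]] .
  \<comment> \<open>\<open>B y v\<close> is the field \<open>A v\<close> in chart coordinates,
    reduced to its component off the slice.\<close>
  define B where "B y v = Q (Df (g y) (A (g y) v))" for y v
  define V1 where "V1 = V \<inter> g -` Z"
  have V1: "open V1" unfolding V1_def
    by (rule continuous_open_preimage[OF smooth_on_imp_continuous_on[OF D(4)] D(2) Z(1)])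
  have gV1: "g y \<in> U" "g y \<in> Z" if "y \<in> V1" for y using that D by (auto simp: V1_def)
  have y0: "f z0 \<in> V1" "f z0 \<in> E" using zU D Z slice M(2) by (auto simp: V1_def)
  have Blin: "linear (B y)" if "y \<in> V1" for y
    unfolding B_def using linear_compose[OF linear_compose[OF lin[OF gV1(2)] Dflin[OF gV1(1)]] Q, of y y] that
    by (simp add: o_def)
  have Bs: "smooth_on V1 (\<lambda>y. B y v)" for v
    unfolding smooth_on_fam_Ck_iff
  proof
    fix k
    have g: "fam_Ck k {0::real} V1 (\<lambda>_. g)"
      by (rule smooth_on_fam_Ck[OF smooth_on_subset[OF D(4)]]) (auto simp: V1_def)
    have 1: "fam_Ck k {0::real} V1 (\<lambda>_ y. A (g y) v)"
      by (rule fam_Ck_compose[where F = "\<lambda>_ z. A z v" and f = "\<lambda>_. g", OF V1 Z(1) smooth_on_fam_Ck[OF A] g])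
        (use gV1 in auto)
    have 2: "fam_Ck k {0::real} V1 (\<lambda>_ y. Df (g y) c)" for c
      unfolding Df_def
      by (rule fam_Ck_compose[where F = "\<lambda>_ x. frechet_derivative f (at x) c" and f = "\<lambda>_. g",
            OF V1 D(1) smooth_on_fam_Ck[OF smooth_on_derivative[OF D(3)]] g])
        (use gV1 in auto)
    have "fam_Ck k {0::real} V1 (\<lambda>_ y. \<Sum>c\<in>Basis. (A (g y) v \<bullet> c) *\<^sub>R Df (g y) c)"
      by (intro fam_Ck_sum V1 fam_Ck_bilinear[OF V1 bounded_bilinear_scaleR]
        fam_Ck_bounded_linear[OF V1 bounded_linear_inner_left 1] 2)
    then have "fam_Ck k {0::real} V1 (\<lambda>_ y. Df (g y) (A (g y) v))"
      by (rule fam_Ck_cong[OF V1, rotated]) (rule linear_Basis_sum[OF Dflin, symmetric], rule gV1)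
    then show "fam_Ck k {0::real} V1 (\<lambda>_ y. B y v)"
      unfolding B_def by (rule fam_Ck_bounded_linear[OF V1 linear_conv_bounded_linear[THEN iffD1, OF Q]])
  qed
  have B0: "B y v = 0" if y: "y \<in> V1" "y \<in> E" for y v
  proof -
    have "y \<in> f ` (M \<inter> U)" using y slice by (auto simp: V1_def)
    then have gy: "g y \<in> M" "g y \<in> U" "g y \<in> Z" using D gV1[OF y(1)] by auto
    have "(Q \<circ> Df (g y)) (A (g y) v) = 0"
    proof (rule linear_eq_0_on_span[OF linear_compose[OF Dflin[OF gy(2)] Q] _ tan[OF gy(1,3)]])
      show "(Q \<circ> Df (g y)) v = 0" if "v \<in> tangent_space M (g y)" for v
        using tangent_vector_in_slice[OF d gy(2) that Q] QE slice by (force simp: Df_def)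
    qed
    then show ?thesis by (simp add: B_def)
  qed
  obtain \<rho> where \<rho>: "\<rho> > 0" "cball (f z0) \<rho> \<subseteq> V1" using V1 y0 open_contains_cball by blast
  have Bk: "higher_differentiable_on (Suc 0) V1 (\<lambda>y. B y v)" for v using Bs[of v] unfolding smooth_on_def ..
  obtain C where C: "C > 0" "\<And>y y' v. y \<in> cball (f z0) \<rho> \<Longrightarrow> y' \<in> cball (f z0) \<rho> \<Longrightarrow>
      norm (B y v - B y' v) \<le> C * norm (y - y') * norm v"
    using linear_family_lipschitz[OF Bk Blin compact_cball convex_cball \<rho>(2)] by metis
  have cQ: "continuous_on UNIV (\<lambda>y. y - Q y)"
    by (intro continuous_intros linear_continuous_on linear_conv_bounded_linear[THEN iffD1, OF Q])
  \<comment> \<open>Both \<open>y\<close> and its projection \<open>y - Q y\<close> to the slice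
    must lie in the ball, so that the Lipschitz bound compares \<open>B y v\<close> with the zero
    value on the slice.\<close>
  define Y where "Y = ball (f z0) \<rho> \<inter> (\<lambda>y. y - Q y) -` ball (f z0) \<rho>"
  have Y: "open Y" unfolding Y_def using cQ by (intro open_Int open_ball) (simp add: continuous_on_open_vimage)
  have BY: "norm (B y v) \<le> C * norm (Q y) * norm v" if "y \<in> Y" for y v
  proof -
    have y: "y \<in> cball (f z0) \<rho>" "y - Q y \<in> cball (f z0) \<rho>" using that by (auto simp: Y_def)
    have "B (y - Q y) v = 0" using B0[OF _ yQ] y(2) \<rho>(2) by blast
    then show ?thesis using C(2)[OF y, of v] by simp
  qed
  define W where "W = (U \<inter> f -` Y) \<inter> Z"
  show ?thesis
  proof (rule that[of W "1 / (2 * C)"], safe)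
    show "open W" unfolding W_def
      by (intro open_Int Z(1) continuous_open_preimage[OF smooth_on_imp_continuous_on[OF D(3)] D(1) Y])
    show "z0 \<in> W" using zU Z y0 \<rho>(1) QE by (auto simp: W_def Y_def)
    show "1 / (2 * C) > 0" using C by simp
    fix c :: "real \<Rightarrow> 'a" and v
    assume v: "norm v \<le> 1 / (2 * C)" and c0: "c 0 \<in> M" and cW: "c ` {0..1} \<subseteq> W"
      and "\<forall>t\<in>{0..1}. (c has_vector_derivative A (c t) v) (at t within {0..1})"
    then have cd: "\<And>t. t \<in> {0..1} \<Longrightarrow> (c has_vector_derivative A (c t) v) (at t within {0..1})" by blast
    have cU: "c t \<in> U" "f (c t) \<in> Y" if "t \<in> {0..1}" for t
      using subsetD[OF cW imageI[OF that]] by (auto simp: W_def)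
    define q where "q t = Q (f (c t))" for t
    have qd: "(q has_derivative (\<lambda>h. h *\<^sub>R B (f (c t)) v)) (at t within {0..1})" if t: "t \<in> {0..1}" for t
    proof -
      have "((\<lambda>t. f (c t)) has_derivative (\<lambda>h. Df (c t) (h *\<^sub>R A (c t) v))) (at t within {0..1})"
        unfolding Df_def
        by (rule has_derivative_compose[OF cd[OF t, unfolded has_vector_derivative_def] smooth_on_has_derivative[OF D(3) cU(1)[OF t]]])
      then have "(q has_derivative (\<lambda>h. Q (Df (c t) (h *\<^sub>R A (c t) v)))) (at t within {0..1})"
        unfolding q_def by (rule bounded_linear.has_derivative[OF linear_conv_bounded_linear[THEN iffD1, OF Q]])
      then show ?thesis
        using D(6)[OF cU(1)[OF t]] by (simp add: B_def linear_cmul[OF Dflin[OF cU(1)[OF t]]] linear_cmul[OF Q])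
    qed
    have cq: "continuous_on {0..1} q"
      unfolding continuous_on_eq_continuous_within by (intro ballI has_derivative_continuous[OF qd])
    obtain t where t: "t \<in> {0..1}" "\<And>s. s \<in> {0..1} \<Longrightarrow> norm (q s) \<le> norm (q t)"
      using continuous_attains_sup[OF compact_Icc _ continuous_on_norm[OF cq]] by auto
    \<comment> \<open>The bound \<open>1 / (2 * C)\<close> on \<open>v\<close> makes the derivative
      of \<open>q\<close> at most half of the maximum of \<open>norm q\<close>. As
      \<open>q 0 = 0\<close> and the time interval has length one, that maximum is zero.\<close>
    have "norm (q t - q 0) \<le> (norm (q t) / 2) * norm (t - 0)"
    proof (rule differentiable_bound[OF convex_real_interval(5) qd])
      fix s :: real assume s: "s \<in> {0..1}"
      show "onorm (\<lambda>h. h *\<^sub>R B (f (c s)) v) \<le> norm (q t) / 2"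
      proof (rule onorm_le)
        fix h :: real
        have "norm (B (f (c s)) v) \<le> C * norm (q s) * norm v"
          using BY[OF cU(2)[OF s]] by (simp add: q_def)
        also have "\<dots> \<le> C * norm (q t) * (1 / (2 * C))"
          using C(1) t(2)[OF s] v by (intro mult_mono) auto
        also have "\<dots> = norm (q t) / 2" using C(1) by simp
        finally have "\<bar>h\<bar> * norm (B (f (c s)) v) \<le> \<bar>h\<bar> * (norm (q t) / 2)"
          by (rule mult_left_mono) simp
        then show "norm (h *\<^sub>R B (f (c s)) v) \<le> norm (q t) / 2 * norm h"
          by (simp add: mult.commute)
      qed
    qed (use t in auto)
    moreover have "q 0 = 0"
    proof -
      have "f (c 0) \<in> E" using slice c0 cU(1)[of 0] by auto
      then show ?thesis by (simp add: q_def QE)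
    qed
    moreover have "norm (q t) / 2 * norm (t - 0) \<le> norm (q t) / 2"
      using t(1) by (intro mult_right_le_one_le) auto
    ultimately have "norm (q t) \<le> norm (q t) / 2" by (metis diff_zero order_trans)
    then have "norm (q t) = 0" by simp
    then have "q 1 = 0" using t(2)[of 1] by simp
    then have "f (c 1) \<in> E" using yQ[of "f (c 1)"] by (simp add: q_def)
    then have "f (c 1) \<in> f ` (M \<inter> U)" using slice D(5)[OF cU(1)[of 1]] by auto
    then show "c 1 \<in> M" using D(6) cU(1)[of 1] by (metis IntD1 IntD2 atLeastAtMost_iff image_iff order_refl zero_le_one)
  qed
qed

theorem theorem3p4:
  fixes m n p :: nat
    and \<O> \<Lambda> :: "(real ^ 'N) set"
    and s :: "nat \<Rightarrow> real ^ 'N \<Rightarrow> real ^ 'N"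
  assumes "1 \<le> m" and "m \<le> n" and "1 \<le> p"
    and "CARD('N) = n + p"
    and "open \<O>"
    and "partial_frame \<O> m s"
    and "in_involution \<O> m s"
    and "\<Lambda> \<subseteq> \<O>"
    and "embedded_submanifold (n - m) \<Lambda>"
    and "\<And>z. z \<in> \<Lambda> \<Longrightarrow> span ((\<lambda>i. s i z) ` {1..m}) \<inter> tangent_space \<Lambda> z = {0}"
    and "\<And>z. z \<in> \<Lambda> \<Longrightarrow>
           dim {u + v | u v. u \<in> span ((\<lambda>i. s i z) ` {1..m}) \<and> v \<in> tangent_space \<Lambda> z} = n"
  shows "\<forall>z\<in>\<Lambda>. \<exists>U \<Gamma>.
           integral_extension \<O> m s \<Lambda> n z U \<Gamma> \<and>
           (\<forall>U' \<Gamma>'. integral_extension \<O> m s \<Lambda> n z U' \<Gamma>' \<longrightarrow>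
              (\<exists>W. integral_extension \<O> m s \<Lambda> n z W (\<Gamma> \<inter> \<Gamma>' \<inter> W)))"
proof
  fix z assume z: "z \<in> \<Lambda>"
  then have zO: "z \<in> \<O>" using assms(8) by blast
  let ?J = "{1..m}"
  obtain U1 V f g E where zU: "z \<in> U1" and d: "diffeomorphism_between U1 V f g" and fz: "f z = 0"
    and E: "subspace E" "dim E = n - m" and slice: "f ` (\<Lambda> \<inter> U1) = E \<inter> V"
    and dg: "\<And>w. frechet_derivative g (at 0) w = w"
    by (rule submanifold_chart[OF assms(9) z]) (assumption | rule that)+
  note D = diffeomorphism_betweenD[OF d]
  have V0: "0 \<in> V" "g 0 = z" using D(5,6)[OF zU] by (simp_all add: fz)
  have gE: "g e \<in> \<Lambda>" if "e \<in> E" "e \<in> V" for e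
  proof -
    have "e \<in> f ` (\<Lambda> \<inter> U1)" using that slice by auto
    then show ?thesis using D(6) by auto
  qed
  \<comment> \<open>The curve \<open>t \<mapsto> g (t e)\<close> runs in \<open>\<Lambda>\<close>
    and has velocity \<open>e\<close>, because \<open>g\<close> has the identity as derivative at 0.
    Transversality to the tangent space thus becomes transversality to \<open>E\<close>.\<close>
  have "e \<in> tangent_space \<Lambda> z" if "e \<in> E" for e
    using derivative_in_tangent_space[OF D(2) V0(1) D(4), of e \<Lambda>] gE subspace_scale[OF E(1) that] by (simp add: V0 dg)
  then have tr: "span ((\<lambda>i. s i z) ` ?J) \<inter> E = {0}"
    using assms(10)[OF z] subspace_0[OF E(1)] span_zero by blast
  obtain P A Z where P: "linear P" "\<And>w. P (P w) = P w" "\<And>e. e \<in> E \<Longrightarrow> P e = 0"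
    and rP: "range P = span ((\<lambda>i. s i z) ` {1..m})"
    and Z: "open Z" "z \<in> Z" "Z \<subseteq> \<O>"
    and A: "\<And>z. z \<in> Z \<Longrightarrow> linear (A z)" "\<And>w. smooth_on Z (\<lambda>z. A z w)" "A z = P"
      "\<And>z w. z \<in> Z \<Longrightarrow> A z (P w) = A z w" "\<And>z w. z \<in> Z \<Longrightarrow> P (A z w) = P w"
      "\<And>z w. z \<in> Z \<Longrightarrow> A z w \<in> span ((\<lambda>i. s i z) ` {1..m})"
      "\<And>z w. z \<in> Z \<Longrightarrow> w \<in> span ((\<lambda>i. s i z) ` {1..m}) \<Longrightarrow> A z (P w) = w"
      "\<And>z u v. z \<in> Z \<Longrightarrow> frechet_derivative (\<lambda>z. A z u) (at z) (A z v) = frechet_derivative (\<lambda>z. A z v) (at z) (A z u)"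
    by (rule adapted_projection[OF assms(5) zO assms(6,7) E(1) tr]) (assumption | rule that)+
  obtain r \<Psi> where r: "r > 0" "\<And>p. p \<in> ball 0 r \<Longrightarrow> p - P p \<in> V" and \<Psi>: "smooth_on (ball 0 r) \<Psi>"
    "\<And>p. p \<in> ball 0 r \<Longrightarrow> \<Psi> p \<in> Z"
    "\<And>p w. p \<in> ball 0 r \<Longrightarrow> P w = w \<Longrightarrow> frechet_derivative \<Psi> (at p) w = A (\<Psi> p) w"
    "\<And>p. p \<in> ball 0 r \<Longrightarrow> P p = 0 \<Longrightarrow> \<Psi> p = g p"
    "\<And>w. frechet_derivative \<Psi> (at 0) w = w"
    by (rule flow_box[OF P(1) Z(1,2) A(1,2,3,4,8) D(2) V0(1) D(4) V0(2) dg]) (assumption | rule that)+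
  have \<Psi>0: "\<Psi> 0 = z" using \<Psi>(4)[of 0] r(1) V0 linear_0[OF P(1)] by simp
  have r0: "0 \<in> ball 0 r" using r(1) by simp
  obtain N' M h where N': "0 \<in> N'" "N' \<subseteq> ball 0 r" and dh: "diffeomorphism_between N' M \<Psi> h"
    by (rule smooth_inverse_function[OF open_ball r0 \<Psi>(1,5)]) (assumption | rule that)+
  note H = diffeomorphism_betweenD[OF dh]
  \<comment> \<open>For \<open>q\<close> in \<open>N\<close> the chart coordinate
    \<open>f (\<Psi> q)\<close> is again in \<open>N'\<close>, where \<open>\<Psi>\<close> is
    injective; this allows it to be compared with \<open>q\<close> itself.\<close>
  define N where "N = N' \<inter> \<Psi> -` (U1 \<inter> f -` N')"
  have "open (U1 \<inter> f -` N')"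
    by (rule continuous_open_preimage[OF smooth_on_imp_continuous_on[OF D(3)] D(1) H(1)])
  then have N: "open N" unfolding N_def
    by (rule continuous_open_preimage[OF smooth_on_imp_continuous_on[OF H(3)] H(1)])
  have N0: "0 \<in> N" using N' zU by (simp add: N_def \<Psi>0 fz)
  have NN': "N \<subseteq> N'" by (auto simp: N_def)
  have Nr: "p \<in> ball 0 r" if "p \<in> N" for p using that NN' N'(2) by auto
  have inj: "p = q" if "p \<in> N'" "q \<in> N'" "\<Psi> p = \<Psi> q" for p q using H(6) that by metis
  \<comment> \<open>This is \<open>range P + E\<close>; the direct sum with a transverse
    \<open>E\<close> has dimension \<open>m + (n - m)\<close>.\<close>
  define F where "F = {p. p - P p \<in> E}"
  have F: "subspace F"
    using E(1) unfolding F_def subspace_def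
    by (auto simp: linear_0[OF P(1)] linear_add[OF P(1)] linear_cmul[OF P(1)] add_diff_add scaleR_diff_right[symmetric])
  have dimF: "dim F = n"
  proof -
    have "F = {x + y |x y. x \<in> range P \<and> y \<in> E}"
    proof (intro equalityI subsetI)
      fix p assume "p \<in> F"
      then have "p = P p + (p - P p)" "p - P p \<in> E" by (auto simp: F_def)
      then show "p \<in> {x + y |x y. x \<in> range P \<and> y \<in> E}" by blast
    next
      fix p assume "p \<in> {x + y |x y. x \<in> range P \<and> y \<in> E}"
      then obtain w y where "p = P w + y" "y \<in> E" by auto
      then show "p \<in> F" by (simp add: F_def linear_add[OF P(1)] P)
    qed
    moreover have "dim {x + y |x y. x \<in> range P \<and> y \<in> E} + dim (range P \<inter> E) = dim (range P) + dim E"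
      by (rule dim_sums_Int[OF linear_subspace_image[OF P(1) subspace_UNIV] E(1)])
    moreover have "dim (range P) = m"
    proof -
      have "inj_on (\<lambda>i. s i z) ?J" "independent ((\<lambda>i. s i z) ` ?J)"
        using assms(6) zO by (auto simp: partial_frame_def)
      then show ?thesis unfolding rP by (simp add: dim_eq_card_independent card_image)
    qed
    ultimately show ?thesis using tr assms(2) E(2) by (simp add: rP)
  qed
  \<comment> \<open>Stated for every small \<open>N2\<close>: the choice \<open>N2 = N\<close> gives
    existence, and a ball gives the intersection in the uniqueness part.\<close>
  have ext: "integral_extension \<O> m s \<Lambda> n z (\<Psi> ` N2) (\<Psi> ` (F \<inter> N2))"
    if N2: "open N2" "N2 \<subseteq> N" "0 \<in> N2" for N2
  proof -
    have N2': "N2 \<subseteq> N'" using N2 NN' by auto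
    have d2: "diffeomorphism_between N2 (\<Psi> ` N2) \<Psi> h"
      by (rule diffeomorphism_between_restrict[OF dh N2(1) N2'])
    note D2 = diffeomorphism_betweenD[OF d2]
    have ZN2: "\<Psi> p \<in> Z" if "p \<in> N2" for p using \<Psi>(2) Nr that N2(2) by blast
    show ?thesis
      unfolding integral_extension_def
    proof (intro conjI ballI)
      show "open (\<Psi> ` N2)" by (rule D2(2))
      show "z \<in> \<Psi> ` N2" using N2(3) \<Psi>0 by force
      show "\<Psi> ` N2 \<subseteq> \<O>" "\<Psi> ` (F \<inter> N2) \<subseteq> \<O>" using ZN2 Z(3) by auto
      show "embedded_submanifold n (\<Psi> ` (F \<inter> N2))"
        unfolding embedded_submanifold_def
      proof (intro ballI exI conjI)
        show "diffeomorphism_between (\<Psi> ` N2) N2 h \<Psi>" by (rule diffeomorphism_between_sym[OF d2])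
        show "h ` (\<Psi> ` (F \<inter> N2) \<inter> \<Psi> ` N2) = F \<inter> N2"
        proof -
          have "\<Psi> ` (F \<inter> N2) \<inter> \<Psi> ` N2 = \<Psi> ` (F \<inter> N2)" by auto
          then show ?thesis using D2(6) by (force simp: image_image)
        qed
      qed (use F dimF in auto)
      show "\<Lambda> \<inter> \<Psi> ` N2 = \<Lambda> \<inter> \<Psi> ` (F \<inter> N2)"
      proof (intro equalityI subsetI)
        fix x assume x: "x \<in> \<Lambda> \<inter> \<Psi> ` N2"
        then obtain q where q: "q \<in> N2" "x = \<Psi> q" by auto
        then have qN: "x \<in> U1" "f x \<in> N'" using N2(2) by (auto simp: N_def)
        then have fx: "f x \<in> E" using slice x by auto
        \<comment> \<open>The coordinate \<open>f x\<close> of a point of \<open>\<Lambda>\<close>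
          lies in the kernel of \<open>P\<close>, where \<open>\<Psi>\<close> agrees with
          \<open>g\<close>. So \<open>f x\<close> and \<open>q\<close> have the same image
          \<open>x\<close>, and injectivity on \<open>N'\<close> identifies them.\<close>
        have "\<Psi> (f x) = g (f x)" using \<Psi>(4) qN(2) N'(2) P(3)[OF fx] by auto
        then have "\<Psi> (f x) = \<Psi> q" using D(6)[OF qN(1)] q by simp
        then have "f x = q" using inj[OF qN(2)] q N2' by auto
        then have "q \<in> F" using fx P(3)[OF fx] by (simp add: F_def)
        then show "x \<in> \<Lambda> \<inter> \<Psi> ` (F \<inter> N2)" using x q by auto
      qed auto
      fix i w assume i: "i \<in> ?J" and "w \<in> \<Psi> ` (F \<inter> N2)"
      then obtain q where q: "q \<in> F" "q \<in> N2" "w = \<Psi> q" by auto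
      \<comment> \<open>\<open>P (s i w)\<close> is a direction of \<open>F\<close>. The derivative
        of \<open>\<Psi>\<close> maps it to \<open>A w (P (s i w))\<close>, which is
        \<open>s i w\<close> because \<open>A w\<close> inverts \<open>P\<close> on the span of the
        frame.\<close>
      have "frechet_derivative \<Psi> (at q) (P (s i w)) \<in> tangent_space (\<Psi> ` (F \<inter> N2)) (\<Psi> q)"
        by (rule derivative_in_tangent_space[OF N2(1) q(2) D2(3)])
          (use q(1) in \<open>auto simp: F_def linear_add[OF P(1)] linear_cmul[OF P(1)] P(2)\<close>)
      moreover have "frechet_derivative \<Psi> (at q) (P (s i w)) = s i w"
        using \<Psi>(3)[of q "P (s i w)"] Nr q N2(2) P(2) A(7)[OF ZN2[OF q(2)], of "s i w"] i by (auto simp: span_base)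
      ultimately show "s i w \<in> tangent_space (\<Psi> ` (F \<inter> N2)) w" using q(3) by simp
    qed
  qed
  show "\<exists>U \<Gamma>. integral_extension \<O> m s \<Lambda> n z U \<Gamma> \<and>
           (\<forall>U' \<Gamma>'. integral_extension \<O> m s \<Lambda> n z U' \<Gamma>' \<longrightarrow>
              (\<exists>W. integral_extension \<O> m s \<Lambda> n z W (\<Gamma> \<inter> \<Gamma>' \<inter> W)))"
  proof (rule exI, rule exI, intro conjI allI impI)
    show "integral_extension \<O> m s \<Lambda> n z (\<Psi> ` N) (\<Psi> ` (F \<inter> N))"
      by (rule ext[OF N order.refl N0])
    fix U' \<Gamma>' assume "integral_extension \<O> m s \<Lambda> n z U' \<Gamma>'"
    then have U': "open U'" "z \<in> U'" and \<Gamma>': "embedded_submanifold n \<Gamma>'" "\<Lambda> \<inter> U' = \<Lambda> \<inter> \<Gamma>'"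
      "\<And>i w. i \<in> ?J \<Longrightarrow> w \<in> \<Gamma>' \<Longrightarrow> s i w \<in> tangent_space \<Gamma>' w"
      by (auto simp: integral_extension_def)
    have z\<Gamma>: "z \<in> \<Gamma>'" using z U'(2) \<Gamma>'(2) by blast
    have tan: "A x w \<in> span (tangent_space \<Gamma>' x)" if "x \<in> \<Gamma>'" "x \<in> Z" for x w
      using A(6)[OF that(2), of w] span_mono[of "(\<lambda>i. s i x) ` ?J" "tangent_space \<Gamma>' x"] \<Gamma>'(3) that(1) by blast
    obtain W1 \<delta> where W1: "open W1" "z \<in> W1" "\<delta> > 0"
      and stay: "\<forall>c v. norm v \<le> \<delta> \<longrightarrow> c 0 \<in> \<Gamma>' \<longrightarrow> c ` {0..1} \<subseteq> W1 \<longrightarrow>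
       (\<forall>t\<in>{0..1}. (c has_vector_derivative A (c t) v) (at t within {0..1})) \<longrightarrow> c (1::real) \<in> \<Gamma>'"
      by (rule integral_curve_stays[OF \<Gamma>'(1) z\<Gamma> Z(1,2) A(1,2) tan]) (assumption | rule that)+
    have "open (N' \<inter> \<Psi> -` (W1 \<inter> U'))"
      by (rule continuous_open_preimage[OF smooth_on_imp_continuous_on[OF H(3)] H(1) open_Int[OF W1(1) U'(1)]])
    then have "open (N \<inter> (N' \<inter> \<Psi> -` (W1 \<inter> U')))" using N by blast
    moreover have "0 \<in> N \<inter> (N' \<inter> \<Psi> -` (W1 \<inter> U'))" using N0 N'(1) W1(2) U'(2) by (simp add: \<Psi>0)
    ultimately obtain r1 where r1: "r1 > 0" "ball 0 r1 \<subseteq> N \<inter> (N' \<inter> \<Psi> -` (W1 \<inter> U'))"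
      using openE by blast
    obtain C where C: "C > 0" "\<And>w. norm (P w) \<le> C * norm w"
      using linear_bounded_pos[OF P(1)] by blast
    \<comment> \<open>\<open>norm (q - P q) + norm (P q)\<close> is at most
      \<open>norm q * (1 + 2 * C)\<close>. This radius keeps the segment from \<open>q - P q\<close>
      to \<open>q\<close> in \<open>ball 0 r1\<close> and makes \<open>P q\<close> a velocity of
      norm below \<open>\<delta>\<close>.\<close>
    define r2 where "r2 = min r1 \<delta> / (1 + 2 * C)"
    have r2: "r2 > 0" "r2 * (1 + 2 * C) = min r1 \<delta>" using r1(1) W1(3) C(1) by (auto simp: r2_def)
    have bound: "norm (q - P q) + norm (P q) < min r1 \<delta>" if "q \<in> ball 0 r2" for q
    proof -
      have "norm (q - P q) + norm (P q) \<le> norm q + 2 * norm (P q)"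
        using norm_triangle_ineq4[of q "P q"] by simp
      also have "\<dots> \<le> norm q * (1 + 2 * C)" using C(2)[of q] by (simp add: algebra_simps)
      also have "\<dots> < r2 * (1 + 2 * C)" using that C(1) by (intro mult_strict_right_mono) auto
      finally show ?thesis using r2(2) by simp
    qed
    have "q \<in> ball 0 r1" if "q \<in> ball 0 r2" for q :: "real ^ 'N"
      using bound[OF that] norm_triangle_ineq[of "q - P q" "P q"] by simp
    then have N2: "ball 0 r2 \<subseteq> N" using r1(2) by blast
    \<comment> \<open>Near \<open>z\<close> only \<open>\<Gamma> \<subseteq> \<Gamma>'\<close> is needed, since then \<open>\<Gamma> \<inter> \<Gamma>'\<close> is locally \<open>\<Gamma>\<close>.\<close>
    have key: "\<Psi> q \<in> \<Gamma>'" if q: "q \<in> F" "q \<in> ball 0 r2" for q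
    proof -
      \<comment> \<open>\<open>e\<close> lies in \<open>E\<close> and \<open>v\<close> in
        \<open>range P\<close>. The curve \<open>c\<close> starts at the point \<open>g e\<close> of
        \<open>\<Lambda>\<close>, follows the field given by \<open>v\<close>, and reaches
        \<open>\<Psi> q\<close> at time 1.\<close>
      define e where "e = q - P q"
      define v where "v = P q"
      define c where "c t = \<Psi> (e + t *\<^sub>R v)" for t
      have path: "e + t *\<^sub>R v \<in> ball 0 r1" if "t \<in> {0..1}" for t
      proof -
        have "norm (e + t *\<^sub>R v) \<le> norm e + \<bar>t\<bar> * norm v" using norm_triangle_ineq[of e "t *\<^sub>R v"] by simp
        also have "\<dots> \<le> norm e + norm v" using that by (simp add: mult_left_le_one_le)
        also have "\<dots> < r1" using bound[OF q(2)] by (simp add: e_def v_def)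
        finally show ?thesis by simp
      qed
      have Pv: "P v = v" by (simp add: v_def P(2))
      have Pe: "P e = 0" by (simp add: e_def linear_diff[OF P(1)] P(2))
      have eN: "e \<in> N \<inter> (N' \<inter> \<Psi> -` (W1 \<inter> U'))" using path[of 0] r1(2) by auto
      have "c 1 \<in> \<Gamma>'"
      proof (rule stay[rule_format, of v])
        show "norm v \<le> \<delta>" using bound[OF q(2)] norm_ge_zero[of "q - P q"] by (simp add: v_def del: norm_ge_zero)
        have "e \<in> V" "e \<in> E" using r(2) Nr q N2 by (auto simp: e_def F_def)
        then have "\<Psi> e \<in> \<Lambda>" using gE \<Psi>(4)[OF _ Pe] Nr eN by auto
        then show "c 0 \<in> \<Gamma>'" using eN \<Gamma>'(2) by (auto simp: c_def)
        show "c ` {0..1} \<subseteq> W1"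
        proof (rule image_subsetI)
          fix t :: real assume "t \<in> {0..1}"
          then show "c t \<in> W1" using subsetD[OF r1(2) path] by (auto simp: c_def)
        qed
        fix t :: real assume t: "t \<in> {0..1}"
        have tr: "e + t *\<^sub>R v \<in> ball 0 r" using path[OF t] r1(2) Nr by blast
        note d\<Psi> = smooth_on_has_derivative[OF \<Psi>(1) tr]
        have "((\<lambda>t. e + t *\<^sub>R v) has_derivative (\<lambda>t. t *\<^sub>R v)) (at t within {0..1})"
          by (auto intro!: derivative_eq_intros)
        then have "(c has_derivative (\<lambda>h. frechet_derivative \<Psi> (at (e + t *\<^sub>R v)) (h *\<^sub>R v))) (at t within {0..1})"
          unfolding c_def by (rule has_derivative_compose) (rule d\<Psi>)
        then show "(c has_vector_derivative A (c t) v) (at t within {0..1})"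
          using \<Psi>(3)[OF tr Pv]
          by (simp add: has_vector_derivative_def linear_cmul[OF has_derivative_linear[OF d\<Psi>]] c_def[of t])
      qed
      then show ?thesis by (simp add: c_def e_def v_def)
    qed
    have "\<Psi> ` (F \<inter> N) \<inter> \<Gamma>' \<inter> \<Psi> ` ball 0 r2 = \<Psi> ` (F \<inter> ball 0 r2)"
    proof (intro equalityI subsetI)
      fix x assume "x \<in> \<Psi> ` (F \<inter> N) \<inter> \<Gamma>' \<inter> \<Psi> ` ball 0 r2"
      then obtain q q' where q: "q \<in> F" "q \<in> N" "x = \<Psi> q" "q' \<in> ball 0 r2" "x = \<Psi> q'" by blast
      have "q' \<in> N'" using q(4) N2 NN' by blast
      then have "q = q'" using inj[of q q'] NN' q by auto
      then show "x \<in> \<Psi> ` (F \<inter> ball 0 r2)" using q by auto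
    qed (use key N2 in auto)
    then have "integral_extension \<O> m s \<Lambda> n z (\<Psi> ` ball 0 r2) (\<Psi> ` (F \<inter> N) \<inter> \<Gamma>' \<inter> \<Psi> ` ball 0 r2)"
      using ext[OF open_ball N2] r2(1) by simp
    then show "\<exists>W. integral_extension \<O> m s \<Lambda> n z W (\<Psi> ` (F \<inter> N) \<inter> \<Gamma>' \<inter> W)" by blast
  qed
qed

end
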